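(* Let $D\subset\mathbb{C}$ be a bounded domain with $C^1$ boundary and suppose $u\in C^\infty(\overline{D})$ is a positive function. For $z\in D$ let $g_z$ be the Green function of the Laplacian on $D$ with pole at $z$, and define $T\phi(z)=\int_D\phi\,u\,g_z\,dA$. For $\epsilon\geq0$ and a bounded Borel function $f$ on $\partial D$, let $\phi_\epsilon$ be the solution to the Dirichlet problem $(\Delta-\epsilon u)\phi_\epsilon=0$ in $D$, $\phi_\epsilon=f$ on $\partial D$. Then $$\phi_\epsilon(z)=\phi_0(z)+\epsilon\int_D u\,\phi_0\,g_z\,dA+o(\epsilon)$$ as $\epsilon\to0$, where the error term converges uniformly in $z$. Moreover, a full series expansion is given by $\phi_\epsilon=\sum_{n=0}^\infty\epsilon^nT^n\phi_0$.
   Context: The Green function $g_z$ of the Laplacian on $D$ solves $\Delta g_z=\delta_z$ in $D$, $g_z=0$ on $\partial D$. $\phi_0$ is the solution of the Dirichlet problem for the Laplacian with boundary data $f$. $T^n$ is the $n$-fold iterate of $T$; $dA$ is area measure.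
   Formalization: The series expansion of φ_ε is asserted for all sufficiently small ε ≥ 0 (0 ≤ ε < ε₀ for some ε₀ > 0, uniform in z), not for every ε ≥ 0; for large ε the series diverges, e.g. for the unit disc with u = 1, f = 1. *)

theory Defs
  imports "HOL-Analysis.Analysis"
begin

definition pd :: "complex \<Rightarrow> (complex \<Rightarrow> real) \<Rightarrow> complex \<Rightarrow> real" where
  "pd v f z = deriv (\<lambda>t::real. f (z + of_real t * v)) 0"

fun iter_pd :: "complex list \<Rightarrow> (complex \<Rightarrow> real) \<Rightarrow> complex \<Rightarrow> real" where
  "iter_pd [] f = f"
| "iter_pd (v # vs) f = pd v (iter_pd vs f)"

definition Ck_on :: "nat \<Rightarrow> complex set \<Rightarrow> (complex \<Rightarrow> real) \<Rightarrow> bool" where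
  "Ck_on k S f \<longleftrightarrow>
     (\<forall>vs. set vs \<subseteq> {1, \<i>} \<and> length vs \<le> k \<longrightarrow>
        continuous_on S (iter_pd vs f) \<and>
        (length vs < k \<longrightarrow>
           (\<forall>v\<in>{1, \<i>}. \<forall>z\<in>S. (\<lambda>t::real. iter_pd vs f (z + of_real t * v)) differentiable (at 0))))"

definition smooth_on :: "complex set \<Rightarrow> (complex \<Rightarrow> real) \<Rightarrow> bool" where
  "smooth_on S f \<longleftrightarrow> (\<forall>k. Ck_on k S f)"

definition smooth_on_closure :: "complex set \<Rightarrow> (complex \<Rightarrow> real) \<Rightarrow> bool" where
  "smooth_on_closure D u \<longleftrightarrow>
     (\<exists>U v. open U \<and> closure D \<subseteq> U \<and> smooth_on U v \<and> (\<forall>w\<in>closure D. v w = u w))"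

definition lap :: "(complex \<Rightarrow> real) \<Rightarrow> complex \<Rightarrow> real" where
  "lap f z = pd 1 (pd 1 f) z + pd \<i> (pd \<i> f) z"

definition harmonic_on :: "complex set \<Rightarrow> (complex \<Rightarrow> real) \<Rightarrow> bool" where
  "harmonic_on S h \<longleftrightarrow> Ck_on 2 S h \<and> (\<forall>w\<in>S. lap h w = 0)"

definition bounded_domain :: "complex set \<Rightarrow> bool" where
  "bounded_domain D \<longleftrightarrow> open D \<and> connected D \<and> bounded D \<and> D \<noteq> {}"

definition C1_boundary :: "complex set \<Rightarrow> bool" where
  "C1_boundary D \<longleftrightarrow>
     (\<forall>p\<in>frontier D. \<exists>r>0. \<exists>\<theta>::real. \<exists>h::real \<Rightarrow> real.
        h C1_differentiable_on UNIV \<and>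
        D \<inter> ball p r = {w \<in> ball p r. h (Re (cis \<theta> * (w - p))) < Im (cis \<theta> * (w - p))})"

text \<open>g z w = g_z(w): Delta g_z = delta_z in D (i.e. g_z(w) = (1/2pi) log|w-z| + harmonic),
  g_z = 0 on the boundary of D.\<close>
definition is_green_function :: "complex set \<Rightarrow> (complex \<Rightarrow> complex \<Rightarrow> real) \<Rightarrow> bool" where
  "is_green_function D g \<longleftrightarrow>
     (\<forall>z\<in>D. (\<exists>h. harmonic_on D h \<and> (\<forall>w\<in>D - {z}. g z w = ln (cmod (w - z)) / (2 * pi) + h w))
            \<and> (\<forall>p\<in>frontier D. ((g z) \<longlongrightarrow> 0) (at p within D)))"

definition dirichlet_classical ::
  "complex set \<Rightarrow> (complex \<Rightarrow> real) \<Rightarrow> (complex \<Rightarrow> real) \<Rightarrow> (complex \<Rightarrow> real) \<Rightarrow> bool" where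
  "dirichlet_classical D V h \<psi> \<longleftrightarrow>
     Ck_on 2 D \<psi> \<and> (\<forall>z\<in>D. lap \<psi> z - V z * \<psi> z = 0) \<and>
     continuous_on (closure D) \<psi> \<and> (\<forall>p\<in>frontier D. \<psi> p = h p)"

text \<open>Solution for bounded Borel data f: phi(z) = integral of f against the
  (Delta - V)-harmonic measure at z, i.e. the finite Borel measure on the boundary
  representing the classical solution operator on continuous data.\<close>
definition dirichlet_solution ::
  "complex set \<Rightarrow> (complex \<Rightarrow> real) \<Rightarrow> (complex \<Rightarrow> real) \<Rightarrow> (complex \<Rightarrow> real) \<Rightarrow> bool" where
  "dirichlet_solution D V f \<phi> \<longleftrightarrow>
     (\<forall>z\<in>D. \<exists>\<mu>. finite_measure \<mu> \<and> space \<mu> = frontier D \<and>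
        sets \<mu> = sets (restrict_space borel (frontier D)) \<and>
        (\<forall>h \<psi>. continuous_on (frontier D) h \<longrightarrow> dirichlet_classical D V h \<psi> \<longrightarrow>
                 \<psi> z = integral\<^sup>L \<mu> h) \<and>
        \<phi> z = integral\<^sup>L \<mu> f)"

definition Top :: "complex set \<Rightarrow> (complex \<Rightarrow> real) \<Rightarrow> (complex \<Rightarrow> complex \<Rightarrow> real)
                    \<Rightarrow> (complex \<Rightarrow> real) \<Rightarrow> complex \<Rightarrow> real" where
  "Top D u g \<phi> z = (LINT w:D|lborel. \<phi> w * u w * g z w)"

end

theory Submission
  imports Defs
begin

text \<open>
  The representing measures \<open>\<mu>\<^sub>\<epsilon>\<^sub>,\<^sub>z\<close> are determined by classical solutions, and those are built from the Green
  function alone. For a polynomial \<open>H\<close> the function \<open>\<psi>\<^sub>0 = H - G(\<Delta>H)\<close>, with \<open>G\<phi>(z) = \<integral> \<phi> g\<^sub>z\<close>, is harmonic with boundary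
  values \<open>H\<close>, and for small \<open>\<epsilon>\<close> the Neumann series of \<open>\<psi> = \<psi>\<^sub>0 + \<epsilon> T\<psi>\<close> solves \<open>(\<Delta> - \<epsilon>u)\<psi> = 0\<close> with the same boundary
  values. This needs \<open>\<Delta>G\<phi> = \<phi>\<close> for \<open>C\<^sup>1\<close> densities and \<open>G\<phi> \<rightarrow> 0\<close> at the boundary, both of which rest on the symmetry
  \<open>g\<^sub>z(w) = g\<^sub>w(z)\<close>. Hence \<open>\<integral> H d\<mu>\<^sub>\<epsilon>\<^sub>,\<^sub>z = \<integral> H d\<mu>\<^sub>0\<^sub>,\<^sub>z + \<epsilon> \<integral> u(w) g\<^sub>z(w) (\<integral> H d\<mu>\<^sub>\<epsilon>\<^sub>,\<^sub>w) dA(w)\<close>; by Stone--Weierstrass and a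
  monotone class argument the same identity holds for bounded Borel data, that is \<open>\<phi>\<^sub>\<epsilon> = \<phi>\<^sub>0 + \<epsilon> T\<phi>\<^sub>\<epsilon>\<close>, and iterating it
  gives the series.
\<close>

section \<open>Directional derivatives and the maximum principle\<close>

text \<open>\<open>dirichlet_solution\<close> constrains the measures only through classical
  solutions with continuous data, and it provides a measure for each z separately. Two obstacles
  follow. First, enough classical solutions have to be produced, or the measures would be
  unconstrained; polynomials suffice, since they are uniformly dense on the compact frontier and
  have polynomial Laplacians. Second, \<open>is_green_function\<close> controls \<open>g z\<close>
  in its second argument alone, whereas the Laplacian and the boundary limits of the Green operator
  concern z. The harmonic measures, that is the case \<epsilon> = 0, bridge this gap: the regular
  part of \<open>g z\<close> at w is minus the integral of ln |z - \<zeta>| / (2 pi) against the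
  measure at w, and there z enters only through a kernel that is smooth off the frontier.
  Measurability in z of the integral of f against the measure at z is not given either; it travels
  with the integral identity when the boundary data are extended. The smallness condition is
  \<epsilon> q < 1, where q = U * Gconst bounds the norm of T on bounded functions.\<close>

definition has_pd :: "(complex \<Rightarrow> real) \<Rightarrow> real \<Rightarrow> complex \<Rightarrow> complex \<Rightarrow> bool" where
  "has_pd f d v z \<longleftrightarrow> ((\<lambda>t::real. f (z + of_real t * v)) has_real_derivative d) (at 0)"

text \<open>\<open>pd\<close> is a \<open>deriv\<close> and has an unspecified value where the
  derivative does not exist. \<open>has_pd\<close> carries existence along with the value, so the
  calculus is done with it and \<open>pd\<close> is recovered at the end.\<close>

lemma has_pd_imp_pd: "has_pd f d v z \<Longrightarrow> pd v f z = d"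
  by (simp add: has_pd_def pd_def DERIV_imp_deriv)

lemma has_pd_differentiable: "has_pd f d v z \<Longrightarrow> (\<lambda>t::real. f (z + of_real t * v)) differentiable (at 0)"
  by (auto simp: has_pd_def real_differentiable_def)

lemma eventually_line_in_open:
  fixes z v :: complex
  assumes "open S" "z \<in> S"
  shows "\<forall>\<^sub>F t::real in nhds 0. z + of_real t * v \<in> S"
proof -
  have "open ((\<lambda>t::real. z + of_real t * v) -` S)"
    by (intro open_vimage continuous_intros assms)
  then show ?thesis
    using eventually_nhds_in_open[of "(\<lambda>t::real. z + of_real t * v) -` S" 0] assms(2) by simp
qed

lemma has_pd_cong:
  assumes "open S" "z \<in> S" "\<And>w. w \<in> S \<Longrightarrow> f w = f' w" "has_pd f d v z"
  shows "has_pd f' d v z"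
proof -
  have "\<forall>\<^sub>F t::real in nhds 0. f (z + of_real t * v) = f' (z + of_real t * v)"
    using eventually_line_in_open[OF assms(1,2)] by eventually_elim (use assms in auto)
  then show ?thesis
    using assms(4) unfolding has_pd_def
    by (subst (asm) DERIV_cong_ev[OF refl _ refl]) auto
qed

text \<open>The definition differentiates at t = 0 only; moving the base point gives the derivative
  along the whole line, as mean value and monotonicity arguments need.\<close>

lemma has_pd_line:
  assumes "has_pd f d v (z + of_real t * v)"
  shows "((\<lambda>s::real. f (z + of_real s * v)) has_real_derivative d) (at t)"
proof -
  have "((\<lambda>s::real. f (z + of_real (t + s) * v)) has_real_derivative d) (at 0)"
    using assms by (simp add: has_pd_def algebra_simps)
  then show ?thesis
    using DERIV_shift[of "\<lambda>s. f (z + of_real s * v)" d 0 t] by (simp add: add.commute)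
qed

lemma has_pd_const: "has_pd (\<lambda>_. c) 0 v z"
  by (simp add: has_pd_def)

lemma has_pd_add: "has_pd f a v z \<Longrightarrow> has_pd f' b v z \<Longrightarrow> has_pd (\<lambda>w. f w + f' w) (a + b) v z"
  unfolding has_pd_def by (rule DERIV_add)

lemma has_pd_diff: "has_pd f a v z \<Longrightarrow> has_pd f' b v z \<Longrightarrow> has_pd (\<lambda>w. f w - f' w) (a - b) v z"
  unfolding has_pd_def by (rule DERIV_diff)

lemma has_pd_minus: "has_pd f a v z \<Longrightarrow> has_pd (\<lambda>w. - f w) (- a) v z"
  unfolding has_pd_def by (rule DERIV_minus)

lemma has_pd_mult:
  "has_pd f a v z \<Longrightarrow> has_pd f' b v z \<Longrightarrow> has_pd (\<lambda>w. f w * f' w) (a * f' z + f z * b) v z"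
  unfolding has_pd_def by (drule (1) DERIV_mult) (simp add: algebra_simps)

lemma has_pd_cmult: "has_pd f a v z \<Longrightarrow> has_pd (\<lambda>w. c * f w) (c * a) v z"
  unfolding has_pd_def by (rule DERIV_cmult)

lemma has_pd_chain:
  assumes "has_pd f a v z" "(h has_real_derivative b) (at (f z))"
  shows "has_pd (\<lambda>w. h (f w)) (b * a) v z"
  using DERIV_chain2[of h b "\<lambda>t. f (z + of_real t * v)" 0 a UNIV] assms unfolding has_pd_def by simp

lemma has_pd_divide:
  assumes "has_pd f a v z" "has_pd h b v z" "h z \<noteq> 0"
  shows "has_pd (\<lambda>w. f w / h w) ((a * h z - f z * b) / (h z * h z)) v z"
  using DERIV_divide[of "\<lambda>t. f (z + of_real t * v)" a 0 UNIV "\<lambda>t. h (z + of_real t * v)" b] assms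
  unfolding has_pd_def by simp

lemma has_pd_Re: "has_pd Re (Re v) v z"
  unfolding has_pd_def by (auto intro!: derivative_eq_intros)

lemma has_pd_Im: "has_pd Im (Im v) v z"
  unfolding has_pd_def by (auto intro!: derivative_eq_intros)

lemma has_pd_translate: "has_pd f d v (z + c) \<Longrightarrow> has_pd (\<lambda>w. f (w + c)) d v z"
  unfolding has_pd_def by (simp add: algebra_simps)

lemma has_pd_translate_diff: "has_pd f d v (z - c) \<Longrightarrow> has_pd (\<lambda>w. f (w - c)) d v z"
  using has_pd_translate[of f d v z "- c"] by simp

lemma has_pd_norm_sq: "has_pd (\<lambda>w. (cmod w)\<^sup>2) (2 * (z \<bullet> v)) v z"
proof -
  have "has_pd (\<lambda>w. Re w * Re w + Im w * Im w) (Re v * Re z + Re z * Re v + (Im v * Im z + Im z * Im v)) v z"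
    by (intro has_pd_add has_pd_mult has_pd_Re has_pd_Im)
  then show ?thesis
    by (simp add: cmod_def power2_eq_square inner_complex_def algebra_simps)
qed

section \<open>Twice continuously differentiable functions in terms of explicit derivatives\<close>

lemma Ck2_D:
  assumes "Ck_on 2 S f" and v: "v \<in> {1, \<i>}" and w: "w \<in> {1, \<i>}" and z: "z \<in> S"
  shows "has_pd f (pd v f z) v z" "has_pd (pd v f) (pd w (pd v f) z) w z"
proof -
  have "(\<lambda>t::real. iter_pd [] f (z + of_real t * v)) differentiable (at 0)"
    using assms unfolding Ck_on_def by (auto dest!: spec[of _ "[]"])
  then show "has_pd f (pd v f z) v z"
    unfolding has_pd_def pd_def by (simp add: DERIV_deriv_iff_real_differentiable)
  have "(\<lambda>t::real. iter_pd [v] f (z + of_real t * w)) differentiable (at 0)"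
    using assms unfolding Ck_on_def by (auto dest!: spec[of _ "[v]"])
  then show "has_pd (pd v f) (pd w (pd v f) z) w z"
    unfolding has_pd_def by (subst (2) pd_def) (simp add: DERIV_deriv_iff_real_differentiable)
qed

lemma Ck2_continuous:
  assumes "Ck_on 2 S f" and v: "v \<in> {1, \<i>}" and w: "w \<in> {1, \<i>}"
  shows "continuous_on S f" "continuous_on S (pd v f)" "continuous_on S (pd w (pd v f))"
  using assms unfolding Ck_on_def
  by (auto dest: spec[of _ "[]"] spec[of _ "[v]"] spec[of _ "[w, v]"])

text \<open>The way C^2 regularity is established from explicit candidates \<open>F\<close> and
  \<open>G\<close>. Since \<open>pd v f\<close> agrees with \<open>F v\<close> only on
  \<open>S\<close>, openness is needed before differentiating a second time.\<close>

lemma Ck2_I: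
  assumes S: "open S" and c0: "continuous_on S f"
    and d1: "\<And>v z. v \<in> {1, \<i>} \<Longrightarrow> z \<in> S \<Longrightarrow> has_pd f (F v z) v z"
    and c1: "\<And>v. v \<in> {1, \<i>} \<Longrightarrow> continuous_on S (F v)"
    and d2: "\<And>v w z. v \<in> {1, \<i>} \<Longrightarrow> w \<in> {1, \<i>} \<Longrightarrow> z \<in> S \<Longrightarrow> has_pd (F v) (G v w z) w z"
    and c2: "\<And>v w. v \<in> {1, \<i>} \<Longrightarrow> w \<in> {1, \<i>} \<Longrightarrow> continuous_on S (G v w)"
  shows "Ck_on 2 S f" "\<And>z. z \<in> S \<Longrightarrow> lap f z = G 1 1 z + G \<i> \<i> z"
proof -
  have p1: "pd v f z = F v z" if "v \<in> {1, \<i>}" "z \<in> S" for v z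
    using d1[OF that] has_pd_imp_pd by blast
  have D2: "has_pd (pd v f) (G v w z) w z" if "v \<in> {1, \<i>}" "w \<in> {1, \<i>}" "z \<in> S" for v w z
    by (rule has_pd_cong[OF S \<open>z \<in> S\<close> _ d2[OF that]]) (use p1 that in auto)
  have p2: "pd w (pd v f) z = G v w z" if "v \<in> {1, \<i>}" "w \<in> {1, \<i>}" "z \<in> S" for v w z
    using D2[OF that] has_pd_imp_pd by blast
  show "lap f z = G 1 1 z + G \<i> \<i> z" if "z \<in> S" for z
    using p2 that by (simp add: lap_def)
  have cF: "continuous_on S (pd v f)" if "v \<in> {1, \<i>}" for v
    by (rule continuous_on_eq[OF c1[OF that]]) (simp add: p1[OF that])
  have cG: "continuous_on S (pd w (pd v f))" if "v \<in> {1, \<i>}" "w \<in> {1, \<i>}" for v w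
    by (rule continuous_on_eq[OF c2[OF that]]) (simp add: p2[OF that])
  \<comment> \<open>In \<open>iter_pd\<close> the head of the list is applied last, hence
    \<open>[w, v]\<close> for \<open>pd w (pd v f)\<close>.\<close>
  have len: "length vs \<le> 2 \<Longrightarrow> vs = [] \<or> (\<exists>v. vs = [v]) \<or> (\<exists>v w. vs = [w, v])" for vs :: "complex list"
    by (auto simp: numeral_2_eq_2 le_Suc_eq length_Suc_conv)
  have "continuous_on S (iter_pd vs f) \<and>
        (length vs < 2 \<longrightarrow>
           (\<forall>v\<in>{1, \<i>}. \<forall>z\<in>S. (\<lambda>t::real. iter_pd vs f (z + of_real t * v)) differentiable (at 0)))"
    if "set vs \<subseteq> {1, \<i>}" "length vs \<le> 2" for vs
    using len[OF that(2)]
  proof (elim disjE exE)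
    assume "vs = []"
    then show ?thesis
      using c0 d1 by (metis has_pd_differentiable iter_pd.simps(1))
  next
    fix v assume vs: "vs = [v]"
    then have "v \<in> {1, \<i>}" using that by simp
    then show ?thesis
      using cF D2 vs by (metis has_pd_differentiable iter_pd.simps)
  next
    fix v w assume "vs = [w, v]"
    then show ?thesis
      using that cG by auto
  qed
  then show "Ck_on 2 S f"
    unfolding Ck_on_def by (intro allI impI, elim conjE)
qed

text \<open>\<open>F\<close> is only assumed differentiable at \<open>z\<close> itself. Its value
  there is 0, so \<open>d > 0\<close> would make it positive just beyond \<open>z\<close> and
  \<open>f\<close> strictly increasing there, against maximality.\<close>

lemma has_pd_second_at_local_max:
  assumes S: "open S" "z \<in> S"
    and d1: "\<And>w. w \<in> S \<Longrightarrow> has_pd f (F w) v w" and d2: "has_pd F d v z"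
    and mx: "\<And>w. w \<in> S \<Longrightarrow> f w \<le> f z"
  shows "d \<le> 0"
proof (rule ccontr)
  assume "\<not> d \<le> 0"
  then have d: "d > 0" by simp
  obtain r where r: "r > 0" "\<And>t. \<bar>t\<bar> < r \<Longrightarrow> z + of_real t * v \<in> S"
    using eventually_line_in_open[OF S, of v] unfolding eventually_nhds_metric
    by (auto simp: dist_real_def)
  have D: "((\<lambda>s. f (z + of_real s * v)) has_real_derivative F (z + of_real t * v)) (at t)"
    if "\<bar>t\<bar> < r" for t
    by (rule has_pd_line[OF d1[OF r(2)[OF that]]])
  have "F (z + of_real 0 * v) = 0"
    by (rule DERIV_local_max[OF D r(1)]) (use r mx in auto)
  then have F0: "F z = 0" by simp
  obtain e where e: "e > 0" "\<And>h. 0 < h \<Longrightarrow> h < e \<Longrightarrow> 0 < F (z + of_real h * v)"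
    using DERIV_pos_inc_right[OF d2[unfolded has_pd_def] d] F0 by auto
  define t where "t = min e r / 2"
  have t: "0 < t" "t < e" "t < r"
    using e r by (auto simp: t_def)
  have "f (z + of_real 0 * v) < f (z + of_real t * v)"
  proof (rule DERIV_pos_imp_increasing_open[OF t(1)])
    show "\<exists>y. ((\<lambda>s. f (z + of_real s * v)) has_real_derivative y) (at x) \<and> y > 0" if "0 < x" "x < t" for x
      using D[of x] e(2)[of x] that t by (intro exI[of _ "F (z + of_real x * v)"]) auto
    show "continuous_on {0..t} (\<lambda>s. f (z + of_real s * v))"
      by (intro continuous_at_imp_continuous_on ballI DERIV_isCont[OF D]) (use t in auto)
  qed
  then show False
    using mx[OF r(2)[of t]] t by simp
qed

text \<open>The boundary condition is one-sided, so it also covers points where \<open>f\<close>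
  tends to minus infinity, such as the pole of a Green function. Adding a small multiple of |w|^2
  makes the Laplacian strictly positive, which is impossible at an interior maximum.\<close>

lemma harmonic_maximum_principle:
  assumes S: "open S" "bounded S" and h: "harmonic_on S f"
    and bd: "\<And>p e. p \<in> frontier S \<Longrightarrow> e > 0 \<Longrightarrow> \<forall>\<^sub>F w in at p within S. f w < e"
    and z: "z \<in> S"
  shows "f z \<le> 0"
proof (rule ccontr)
  define c where "c = f z"
  assume "\<not> f z \<le> 0"
  then have c: "c > 0" by (simp add: c_def)
  have C2: "Ck_on 2 S f" and lap0: "\<And>w. w \<in> S \<Longrightarrow> lap f w = 0"
    using h by (auto simp: harmonic_on_def)
  have cf: "continuous_on S f"
    using Ck2_continuous(1)[OF C2] by auto
  obtain R where R: "R > 0" "\<And>w. w \<in> S \<Longrightarrow> cmod w \<le> R"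
    using S(2) bounded_pos by blast
  \<comment> \<open>Chosen so that the added term is at most c/4 on \<open>S\<close>: at the maximum
    of \<open>F\<close> over \<open>K\<close> the value of f is then at least 3c/4, which lies
    strictly above the level c/2.\<close>
  define \<delta> where "\<delta> = c / (4 * R\<^sup>2)"
  have \<delta>: "\<delta> > 0" using c R by (simp add: \<delta>_def)
  define F where "F w = f w + \<delta> * (cmod w)\<^sup>2" for w
  define K where "K = {w \<in> S. c / 2 \<le> f w}"
  have small: "\<delta> * (cmod w)\<^sup>2 \<le> c / 4" if "w \<in> S" for w
  proof -
    have "(cmod w)\<^sup>2 \<le> R\<^sup>2" using R(2)[OF that] by (simp add: power_mono)
    then have "\<delta> * (cmod w)\<^sup>2 \<le> \<delta> * R\<^sup>2" using \<delta> by simp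
    also have "\<dots> = c / 4" using R by (simp add: \<delta>_def)
    finally show ?thesis .
  qed
  \<comment> \<open>A limit of points of \<open>K\<close> outside \<open>S\<close> would lie on the
    frontier, where the boundary condition with e = c/2 forces f below c/2.\<close>
  have "closed K"
    unfolding closed_sequential_limits
  proof (intro allI impI, elim conjE)
    fix x l assume x: "\<forall>n. x n \<in> K" and l: "x \<longlonglongrightarrow> l"
    have xS: "x n \<in> S" and xc: "c / 2 \<le> f (x n)" for n
      using x by (auto simp: K_def)
    have "l \<in> closure S"
      using xS l closure_sequential by blast
    show "l \<in> K"
    proof (cases "l \<in> S")
      case True
      then have "(\<lambda>n. f (x n)) \<longlonglongrightarrow> f l"
        using cf l xS continuous_on_tendsto_compose[of S f x l sequentially] by auto
      then have "c / 2 \<le> f l"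
        by (rule LIMSEQ_le_const) (use xc in auto)
      then show ?thesis using True by (simp add: K_def)
    next
      case False
      then have "l \<in> frontier S"
        using \<open>l \<in> closure S\<close> S by (simp add: frontier_def interior_open)
      then have ev: "\<forall>\<^sub>F w in at l within S. f w < c / 2"
        by (rule bd) (use c in auto)
      have "filterlim x (at l within S) sequentially"
        using l xS False by (auto simp: filterlim_at intro!: always_eventually)
      then have "\<forall>\<^sub>F n in sequentially. f (x n) < c / 2"
        using eventually_compose_filterlim[OF ev] by blast
      then obtain n where "f (x n) < c / 2"
        using eventually_happens'[OF sequentially_bot] by blast
      then show ?thesis
        using xc[of n] by simp
    qed
  qed
  then have "compact K"
    using bounded_subset[OF S(2), of K] by (auto simp: K_def compact_eq_bounded_closed)
  moreover have "z \<in> K" using z c by (simp add: K_def c_def)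
  moreover have "continuous_on K F"
    unfolding F_def by (intro continuous_intros continuous_on_subset[OF cf]) (auto simp: K_def)
  ultimately obtain w where w: "w \<in> K" "\<And>y. y \<in> K \<Longrightarrow> F y \<le> F w"
    using continuous_attains_sup[of K F] by blast
  have "F z \<ge> c" using \<delta> by (simp add: F_def c_def)
  then have "c \<le> F w" using w(2)[OF \<open>z \<in> K\<close>] by linarith
  moreover have wS: "w \<in> S" using w by (simp add: K_def)
  ultimately have "f w > c / 2"
    using small[OF wS] c by (simp add: F_def)
  define U where "U = {y \<in> S. c / 2 < f y}"
  have "open U"
    using continuous_open_preimage[OF cf S(1), of "{c/2<..}"]
    by (simp add: U_def vimage_def Int_def)
  have "w \<in> U" using wS \<open>f w > c / 2\<close> by (simp add: U_def)
  \<comment> \<open>Summed over the two directions this says that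
    \<open>lap f w + 4 * \<delta>\<close> is at most 0, although f is harmonic.\<close>
  have "pd v (pd v f) w + \<delta> * 2 \<le> 0" if v: "v \<in> {1, \<i>}" for v
  proof (rule has_pd_second_at_local_max[OF \<open>open U\<close> \<open>w \<in> U\<close>, of F "\<lambda>y. pd v f y + \<delta> * (2 * (y \<bullet> v))" v])
    show "has_pd F (pd v f y + \<delta> * (2 * (y \<bullet> v))) v y" if "y \<in> U" for y
      unfolding F_def using that v
      by (intro has_pd_add has_pd_cmult has_pd_norm_sq Ck2_D(1)[OF C2]) (auto simp: U_def)
    have "has_pd (\<lambda>y. y \<bullet> v) 1 v w"
      using v has_pd_Re[of v w] has_pd_Im[of v w] by (auto simp: inner_complex_def)
    then have "has_pd (\<lambda>y. 2 * (y \<bullet> v)) 2 v w"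
      using has_pd_cmult[of "\<lambda>y. y \<bullet> v" 1 v w 2] by simp
    then show "has_pd (\<lambda>y. pd v f y + \<delta> * (2 * (y \<bullet> v))) (pd v (pd v f) w + \<delta> * 2) v w"
      using wS v by (intro has_pd_add has_pd_cmult Ck2_D(2)[OF C2]) auto
    show "F y \<le> F w" if "y \<in> U" for y
      using w(2)[of y] that by (auto simp: U_def K_def)
  qed
  from this[of 1] this[of \<i>] lap0[OF wS] \<delta> show False
    by (simp add: lap_def)
qed

lemma continuous_on_closure_extend:
  fixes G b :: "complex \<Rightarrow> real"
  assumes D: "open D" and G: "continuous_on D G" and b: "continuous_on (frontier D) b"
    and lim: "\<And>p. p \<in> frontier D \<Longrightarrow> (G \<longlongrightarrow> b p) (at p within D)"
  shows "continuous_on (closure D) (\<lambda>w. if w \<in> D then G w else b w)" (is "continuous_on _ ?F")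
proof -
  have cl: "closure D = D \<union> frontier D" and dis: "D \<inter> frontier D = {}"
    using D by (auto simp: frontier_def interior_open closure_subset[THEN subsetD])
  have "(?F \<longlongrightarrow> ?F p) (at p within closure D)" if p: "p \<in> closure D" for p
  proof (cases "p \<in> D")
    case True
    have "(G \<longlongrightarrow> G p) (at p)"
      using G True unfolding continuous_on_eq_continuous_at[OF D] isCont_def by blast
    moreover have "\<forall>\<^sub>F w in at p. w \<in> D"
      using D True eventually_at_in_open' by blast
    ultimately have "(?F \<longlongrightarrow> G p) (at p)"
      by (elim Lim_transform_eventually) (auto elim: eventually_mono)
    then show ?thesis
      using True by (simp add: Lim_at_imp_Lim_at_within)
  next
    case False
    then have pf: "p \<in> frontier D" using p cl by auto
    have "(?F \<longlongrightarrow> b p) (at p within D)"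
      using lim[OF pf] by (rule Lim_transform_eventually) (auto simp: eventually_at_filter)
    moreover have "(?F \<longlongrightarrow> b p) (at p within frontier D)"
    proof (rule Lim_transform_eventually)
      show "(b \<longlongrightarrow> b p) (at p within frontier D)"
        using b pf by (simp add: continuous_on_def)
      show "\<forall>\<^sub>F w in at p within frontier D. b w = ?F w"
        unfolding eventually_at_filter using dis by (intro always_eventually) auto
    qed
    ultimately show ?thesis
      using False unfolding cl by (simp add: at_within_union filterlim_sup)
  qed
  then show ?thesis by (simp add: continuous_on_def)
qed

section \<open>Integrals depending on a parameter\<close>

lemma pred_ball[measurable]: "Measurable.pred borel (\<lambda>x. x \<in> ball (a::complex) r)"
  by (simp add: pred_def)

lemma emeasure_ball_less_top: "emeasure lborel (ball (a::complex) r) < top"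
  using emeasure_bounded_finite[OF bounded_ball[of a r]] by simp

lemma lborel_affine_complex:
  fixes f :: "complex \<Rightarrow> real"
  assumes c: "c \<noteq> 0" and f[measurable]: "f \<in> borel_measurable borel"
  shows lborel_integrable_affine_iff: "integrable lborel (\<lambda>x. f (t + c *\<^sub>R x)) \<longleftrightarrow> integrable lborel f"
    and lborel_integral_affine: "integral\<^sup>L lborel f = \<bar>c\<bar>\<^sup>2 * (\<integral>x. f (t + c *\<^sub>R x) \<partial>lborel)"
proof -
  have eq: "integrable lborel f \<longleftrightarrow> integrable (density (distr lborel borel (\<lambda>x. t + c *\<^sub>R x)) (\<lambda>_. ennreal (\<bar>c\<bar>\<^sup>2))) f"
    by (subst lborel_affine[OF c, of t]) simp
  also have "\<dots> \<longleftrightarrow> integrable lborel (\<lambda>x. \<bar>c\<bar>\<^sup>2 *\<^sub>R f (t + c *\<^sub>R x))"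
    by (simp add: integrable_density integrable_distr_eq)
  finally show "integrable lborel (\<lambda>x. f (t + c *\<^sub>R x)) \<longleftrightarrow> integrable lborel f"
    using c by simp
  have "integral\<^sup>L lborel f = integral\<^sup>L (density (distr lborel borel (\<lambda>x. t + c *\<^sub>R x)) (\<lambda>_. ennreal (\<bar>c\<bar>\<^sup>2))) f"
    by (subst lborel_affine[OF c, of t]) simp
  also have "\<dots> = \<bar>c\<bar>\<^sup>2 * (\<integral>x. f (t + c *\<^sub>R x) \<partial>lborel)"
    by (simp add: integral_density integral_distr)
  finally show "integral\<^sup>L lborel f = \<bar>c\<bar>\<^sup>2 * (\<integral>x. f (t + c *\<^sub>R x) \<partial>lborel)" .
qed

lemma lborel_reflect_complex:
  fixes f :: "complex \<Rightarrow> real"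
  assumes f: "f \<in> borel_measurable borel"
  shows lborel_integrable_reflect_iff: "integrable lborel (\<lambda>x. f (t - x)) \<longleftrightarrow> integrable lborel f"
    and lborel_integral_reflect: "(\<integral>x. f (t - x) \<partial>lborel) = integral\<^sup>L lborel f"
  using lborel_integrable_affine_iff[OF _ f, of "-1" t] lborel_integral_affine[OF _ f, of "-1" t] by simp_all

text \<open>Compares \<open>1 / \<bar>x\<bar>\<close> with a sum of multiples of indicators of dyadic balls.\<close>

lemma integrable_inverse_norm_ball:
  "integrable lborel (\<lambda>x::complex. indicator (ball 0 R) x / cmod x)"
proof (cases "R > 0")
  case False
  then show ?thesis by (simp add: ball_empty)
next
  case R: True
  \<comment> \<open>The coefficient is at least 1/|x| on the annulus R/2^(k+1) <= |x| < R/2^k, and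
    the area of the ball makes the integrals geometric with ratio 1/2.\<close>
  define b where "b k x = ennreal (2 ^ Suc k / R) * indicator (ball (0::complex) (R / 2 ^ k)) x" for k :: nat and x
  have pw: "ennreal (indicator (ball 0 R) x / cmod x) \<le> (\<Sum>k. b k x)" for x :: complex
  proof (cases "x = 0 \<or> x \<notin> ball 0 R")
    case True
    then show ?thesis by auto
  next
    case False
    then have x: "0 < cmod x" "cmod x < R" by auto
    define n where "n = (LEAST n. R / 2 ^ n \<le> cmod x)"
    obtain m where "R / cmod x < 2 ^ m" using real_arch_pow[of 2 "R / cmod x"] by auto
    then have "R / 2 ^ m \<le> cmod x" using x by (simp add: field_simps)
    then have n: "R / 2 ^ n \<le> cmod x" unfolding n_def by (rule LeastI)
    have "n \<noteq> 0" using n x by (cases n) auto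
    then obtain k where k: "n = Suc k" by (cases n) auto
    have "\<not> R / 2 ^ k \<le> cmod x"
      using not_less_Least[of k "\<lambda>n. R / 2 ^ n \<le> cmod x"] k unfolding n_def by simp
    then have "b k x = ennreal (2 ^ Suc k / R)" by (simp add: b_def)
    moreover have "1 / cmod x \<le> 2 ^ Suc k / R" using n x R unfolding k by (simp add: field_simps)
    ultimately have "ennreal (indicator (ball 0 R) x / cmod x) \<le> b k x"
      using False by (simp add: ennreal_leI)
    also have "\<dots> = (\<Sum>j\<in>{k}. b j x)" by simp
    also have "\<dots> \<le> (\<Sum>k. b k x)" by (rule sum_le_suminf) auto
    finally show ?thesis .
  qed
  have bm[measurable]: "b k \<in> borel_measurable lborel" for k unfolding b_def[abs_def] by measurable
  have nb: "(\<integral>\<^sup>+x. b k x \<partial>lborel) = ennreal (2 * pi * R * (1/2) ^ k)" for k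
  proof -
    have "(\<integral>\<^sup>+x. b k x \<partial>lborel) = ennreal (2 ^ Suc k / R) * ennreal (pi * (R / 2 ^ k)\<^sup>2)"
      using R unfolding b_def
      by (subst nn_integral_cmult) (auto simp: emeasure_ball unit_ball_vol_2)
    also have "\<dots> = ennreal (2 ^ Suc k / R * (pi * (R / 2 ^ k)\<^sup>2))"
      using R by (subst ennreal_mult) auto
    also have "2 ^ Suc k / R * (pi * (R / 2 ^ k)\<^sup>2) = 2 * pi * R * (1/2) ^ k"
      using R by (simp add: field_simps power2_eq_square)
    finally show ?thesis .
  qed
  have "(\<integral>\<^sup>+x. ennreal (indicator (ball 0 R) x / cmod x) \<partial>lborel) \<le> (\<integral>\<^sup>+x. (\<Sum>k. b k x) \<partial>lborel)"
    by (intro nn_integral_mono pw)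
  also have "\<dots> = (\<Sum>k. ennreal (2 * pi * R * (1/2) ^ k))"
    by (subst nn_integral_suminf) (auto simp: nb)
  also have "\<dots> < \<infinity>"
  proof -
    have "summable (\<lambda>k. 2 * pi * R * (1/2::real) ^ k)"
      by (intro summable_mult summable_geometric) auto
    then show ?thesis
      using R by (subst suminf_ennreal2) auto
  qed
  finally show ?thesis
    by (intro integrableI_nonneg) auto
qed

section \<open>Differentiation and continuity under the integral sign\<close>

lemma has_pd_increment_bound:
  assumes "cmod v = 1" "\<And>y. y \<in> ball z r \<Longrightarrow> has_pd f (F y) v y"
    "\<And>y. y \<in> ball z r \<Longrightarrow> \<bar>F y\<bar> \<le> B" "\<bar>t\<bar> < r"
  shows "\<bar>f (z + of_real t * v) - f z\<bar> \<le> B * \<bar>t\<bar>"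
proof -
  have inb: "z + of_real s * v \<in> ball z r" if "s \<in> {-r<..<r}" for s
    using that assms(1) by (auto simp: dist_norm norm_mult)
  have "norm (f (z + of_real t * v) - f (z + of_real 0 * v)) \<le> B * norm (t - 0)"
  proof (rule field_differentiable_bound[of "{-r<..<r}" _ "\<lambda>s. F (z + of_real s * v)"])
    show "((\<lambda>s. f (z + of_real s * v)) has_field_derivative F (z + of_real s * v)) (at s within {-r<..<r})"
      if "s \<in> {-r<..<r}" for s
      by (rule has_field_derivative_at_within, rule has_pd_line, rule assms(2)[OF inb[OF that]])
    show "norm (F (z + of_real s * v)) \<le> B" if "s \<in> {-r<..<r}" for s
      using assms(3)[OF inb[OF that]] by simp
  qed (use assms(4) in auto)
  then show ?thesis by simp
qed

text \<open>Dominated convergence for the difference quotients: by the mean value bound,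
  \<open>B\<close> dominates them as soon as it dominates the derivatives on a ball.\<close>

lemma has_pd_integral:
  assumes v: "cmod v = 1" and r: "r > 0"
    and int: "\<And>y. y \<in> ball z r \<Longrightarrow> integrable M (k y)"
    and der: "\<And>y x. y \<in> ball z r \<Longrightarrow> x \<in> space M \<Longrightarrow> has_pd (\<lambda>y. k y x) (k' y x) v y"
    and bnd: "\<And>y x. y \<in> ball z r \<Longrightarrow> x \<in> space M \<Longrightarrow> \<bar>k' y x\<bar> \<le> B x"
    and B: "integrable M B" and meas: "k' z \<in> borel_measurable M"
  shows "has_pd (\<lambda>y. \<integral>x. k y x \<partial>M) (\<integral>x. k' z x \<partial>M) v z"
proof -
  let ?K = "\<lambda>y. \<integral>x. k y x \<partial>M" and ?S = "{-r<..<r}"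
  have inb: "z + of_real s * v \<in> ball z r" if "s \<in> ?S" for s
    using that v by (auto simp: dist_norm norm_mult)
  have zb: "z \<in> ball z r" using r by simp
  \<comment> \<open>Working within the interval keeps every point of the sequence in the ball; the
    interval is open, so in the end the filter is \<open>at 0\<close>.\<close>
  have "((\<lambda>h. (?K (z + of_real (0 + h) * v) - ?K (z + of_real 0 * v)) / h) \<longlongrightarrow> (\<integral>x. k' z x \<partial>M)) (at 0 within ?S)"
    unfolding tendsto_at_iff_sequentially
  proof (intro allI impI)
    fix X :: "nat \<Rightarrow> real" assume X: "\<forall>i. X i \<in> ?S - {0}" and X0: "X \<longlonglongrightarrow> 0"
    have XS: "X i \<in> ?S" "X i \<noteq> 0" for i using X by auto
    let ?q = "\<lambda>i x. (k (z + of_real (X i) * v) x - k z x) / X i"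
    have "(\<lambda>i. \<integral>x. ?q i x \<partial>M) \<longlonglongrightarrow> (\<integral>x. k' z x \<partial>M)"
    proof (rule integral_dominated_convergence[OF meas _ B])
      show "?q i \<in> borel_measurable M" for i
        using int[OF inb[OF XS(1)[of i]]] int[OF zb] by measurable
      show "AE x in M. (\<lambda>i. ?q i x) \<longlonglongrightarrow> k' z x"
      proof (rule AE_I2)
        fix x assume "x \<in> space M"
        then have "((\<lambda>h. (k (z + of_real h * v) x - k z x) / h) \<longlongrightarrow> k' z x) (at 0)"
          using der[OF zb, of x] unfolding has_pd_def by (simp add: has_field_derivative_iff)
        moreover have "filterlim X (at 0) sequentially"
          using X0 XS by (auto simp: filterlim_at)
        ultimately show "(\<lambda>i. ?q i x) \<longlonglongrightarrow> k' z x"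
          by (rule filterlim_compose)
      qed
      show "AE x in M. norm (?q i x) \<le> B x" for i
      proof (rule AE_I2)
        fix x assume x: "x \<in> space M"
        have "\<bar>k (z + of_real (X i) * v) x - k z x\<bar> \<le> B x * \<bar>X i\<bar>"
          using XS[of i] by (intro has_pd_increment_bound[OF v der bnd]) (use x in auto)
        then show "norm (?q i x) \<le> B x"
          using XS[of i] by (simp add: abs_divide divide_le_eq)
      qed
    qed
    moreover have "(\<integral>x. ?q i x \<partial>M) = (?K (z + of_real (X i) * v) - ?K z) / X i" for i
      using int[OF inb[OF XS(1)[of i]]] int[OF zb] by simp
    ultimately have "(\<lambda>i. (?K (z + of_real (X i) * v) - ?K z) / X i) \<longlonglongrightarrow> (\<integral>x. k' z x \<partial>M)"
      by (simp only:)
    then show "((\<lambda>h. (?K (z + of_real (0 + h) * v) - ?K (z + of_real 0 * v)) / h) \<circ> X) \<longlonglongrightarrow> (\<integral>x. k' z x \<partial>M)"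
      by (simp add: o_def)
  qed
  moreover have "at (0::real) within ?S = at 0"
    using r by (intro at_within_open) auto
  ultimately show ?thesis
    unfolding has_pd_def by (simp add: has_field_derivative_iff)
qed

text \<open>The derivative is a pointwise limit of difference quotients along a fixed sequence. This
  supplies the measurability that \<open>has_pd_integral\<close> asks for.\<close>

lemma borel_measurable_has_pd:
  assumes S: "open S" "z \<in> S" and m: "\<And>y. y \<in> S \<Longrightarrow> k y \<in> borel_measurable M"
    and d: "\<And>x. x \<in> space M \<Longrightarrow> has_pd (\<lambda>y. k y x) (d x) v z"
  shows "d \<in> borel_measurable M"
proof -
  obtain r where r: "r > 0" "\<And>t. \<bar>t\<bar> < r \<Longrightarrow> z + of_real t * v \<in> S"
    using eventually_line_in_open[OF S, of v] unfolding eventually_nhds_metric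
    by (auto simp: dist_real_def)
  \<comment> \<open>The shift by 2 keeps \<open>X n\<close> strictly below \<open>r\<close> from n =
    0 on.\<close>
  define X where "X n = r / (real n + 2)" for n :: nat
  have X: "X n > 0" "\<bar>X n\<bar> < r" for n
    using r by (auto simp: X_def field_simps intro!: add_pos_nonneg)
  have "X \<longlonglongrightarrow> 0"
    unfolding X_def by real_asymp
  then have lim: "filterlim X (at 0) sequentially"
    using X(1) by (auto simp: filterlim_at intro!: always_eventually less_imp_neq[THEN not_sym])
  show ?thesis
  proof (rule borel_measurable_LIMSEQ_real)
    show "(\<lambda>x. (k (z + of_real (X i) * v) x - k z x) / X i) \<in> borel_measurable M" for i
      using m[OF r(2)[OF X(2)]] m[OF S(2)] by measurable
    show "(\<lambda>i. (k (z + of_real (X i) * v) x - k z x) / X i) \<longlonglongrightarrow> d x" if "x \<in> space M" for x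
      using d[OF that] filterlim_compose[OF _ lim]
      unfolding has_pd_def by (simp add: has_field_derivative_iff)
  qed
qed

lemma continuous_on_integral_dominated:
  assumes m: "\<And>z. z \<in> S \<Longrightarrow> k z \<in> borel_measurable M"
    and c: "\<And>x. x \<in> space M \<Longrightarrow> continuous_on S (\<lambda>z. k z x)"
    and dom: "\<And>z. z \<in> S \<Longrightarrow> \<exists>r>0. \<exists>B. integrable M B \<and> (\<forall>y\<in>S \<inter> ball z r. \<forall>x\<in>space M. \<bar>k y x\<bar> \<le> (B x :: real))"
  shows "continuous_on S (\<lambda>z::complex. \<integral>x. k z x \<partial>M)"
  unfolding continuous_on_def
proof
  fix z assume z: "z \<in> S"
  obtain r B where r: "r > 0" and B: "integrable M B"
    and bd: "\<And>y x. y \<in> S \<Longrightarrow> y \<in> ball z r \<Longrightarrow> x \<in> space M \<Longrightarrow> \<bar>k y x\<bar> \<le> B x"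
    using dom[OF z] by blast
  have "((\<lambda>z. \<integral>x. k z x \<partial>M) \<longlongrightarrow> (\<integral>x. k z x \<partial>M)) (at z within (S \<inter> ball z r))"
    unfolding tendsto_at_iff_sequentially
  proof (intro allI impI)
    fix X assume X: "\<forall>i. X i \<in> S \<inter> ball z r - {z}" and X0: "X \<longlonglongrightarrow> z"
    then have XS: "X i \<in> S" "X i \<in> ball z r" for i by auto
    show "((\<lambda>z. \<integral>x. k z x \<partial>M) \<circ> X) \<longlonglongrightarrow> (\<integral>x. k z x \<partial>M)"
      unfolding o_def
    proof (rule integral_dominated_convergence[OF m[OF z] m[OF XS(1)] B])
      show "AE x in M. (\<lambda>i. k (X i) x) \<longlonglongrightarrow> k z x"
        using continuous_on_tendsto_compose[OF c X0 z] XS by auto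
      show "AE x in M. norm (k (X i) x) \<le> B x" for i
        using bd XS by auto
    qed
  qed
  then show "((\<lambda>z. \<integral>x. k z x \<partial>M) \<longlongrightarrow> (\<integral>x. k z x \<partial>M)) (at z within S)"
    using r by (subst (asm) at_within_nhd[of z "ball z r" _ S]) auto
qed

text \<open>For a finite measure, locally uniform bounds act as dominating constants, so both
  derivatives pass under the integral. It is applied to the logarithmic kernel away from its
  singularity and to averages over \<open>D\<close> of potentials of harmonic measures.\<close>

lemma Ck2_integral:
  assumes M: "finite_measure M" and S: "open S"
    and m: "\<And>z. z \<in> S \<Longrightarrow> k z \<in> borel_measurable M"
    and d1: "\<And>v z x. v \<in> {1, \<i>} \<Longrightarrow> z \<in> S \<Longrightarrow> x \<in> space M \<Longrightarrow> has_pd (\<lambda>y. k y x) (k1 v z x) v z"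
    and d2: "\<And>v w z x. v \<in> {1, \<i>} \<Longrightarrow> w \<in> {1, \<i>} \<Longrightarrow> z \<in> S \<Longrightarrow> x \<in> space M \<Longrightarrow>
               has_pd (\<lambda>y. k1 v y x) (k2 v w z x) w z"
    and c0: "\<And>x. x \<in> space M \<Longrightarrow> continuous_on S (\<lambda>z. k z x)"
    and c1: "\<And>v x. v \<in> {1, \<i>} \<Longrightarrow> x \<in> space M \<Longrightarrow> continuous_on S (\<lambda>z. k1 v z x)"
    and c2: "\<And>v w x. v \<in> {1, \<i>} \<Longrightarrow> w \<in> {1, \<i>} \<Longrightarrow> x \<in> space M \<Longrightarrow> continuous_on S (\<lambda>z. k2 v w z x)"
    and bd: "\<And>z. z \<in> S \<Longrightarrow> \<exists>r>0. \<exists>C. \<forall>y\<in>S \<inter> ball z r. \<forall>x\<in>space M. \<forall>v\<in>{1, \<i>}. \<forall>w\<in>{1, \<i>}.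
               \<bar>k y x\<bar> \<le> C \<and> \<bar>k1 v y x\<bar> \<le> C \<and> \<bar>k2 v w y x\<bar> \<le> C"
  defines "K \<equiv> \<lambda>z. \<integral>x. k z x \<partial>M" and "K1 \<equiv> \<lambda>v z. \<integral>x. k1 v z x \<partial>M" and "K2 \<equiv> \<lambda>v w z. \<integral>x. k2 v w z x \<partial>M"
  shows "Ck_on 2 S K" "\<And>z. z \<in> S \<Longrightarrow> lap K z = K2 1 1 z + K2 \<i> \<i> z"
    "\<And>v z. v \<in> {1, \<i>} \<Longrightarrow> z \<in> S \<Longrightarrow> has_pd K (K1 v z) v z"
    "\<And>v w z. v \<in> {1, \<i>} \<Longrightarrow> w \<in> {1, \<i>} \<Longrightarrow> z \<in> S \<Longrightarrow> has_pd (K1 v) (K2 v w z) w z"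
    "continuous_on S K" "\<And>v. v \<in> {1, \<i>} \<Longrightarrow> continuous_on S (K1 v)"
    "\<And>v w. v \<in> {1, \<i>} \<Longrightarrow> w \<in> {1, \<i>} \<Longrightarrow> continuous_on S (K2 v w)"
proof -
  interpret finite_measure M by (rule M)
  have m1: "k1 v z \<in> borel_measurable M" if "v \<in> {1, \<i>}" "z \<in> S" for v z
    by (rule borel_measurable_has_pd[OF S that(2) m d1[OF that]])
  have m2: "k2 v w z \<in> borel_measurable M" if "v \<in> {1, \<i>}" "w \<in> {1, \<i>}" "z \<in> S" for v w z
    by (rule borel_measurable_has_pd[OF S that(3) m1[OF that(1)] d2[OF that]])
  have unit: "cmod v = 1" if "v \<in> {1, \<i>}" for v using that by auto
  have loc: "\<exists>r>0. \<exists>C. ball z r \<subseteq> S \<and> (\<forall>y\<in>ball z r. \<forall>x\<in>space M. \<forall>v\<in>{1, \<i>}. \<forall>w\<in>{1, \<i>}.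
               \<bar>k y x\<bar> \<le> C \<and> \<bar>k1 v y x\<bar> \<le> C \<and> \<bar>k2 v w y x\<bar> \<le> C)" if z: "z \<in> S" for z
  proof -
    obtain r C where r: "r > 0" "\<forall>y\<in>S \<inter> ball z r. \<forall>x\<in>space M. \<forall>v\<in>{1, \<i>}. \<forall>w\<in>{1, \<i>}.
               \<bar>k y x\<bar> \<le> C \<and> \<bar>k1 v y x\<bar> \<le> C \<and> \<bar>k2 v w y x\<bar> \<le> C"
      using bd[OF z] by blast
    obtain s where s: "s > 0" "ball z s \<subseteq> S" using S z open_contains_ball by blast
    have "ball z (min r s) \<subseteq> S \<inter> ball z r" using s by auto
    then show ?thesis
      using r s by (intro exI[of _ "min r s"] conjI exI[of _ C] ballI) (auto simp: subset_eq)
  qed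
  have int: "integrable M f" if "f \<in> borel_measurable M" "\<And>x. x \<in> space M \<Longrightarrow> \<bar>f x\<bar> \<le> C" for f :: "_ \<Rightarrow> real" and C
    using that by (intro integrable_const_bound[of _ C]) auto
  show D1: "has_pd K (K1 v z) v z" if v: "v \<in> {1, \<i>}" and z: "z \<in> S" for v z
  proof -
    obtain r C where r: "r > 0" "ball z r \<subseteq> S" and C: "\<forall>y\<in>ball z r. \<forall>x\<in>space M. \<forall>v\<in>{1, \<i>}. \<forall>w\<in>{1, \<i>}.
               \<bar>k y x\<bar> \<le> C \<and> \<bar>k1 v y x\<bar> \<le> C \<and> \<bar>k2 v w y x\<bar> \<le> C" using loc[OF z] by blast
    show ?thesis
      unfolding K_def K1_def
      by (rule has_pd_integral[OF unit[OF v] r(1), where B = "\<lambda>_. C"])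
        (use r C v in \<open>auto intro!: int[of _ C] m d1 m1 z\<close>)
  qed
  show D2: "has_pd (K1 v) (K2 v w z) w z" if v: "v \<in> {1, \<i>}" and w: "w \<in> {1, \<i>}" and z: "z \<in> S" for v w z
  proof -
    obtain r C where r: "r > 0" "ball z r \<subseteq> S" and C: "\<forall>y\<in>ball z r. \<forall>x\<in>space M. \<forall>v\<in>{1, \<i>}. \<forall>w\<in>{1, \<i>}.
               \<bar>k y x\<bar> \<le> C \<and> \<bar>k1 v y x\<bar> \<le> C \<and> \<bar>k2 v w y x\<bar> \<le> C" using loc[OF z] by blast
    show ?thesis
      unfolding K1_def K2_def
      by (rule has_pd_integral[OF unit[OF w] r(1), where B = "\<lambda>_. C"])
        (use r C v w in \<open>auto intro!: int[of _ C] m1 d2 m2 z\<close>)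
  qed
  have dom: "\<exists>r>0. \<exists>B. integrable M B \<and> (\<forall>y\<in>S \<inter> ball z r. \<forall>x\<in>space M. \<bar>f y x\<bar> \<le> B x)"
    if zS: "z \<in> S" and fk: "f = k \<or> (\<exists>v\<in>{1,\<i>}. f = k1 v) \<or> (\<exists>v\<in>{1,\<i>}. \<exists>w\<in>{1,\<i>}. f = k2 v w)" for z f
  proof -
    obtain r C where r: "r > 0" and C: "\<forall>y\<in>S \<inter> ball z r. \<forall>x\<in>space M. \<forall>v\<in>{1, \<i>}. \<forall>w\<in>{1, \<i>}.
               \<bar>k y x\<bar> \<le> C \<and> \<bar>k1 v y x\<bar> \<le> C \<and> \<bar>k2 v w y x\<bar> \<le> C" using bd[OF zS] by blast
    show ?thesis
      by (rule exI[of _ r], intro conjI r exI[of _ "\<lambda>_. C"]) (use C fk in auto)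
  qed
  show C0: "continuous_on S K"
    unfolding K_def by (rule continuous_on_integral_dominated[OF m c0 dom]) auto
  show C1: "continuous_on S (K1 v)" if "v \<in> {1, \<i>}" for v
    unfolding K1_def
    by (rule continuous_on_integral_dominated[OF m1[OF that] c1[OF that] dom]) (use that in auto)
  show C2: "continuous_on S (K2 v w)" if "v \<in> {1, \<i>}" "w \<in> {1, \<i>}" for v w
    unfolding K2_def
    by (rule continuous_on_integral_dominated[OF m2[OF that] c2[OF that] dom]) (use that in auto)
  show "lap K z = K2 1 1 z + K2 \<i> \<i> z" if "z \<in> S" for z
    using Ck2_I(2)[OF S C0 D1 C1 D2 C2 that] .
  show "Ck_on 2 S K"
    using Ck2_I(1)[OF S C0 D1 C1 D2 C2] .
qed

section \<open>The logarithmic kernel and first derivatives of its potential\<close>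

text \<open>The value \<open>\<delta> = 0\<close> gives the fundamental solution \<open>ln \<bar>x\<bar> / 2\<pi>\<close>; positive \<open>\<delta>\<close> smooth it out. The suffixes 1, 2, 11 mark
  first and second partial derivatives.\<close>

definition logd :: "real \<Rightarrow> complex \<Rightarrow> real" where
  "logd \<delta> x = ln ((cmod x)\<^sup>2 + \<delta>) / (4 * pi)"

definition logd1 :: "real \<Rightarrow> complex \<Rightarrow> complex \<Rightarrow> real" where
  "logd1 \<delta> v x = (x \<bullet> v) / (2 * pi * ((cmod x)\<^sup>2 + \<delta>))"

definition logd2 :: "complex \<Rightarrow> complex \<Rightarrow> complex \<Rightarrow> real" where
  "logd2 v w x = ((v \<bullet> w) * (cmod x)\<^sup>2 - 2 * (x \<bullet> v) * (x \<bullet> w)) / (2 * pi * (cmod x) ^ 4)"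

lemma logd_0: "logd 0 x = ln (cmod x) / (2 * pi)"
  \<comment> \<open>At \<open>x = 0\<close> both sides vanish by the convention
    \<open>ln 0 = 0\<close>.\<close>
  by (cases "x = 0") (simp_all add: logd_def ln_realpow)

lemma logd_minus_commute: "logd \<delta> (z - w) = logd \<delta> (w - z)"
  by (simp add: logd_def norm_minus_commute)

lemma borel_measurable_logd[measurable]: "logd \<delta> \<in> borel_measurable borel"
  unfolding logd_def[abs_def] by measurable

lemma borel_measurable_logd1[measurable]: "logd1 \<delta> v \<in> borel_measurable borel"
  unfolding logd1_def[abs_def] by measurable

lemma has_pd_logd:
  assumes "(cmod x)\<^sup>2 + \<delta> > 0"
  shows "has_pd (logd \<delta>) (logd1 \<delta> v x) v x"
proof -
  have "has_pd (\<lambda>x. ln ((cmod x)\<^sup>2 + \<delta>)) (1 / ((cmod x)\<^sup>2 + \<delta>) * (2 * (x \<bullet> v) + 0)) v x"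
    by (rule has_pd_chain[OF has_pd_add[OF has_pd_norm_sq has_pd_const]])
      (use assms DERIV_ln_divide in auto)
  from has_pd_cmult[OF this, of "1 / (4 * pi)"] show ?thesis
    by (simp add: logd_def[abs_def] logd1_def field_simps)
qed

lemma has_pd_inner: "has_pd (\<lambda>x. x \<bullet> v) (v \<bullet> w) w x"
proof -
  have "has_pd (\<lambda>x. Re x * Re v + Im x * Im v) (Re w * Re v + Re x * 0 + (Im w * Im v + Im x * 0)) w x"
    by (intro has_pd_add has_pd_mult has_pd_Re has_pd_Im has_pd_const)
  then show ?thesis
    by (simp add: inner_complex_def mult.commute)
qed

lemma has_pd_logd1:
  assumes "x \<noteq> 0"
  shows "has_pd (logd1 0 v) (logd2 v w x) w x"
proof -
  have "has_pd (\<lambda>x. 2 * pi * (cmod x)\<^sup>2) (2 * pi * (2 * (x \<bullet> w))) w x"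
    by (intro has_pd_cmult has_pd_norm_sq)
  from has_pd_divide[OF has_pd_inner[of v w x] this] assms
  have "has_pd (\<lambda>x. (x \<bullet> v) / (2 * pi * (cmod x)\<^sup>2))
     (((v \<bullet> w) * (2 * pi * (cmod x)\<^sup>2) - (x \<bullet> v) * (2 * pi * (2 * (x \<bullet> w)))) /
       ((2 * pi * (cmod x)\<^sup>2) * (2 * pi * (cmod x)\<^sup>2))) w x" by simp
  moreover have "((v \<bullet> w) * (2 * pi * (cmod x)\<^sup>2) - (x \<bullet> v) * (2 * pi * (2 * (x \<bullet> w)))) /
       ((2 * pi * (cmod x)\<^sup>2) * (2 * pi * (cmod x)\<^sup>2)) = logd2 v w x"
    using assms unfolding logd2_def by (simp add: divide_simps power2_eq_square power4_eq_xxxx algebra_simps)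
  ultimately show ?thesis
    by (simp add: logd1_def[abs_def])
qed

text \<open>Harmonicity of ln |x|. The numerators cancel identically, so the origin needs no
  exception.\<close>

lemma logd2_trace: "logd2 1 1 x + logd2 \<i> \<i> x = 0"
proof -
  have "(cmod x)\<^sup>2 = (Re x)\<^sup>2 + (Im x)\<^sup>2" by (simp add: cmod_power2)
  then have "((1::complex) \<bullet> 1) * (cmod x)\<^sup>2 - 2 * (x \<bullet> 1) * (x \<bullet> 1) + ((\<i> \<bullet> \<i>) * (cmod x)\<^sup>2 - 2 * (x \<bullet> \<i>) * (x \<bullet> \<i>)) = 0"
    by (simp add: inner_complex_def power2_eq_square)
  then show ?thesis
    unfolding logd2_def add_divide_distrib[symmetric] by simp
qed

lemma continuous_on_logd1: "\<delta> > 0 \<or> 0 \<notin> S \<Longrightarrow> \<delta> \<ge> 0 \<Longrightarrow> continuous_on S (logd1 \<delta> v)"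
  unfolding logd1_def by (intro continuous_intros) (auto simp: add_nonneg_eq_0_iff)

lemma continuous_on_logd2: "0 \<notin> S \<Longrightarrow> continuous_on S (logd2 v w)"
  unfolding logd2_def by (intro continuous_intros) auto

lemma continuous_on_logd: "\<delta> > 0 \<or> 0 \<notin> S \<Longrightarrow> \<delta> \<ge> 0 \<Longrightarrow> continuous_on S (logd \<delta>)"
  unfolding logd_def
  by (intro continuous_intros) (auto simp: add_nonneg_eq_0_iff)

section \<open>Size of the kernels and their convergence as the smoothing parameter tends to
  0\<close>

lemma two_pi_ge: "2 * pi \<ge> 3" "4 * pi \<ge> 2"
  using pi_gt3 by auto

lemma divide_le_inverse_of_mult_le: "a * c \<le> b \<Longrightarrow> 0 < b \<Longrightarrow> 0 < c \<Longrightarrow> a / b \<le> 1 / (c::real)"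
  by (simp add: field_simps)

text \<open>Free of \<open>\<delta>\<close> and locally integrable in the plane, hence a dominating
  function for \<delta> -> 0.\<close>

lemma abs_logd1_le:
  assumes "cmod v = 1" "\<delta> \<ge> 0"
  shows "\<bar>logd1 \<delta> v x\<bar> \<le> 1 / cmod x"
proof (cases "x = 0")
  case False
  have "\<bar>x \<bullet> v\<bar> \<le> cmod x" using Cauchy_Schwarz_ineq2[of x v] assms by simp
  moreover have "cmod x * cmod x \<le> 2 * pi * ((cmod x)\<^sup>2 + \<delta>)"
    using mult_mono[of 1 "2 * pi" "(cmod x)\<^sup>2" "(cmod x)\<^sup>2 + \<delta>"] two_pi_ge assms by (simp add: power2_eq_square)
  ultimately have "\<bar>x \<bullet> v\<bar> * cmod x \<le> 2 * pi * ((cmod x)\<^sup>2 + \<delta>)"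
    by (meson mult_right_mono norm_ge_zero order_trans)
  moreover have "0 < (cmod x)\<^sup>2 + \<delta>"
    using False assms by (simp add: add_pos_nonneg)
  ultimately show ?thesis
    using False assms unfolding logd1_def abs_divide abs_mult[of "2 * pi"]
    by (intro divide_le_inverse_of_mult_le) auto
qed (simp add: logd1_def)

text \<open>For fixed positive \<open>\<delta>\<close> the gradient of the kernel stays bounded at
  the origin, which lets the smoothed potential be differentiated under the integral. The estimate
  rests on |x| <= 1 + |x|^2.\<close>

lemma abs_logd1_le_const:
  assumes "cmod v = 1" "0 < \<delta>" "\<delta> \<le> 1"
  shows "\<bar>logd1 \<delta> v x\<bar> \<le> 1 / \<delta>"
proof -
  have "\<bar>x \<bullet> v\<bar> \<le> cmod x" using Cauchy_Schwarz_ineq2[of x v] assms by simp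
  moreover have "cmod x \<le> 1 + (cmod x)\<^sup>2"
    using zero_le_power2[of "cmod x - 1/2"] by (simp add: power2_eq_square algebra_simps)
  moreover have "\<delta> * (1 + (cmod x)\<^sup>2) \<le> (cmod x)\<^sup>2 + \<delta>"
    using assms mult_right_mono[of \<delta> 1 "(cmod x)\<^sup>2"] by (simp add: algebra_simps)
  moreover have "1 * ((cmod x)\<^sup>2 + \<delta>) \<le> 2 * pi * ((cmod x)\<^sup>2 + \<delta>)"
    using two_pi_ge assms by (intro mult_right_mono) auto
  moreover have "\<delta> * \<bar>x \<bullet> v\<bar> \<le> \<delta> * (1 + (cmod x)\<^sup>2)"
    using calculation assms by (intro mult_left_mono) auto
  ultimately have "\<delta> * \<bar>x \<bullet> v\<bar> \<le> 2 * pi * ((cmod x)\<^sup>2 + \<delta>)"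
    by simp
  moreover have "0 < (cmod x)\<^sup>2 + \<delta>"
    using assms by (simp add: add_nonneg_pos)
  ultimately show ?thesis
    using assms unfolding logd1_def abs_divide abs_mult[of "2 * pi"]
    by (intro divide_le_inverse_of_mult_le) (auto simp: mult.commute)
qed

lemma abs_logd2_le:
  assumes "cmod v = 1" "cmod w = 1"
  shows "\<bar>logd2 v w x\<bar> \<le> 1 / (cmod x)\<^sup>2"
proof (cases "x = 0")
  case False
  have a: "\<bar>x \<bullet> v\<bar> \<le> cmod x" "\<bar>x \<bullet> w\<bar> \<le> cmod x" "\<bar>v \<bullet> w\<bar> \<le> 1"
    using Cauchy_Schwarz_ineq2[of x v] Cauchy_Schwarz_ineq2[of x w] Cauchy_Schwarz_ineq2[of v w] assms by simp_all
  have "\<bar>(v \<bullet> w) * (cmod x)\<^sup>2\<bar> \<le> 1 * (cmod x)\<^sup>2"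
    unfolding abs_mult using a by (intro mult_mono) auto
  moreover have "\<bar>(x \<bullet> v) * (x \<bullet> w)\<bar> \<le> cmod x * cmod x"
    unfolding abs_mult using a by (intro mult_mono) auto
  ultimately have "\<bar>(v \<bullet> w) * (cmod x)\<^sup>2 - 2 * (x \<bullet> v) * (x \<bullet> w)\<bar> \<le> 3 * (cmod x)\<^sup>2"
    by (simp add: power2_eq_square)
  also have "\<dots> \<le> 2 * pi * (cmod x)\<^sup>2"
    using two_pi_ge by (intro mult_right_mono) auto
  finally have "\<bar>(v \<bullet> w) * (cmod x)\<^sup>2 - 2 * (x \<bullet> v) * (x \<bullet> w)\<bar> * (cmod x)\<^sup>2 \<le> 2 * pi * (cmod x)\<^sup>2 * (cmod x)\<^sup>2"
    by (intro mult_right_mono) auto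
  then show ?thesis
    using False unfolding logd2_def abs_divide
    by (simp add: field_simps abs_mult power4_eq_xxxx power2_eq_square)
qed (simp add: logd2_def)

text \<open>One bound for all \<open>\<delta>\<close> in [0, 1]: from below by ln (1/|x|) <= 1/|x|,
  from above by ln s <= s - 1 with s = |x|^2 + \<delta>, where \<delta> <= 1 absorbs the
  constant.\<close>

lemma abs_logd_le:
  assumes "0 \<le> \<delta>" "\<delta> \<le> 1" "x \<noteq> 0"
  shows "\<bar>logd \<delta> x\<bar> \<le> 1 / cmod x + (cmod x)\<^sup>2"
proof -
  have "ln (1 / cmod x) \<le> 1 / cmod x - 1" using assms by (intro ln_le_minus_one) auto
  then have "- ln (cmod x) \<le> 1 / cmod x" using assms by (simp add: ln_div)
  then have "- (2 / cmod x) \<le> ln ((cmod x)\<^sup>2)" using assms by (simp add: ln_realpow)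
  also have "\<dots> \<le> ln ((cmod x)\<^sup>2 + \<delta>)" using assms by (intro ln_mono) auto
  finally have 1: "- (2 / cmod x) \<le> ln ((cmod x)\<^sup>2 + \<delta>)" .
  have "ln ((cmod x)\<^sup>2 + \<delta>) \<le> (cmod x)\<^sup>2 + \<delta> - 1"
    using assms by (intro ln_le_minus_one) (auto intro: add_pos_nonneg)
  then have 2: "ln ((cmod x)\<^sup>2 + \<delta>) \<le> (cmod x)\<^sup>2" using assms by simp
  have "\<bar>ln ((cmod x)\<^sup>2 + \<delta>)\<bar> \<le> 2 / cmod x + (cmod x)\<^sup>2"
    using 1 2 by (smt (verit) zero_le_power2 divide_nonneg_nonneg norm_ge_zero)
  also have "\<dots> \<le> 2 * (1 / cmod x + (cmod x)\<^sup>2)" by simp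
  also have "\<dots> \<le> 4 * pi * (1 / cmod x + (cmod x)\<^sup>2)"
    using two_pi_ge by (intro mult_right_mono) auto
  finally show ?thesis
    by (simp add: logd_def abs_divide divide_le_eq mult.commute)
qed

lemma AE_lborel_neq: "AE x in lborel. x \<noteq> (a::complex)"
  by (rule AE_lborel_singleton)

lemma integrable_ball_bound:
  "integrable lborel (\<lambda>x::complex. indicator (ball 0 R) x * (1 / cmod x + (cmod x)\<^sup>2))"
proof -
  have "integrable lborel (\<lambda>x::complex. R\<^sup>2 * indicator (ball 0 R) x)"
    by (intro integrable_mult_right integrable_real_indicator) (auto simp: emeasure_ball_less_top)
  then have "integrable lborel (\<lambda>x::complex. indicator (ball 0 R) x * (cmod x)\<^sup>2)"
    by (rule Bochner_Integration.integrable_bound)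
      (auto simp: indicator_def abs_mult intro!: power_mono)
  from Bochner_Integration.integrable_add[OF integrable_inverse_norm_ball[of R] this] show ?thesis
    by (simp add: distrib_left)
qed

lemma integrable_ball_logd:
  assumes "0 \<le> \<delta>" "\<delta> \<le> 1"
  shows "integrable lborel (\<lambda>x::complex. indicator (ball 0 R) x * logd \<delta> x)"
proof (rule Bochner_Integration.integrable_bound[OF integrable_ball_bound[of R]])
  show "AE x in lborel. norm (indicator (ball 0 R) x * logd \<delta> x) \<le> norm (indicator (ball 0 R) x * (1 / cmod x + (cmod x)\<^sup>2))"
    using AE_lborel_neq[of 0] by eventually_elim (use abs_logd_le[OF assms] in \<open>auto simp: indicator_def\<close>)
qed simp

lemma integrable_ball_logd1:
  assumes "0 \<le> \<delta>" "cmod v = 1"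
  shows "integrable lborel (\<lambda>x::complex. indicator (ball 0 R) x * logd1 \<delta> v x)"
  by (rule Bochner_Integration.integrable_bound[OF integrable_inverse_norm_ball[of R]])
    (use abs_logd1_le[OF assms(2,1)] in \<open>auto simp: indicator_def\<close>)

text \<open>Convergence of kernels in L^1 of a ball turns into uniform convergence of their
  convolutions with a bounded density.\<close>

lemma logd_L1_limit:
  defines "\<delta> \<equiv> \<lambda>n. inverse (real (Suc n))"
  shows "(\<lambda>n. \<integral>x. indicator (ball 0 R) x * \<bar>logd (\<delta> n) x - logd 0 x\<bar> \<partial>lborel) \<longlonglongrightarrow> 0"
    and "cmod v = 1 \<Longrightarrow> (\<lambda>n. \<integral>x. indicator (ball 0 R) x * \<bar>logd1 (\<delta> n) v x - logd1 0 v x\<bar> \<partial>lborel) \<longlonglongrightarrow> 0"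
proof -
  have \<delta>: "0 < \<delta> n" "\<delta> n \<le> 1" for n
    unfolding \<delta>_def by (auto simp: field_simps)
  have \<delta>0: "\<delta> \<longlonglongrightarrow> 0"
    unfolding \<delta>_def by (rule LIMSEQ_inverse_real_of_nat)
  have "(\<lambda>n. \<integral>x. indicator (ball 0 R) x * \<bar>logd (\<delta> n) x - logd 0 x\<bar> \<partial>lborel) \<longlonglongrightarrow> integral\<^sup>L lborel (\<lambda>x::complex. 0::real)"
  proof (rule integral_dominated_convergence[where w = "\<lambda>x. 2 * (indicator (ball 0 R) x * (1 / cmod x + (cmod x)\<^sup>2))"])
    show "AE x in lborel. (\<lambda>n. indicator (ball 0 R) x * \<bar>logd (\<delta> n) x - logd 0 x\<bar>) \<longlonglongrightarrow> 0"
      using AE_lborel_neq[of 0]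
    proof eventually_elim
      case (elim x)
      have "(\<lambda>n. logd (\<delta> n) x) \<longlonglongrightarrow> logd 0 x"
        unfolding logd_def using elim by (intro tendsto_intros \<delta>0) auto
      then have "(\<lambda>n. \<bar>logd (\<delta> n) x - logd 0 x\<bar>) \<longlonglongrightarrow> 0"
        using tendsto_rabs_zero LIM_zero by blast
      then show ?case by (rule tendsto_mult_right_zero)
    qed
    show "AE x in lborel. norm (indicator (ball 0 R) x * \<bar>logd (\<delta> n) x - logd 0 x\<bar>)
        \<le> 2 * (indicator (ball 0 R) x * (1 / cmod x + (cmod x)\<^sup>2))" for n
      using AE_lborel_neq[of 0]
    proof eventually_elim
      case (elim x)
      then show ?case
        using abs_logd_le[of "\<delta> n" x] abs_logd_le[of 0 x] \<delta>[of n] by (auto simp: indicator_def)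
    qed
  qed (use integrable_ball_bound in auto)
  then show "(\<lambda>n. \<integral>x. indicator (ball 0 R) x * \<bar>logd (\<delta> n) x - logd 0 x\<bar> \<partial>lborel) \<longlonglongrightarrow> 0" by simp
  assume v: "cmod v = 1"
  have "(\<lambda>n. \<integral>x. indicator (ball 0 R) x * \<bar>logd1 (\<delta> n) v x - logd1 0 v x\<bar> \<partial>lborel) \<longlonglongrightarrow> integral\<^sup>L lborel (\<lambda>x::complex. 0::real)"
  proof (rule integral_dominated_convergence[where w = "\<lambda>x. 2 * (indicator (ball 0 R) x / cmod x)"])
    show "AE x in lborel. (\<lambda>n. indicator (ball 0 R) x * \<bar>logd1 (\<delta> n) v x - logd1 0 v x\<bar>) \<longlonglongrightarrow> 0"
      using AE_lborel_neq[of 0]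
    proof eventually_elim
      case (elim x)
      have "(\<lambda>n. logd1 (\<delta> n) v x) \<longlonglongrightarrow> logd1 0 v x"
        unfolding logd1_def using elim by (intro tendsto_intros \<delta>0) auto
      then have "(\<lambda>n. \<bar>logd1 (\<delta> n) v x - logd1 0 v x\<bar>) \<longlonglongrightarrow> 0"
        using tendsto_rabs_zero LIM_zero by blast
      then show ?case by (rule tendsto_mult_right_zero)
    qed
    show "AE x in lborel. norm (indicator (ball 0 R) x * \<bar>logd1 (\<delta> n) v x - logd1 0 v x\<bar>)
        \<le> 2 * (indicator (ball 0 R) x / cmod x)" for n
    proof (rule AE_I2)
      fix x show "norm (indicator (ball 0 R) x * \<bar>logd1 (\<delta> n) v x - logd1 0 v x\<bar>) \<le> 2 * (indicator (ball 0 R) x / cmod x)"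
        using abs_logd1_le[OF v, of "\<delta> n" x] abs_logd1_le[OF v, of 0 x] \<delta>[of n] by (auto simp: indicator_def)
    qed
  qed (auto intro!: integrable_mult_right integrable_inverse_norm_ball simp del: times_divide_eq_right)
  then show "(\<lambda>n. \<integral>x. indicator (ball 0 R) x * \<bar>logd1 (\<delta> n) v x - logd1 0 v x\<bar> \<partial>lborel) \<longlonglongrightarrow> 0" by simp
qed

section \<open>Convolution of locally integrable kernels with bounded densities of bounded
  support\<close>

definition conv :: "(complex \<Rightarrow> real) \<Rightarrow> (complex \<Rightarrow> real) \<Rightarrow> complex \<Rightarrow> real" where
  "conv \<kappa> \<rho> z = (\<integral>w. \<rho> w * \<kappa> (z - w) \<partial>lborel)"

locale bounded_density =
  fixes \<rho> :: "complex \<Rightarrow> real" and B R :: real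
  assumes meas[measurable]: "\<rho> \<in> borel_measurable borel"
    and bounded: "\<And>w. \<bar>\<rho> w\<bar> \<le> B"
    and support: "\<And>w. w \<notin> ball 0 R \<Longrightarrow> \<rho> w = 0"
begin

lemma B_nonneg: "0 \<le> B"
  using bounded[of 0] by linarith

lemma integrable_density: "integrable lborel \<rho>"
proof (rule Bochner_Integration.integrable_bound)
  show "integrable lborel (\<lambda>x::complex. B * indicator (ball 0 R) x)"
    by (intro integrable_mult_right integrable_real_indicator) (auto simp: emeasure_ball_less_top)
  show "AE x in lborel. norm (\<rho> x) \<le> norm (B * indicator (ball 0 R) x)"
    using bounded support B_nonneg by (intro AE_I2) (auto simp: indicator_def split: if_splits)
qed simp

context
  fixes \<kappa> :: "complex \<Rightarrow> real"
  assumes \<kappa>m[measurable]: "\<kappa> \<in> borel_measurable borel"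
    and \<kappa>i: "\<And>r. integrable lborel (\<lambda>x. indicator (ball 0 r) x * \<kappa> x)"
begin

text \<open>For z and w in the ball of radius R the difference z - w lies in the ball of radius 2R,
  so the kernel is only ever integrated over the larger ball.\<close>

lemma kernel_dominated: 
  assumes "z \<in> ball 0 R"
  shows "\<bar>\<rho> w * \<kappa> (z - w)\<bar> \<le> B * (indicator (ball 0 (2 * R)) (z - w) * \<bar>\<kappa> (z - w)\<bar>)"
proof (cases "w \<in> ball 0 R")
  case True
  then have "z - w \<in> ball 0 (2 * R)"
    using assms norm_triangle_ineq4[of z w] by simp
  then show ?thesis
    using bounded[of w] by (simp add: abs_mult mult_right_mono)
next
  case False
  then show ?thesis using support[of w] B_nonneg by (simp add: indicator_def)
qed

lemma kernel_dominant_integrable: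
  "integrable lborel (\<lambda>w. B * (indicator (ball 0 (2 * R)) (z - w) * \<bar>\<kappa> (z - w)\<bar>))"
proof (rule integrable_mult_right)
  have "integrable lborel (\<lambda>x. indicator (ball 0 (2 * R)) x * \<bar>\<kappa> x\<bar>)"
    using integrable_abs[OF \<kappa>i[of "2 * R"]] by (simp add: abs_mult)
  then show "integrable lborel (\<lambda>w. indicator (ball 0 (2 * R)) (z - w) * \<bar>\<kappa> (z - w)\<bar>)"
    by (subst lborel_integrable_reflect_iff[of "\<lambda>x. indicator (ball 0 (2 * R)) x * \<bar>\<kappa> x\<bar>"]) auto
qed

lemma conv_integrable:
  assumes "z \<in> ball 0 R"
  shows "integrable lborel (\<lambda>w. \<rho> w * \<kappa> (z - w))"
  by (rule Bochner_Integration.integrable_bound[OF kernel_dominant_integrable[of z]])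
    (use kernel_dominated[OF assms] in \<open>auto intro!: AE_I2 intro: order_trans[OF _ abs_ge_self]\<close>)

lemma abs_conv_le:
  assumes "z \<in> ball 0 R"
  shows "\<bar>conv \<kappa> \<rho> z\<bar> \<le> B * (\<integral>x. indicator (ball 0 (2 * R)) x * \<bar>\<kappa> x\<bar> \<partial>lborel)"
proof -
  have "\<bar>conv \<kappa> \<rho> z\<bar> \<le> (\<integral>w. \<bar>\<rho> w * \<kappa> (z - w)\<bar> \<partial>lborel)"
    unfolding conv_def by (rule integral_abs_bound)
  also have "\<dots> \<le> (\<integral>w. B * (indicator (ball 0 (2 * R)) (z - w) * \<bar>\<kappa> (z - w)\<bar>) \<partial>lborel)"
    by (intro integral_mono integrable_abs conv_integrable assms kernel_dominant_integrable kernel_dominated)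
  also have "\<dots> = B * (\<integral>x. indicator (ball 0 (2 * R)) x * \<bar>\<kappa> x\<bar> \<partial>lborel)"
    by (subst lborel_integral_reflect[of "\<lambda>x. B * (indicator (ball 0 (2 * R)) x * \<bar>\<kappa> x\<bar>)"]) auto
  finally show ?thesis .
qed

end

lemma conv_uniform_limit:
  assumes \<kappa>: "\<kappa> \<in> borel_measurable borel" "\<And>r. integrable lborel (\<lambda>x. indicator (ball 0 r) x * \<kappa> x)"
    and \<kappa>n: "\<And>n. \<kappa>n n \<in> borel_measurable borel" "\<And>n r. integrable lborel (\<lambda>x. indicator (ball 0 r) x * \<kappa>n n x)"
    and lim: "(\<lambda>n. \<integral>x. indicator (ball 0 (2 * R)) x * \<bar>\<kappa>n n x - \<kappa> x\<bar> \<partial>lborel) \<longlonglongrightarrow> 0"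
  shows "uniform_limit (ball 0 R) (\<lambda>n. conv (\<kappa>n n) \<rho>) (conv \<kappa> \<rho>) sequentially"
proof (rule uniform_limitI)
  fix e :: real assume e: "e > 0"
  have "(\<lambda>n. B * (\<integral>x. indicator (ball 0 (2 * R)) x * \<bar>\<kappa>n n x - \<kappa> x\<bar> \<partial>lborel)) \<longlonglongrightarrow> B * 0"
    by (intro tendsto_intros lim)
  then have "\<forall>\<^sub>F n in sequentially. B * (\<integral>x. indicator (ball 0 (2 * R)) x * \<bar>\<kappa>n n x - \<kappa> x\<bar> \<partial>lborel) < e"
    using e by (auto dest: order_tendstoD(2)[of _ _ _ e])
  then show "\<forall>\<^sub>F n in sequentially. \<forall>z\<in>ball 0 R. dist (conv (\<kappa>n n) \<rho> z) (conv \<kappa> \<rho> z) < e"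
  proof eventually_elim
    case (elim n)
    show ?case
    proof
      fix z :: complex assume z: "z \<in> ball 0 R"
      have i: "integrable lborel (\<lambda>x. indicator (ball 0 r) x * (\<kappa>n n x - \<kappa> x))" for r
        using Bochner_Integration.integrable_diff[OF \<kappa>n(2) \<kappa>(2), of r n r] by (simp add: algebra_simps)
      have "conv (\<kappa>n n) \<rho> z - conv \<kappa> \<rho> z = conv (\<lambda>x. \<kappa>n n x - \<kappa> x) \<rho> z"
        unfolding conv_def using conv_integrable[OF \<kappa>n z] conv_integrable[OF \<kappa> z]
        by (simp add: right_diff_distrib)
      moreover have "\<bar>conv (\<lambda>x. \<kappa>n n x - \<kappa> x) \<rho> z\<bar> \<le> B * (\<integral>x. indicator (ball 0 (2 * R)) x * \<bar>\<kappa>n n x - \<kappa> x\<bar> \<partial>lborel)"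
        by (rule abs_conv_le[OF _ i z]) (use \<kappa>(1) \<kappa>n(1) in measurable)
      ultimately show "dist (conv (\<kappa>n n) \<rho> z) (conv \<kappa> \<rho> z) < e"
        using elim by (simp add: dist_real_def)
    qed
  qed
qed

lemma has_pd_conv_logd_pos:
  assumes v: "cmod v = 1" and d: "0 < \<delta>" "\<delta> \<le> 1" and z: "z \<in> ball 0 R"
  shows "has_pd (conv (logd \<delta>) \<rho>) (conv (logd1 \<delta> v) \<rho> z) v z"
proof -
  obtain r where r: "r > 0" "ball z r \<subseteq> ball 0 R"
    using openE[OF open_ball z] by blast
  show ?thesis
    unfolding conv_def[abs_def]
  proof (rule has_pd_integral[OF v r(1)])
    show "integrable lborel (\<lambda>w. \<rho> w * logd \<delta> (y - w))" if "y \<in> ball z r" for y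
      using r that d by (intro conv_integrable integrable_ball_logd) auto
    show "has_pd (\<lambda>y. \<rho> x * logd \<delta> (y - x)) (\<rho> x * logd1 \<delta> v (y - x)) v y" for x y
      using d by (intro has_pd_cmult has_pd_translate_diff has_pd_logd) (simp add: add_nonneg_pos)
    show "\<bar>\<rho> x * logd1 \<delta> v (y - x)\<bar> \<le> \<bar>\<rho> x\<bar> * (1 / \<delta>)" for x y
      unfolding abs_mult by (intro mult_left_mono abs_logd1_le_const v d) auto
    show "integrable lborel (\<lambda>x. \<bar>\<rho> x\<bar> * (1 / \<delta>))"
      by (intro integrable_mult_left integrable_abs integrable_density)
  qed simp
qed

lemma continuous_on_conv_logd_pos:
  assumes d: "0 < \<delta>" "\<delta> \<le> 1"
  shows "continuous_on (ball 0 R) (conv (logd \<delta>) \<rho>)"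
  unfolding conv_def[abs_def]
proof (rule continuous_on_integral_dominated)
  show "continuous_on (ball 0 R) (\<lambda>z. \<rho> x * logd \<delta> (z - x))" for x
    using d by (intro continuous_intros continuous_on_compose2[OF continuous_on_logd[of \<delta> UNIV]]) auto
  \<comment> \<open>The argument of the logarithm lies between \<open>\<delta>\<close> and 4R^2 +
    \<delta>, and ln s <= s - 1.\<close>
  define C where "C = \<bar>ln \<delta>\<bar> + 4 * R\<^sup>2 + 1"
  have bd: "\<bar>\<rho> x * logd \<delta> (y - x)\<bar> \<le> \<bar>\<rho> x\<bar> * C" if y: "y \<in> ball 0 R" for x y
  proof (cases "x \<in> ball 0 R")
    case True
    have "cmod (y - x) \<le> 2 * R" using True y norm_triangle_ineq4[of y x] by simp
    then have "(cmod (y - x))\<^sup>2 \<le> (2 * R)\<^sup>2" by (intro power_mono) auto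
    then have s: "(cmod (y - x))\<^sup>2 \<le> 4 * R\<^sup>2" by (simp add: power_mult_distrib)
    have p: "0 < (cmod (y - x))\<^sup>2 + \<delta>" using d by (simp add: add_nonneg_pos)
    have "ln ((cmod (y - x))\<^sup>2 + \<delta>) \<le> 4 * R\<^sup>2"
      using ln_le_minus_one[OF p] s d by simp
    moreover have "ln \<delta> \<le> ln ((cmod (y - x))\<^sup>2 + \<delta>)"
      using d by (intro ln_mono) auto
    moreover have "0 \<le> 4 * R\<^sup>2" by simp
    ultimately have "\<bar>ln ((cmod (y - x))\<^sup>2 + \<delta>)\<bar> \<le> C"
      unfolding C_def by linarith
    also have "C = 1 * C" by simp
    also have "\<dots> \<le> 4 * pi * C" unfolding C_def using two_pi_ge by (intro mult_right_mono) auto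
    finally have "\<bar>logd \<delta> (y - x)\<bar> \<le> C" by (simp add: logd_def abs_divide divide_le_eq mult.commute)
    then show ?thesis unfolding abs_mult by (intro mult_left_mono) auto
  qed (simp add: support)
  fix z assume "z \<in> ball (0::complex) R"
  show "\<exists>r>0. \<exists>B. integrable lborel B \<and>
     (\<forall>y\<in>ball 0 R \<inter> ball z r. \<forall>x\<in>space lborel. \<bar>\<rho> x * logd \<delta> (y - x)\<bar> \<le> B x)"
    by (intro exI[of _ 1] conjI exI[of _ "\<lambda>x. \<bar>\<rho> x\<bar> * C"] ballI bd integrable_mult_left integrable_abs integrable_density) auto
qed simp

lemma continuous_on_conv_logd1_pos:
  assumes v: "cmod v = 1" and d: "0 < \<delta>" "\<delta> \<le> 1"
  shows "continuous_on S (conv (logd1 \<delta> v) \<rho>)"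
  unfolding conv_def[abs_def]
proof (rule continuous_on_integral_dominated)
  show "continuous_on S (\<lambda>z. \<rho> x * logd1 \<delta> v (z - x))" for x
    using d by (intro continuous_intros continuous_on_compose2[OF continuous_on_logd1[of \<delta> UNIV v]]) auto
  fix z assume "z \<in> S"
  show "\<exists>r>0. \<exists>B. integrable lborel B \<and>
     (\<forall>y\<in>S \<inter> ball z r. \<forall>x\<in>space lborel. \<bar>\<rho> x * logd1 \<delta> v (y - x)\<bar> \<le> B x)"
  proof (intro exI[of _ 1] conjI exI[of _ "\<lambda>x. \<bar>\<rho> x\<bar> * (1 / \<delta>)"] ballI)
    show "\<bar>\<rho> x * logd1 \<delta> v (y - x)\<bar> \<le> \<bar>\<rho> x\<bar> * (1 / \<delta>)" for x y
      unfolding abs_mult by (intro mult_left_mono abs_logd1_le_const v d) auto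
    show "integrable lborel (\<lambda>x. \<bar>\<rho> x\<bar> * (1 / \<delta>))"
      by (intro integrable_mult_left integrable_abs integrable_density)
  qed simp
qed simp

lemma conv_logd_approx:
  "uniform_limit (ball 0 R) (\<lambda>n. conv (logd (inverse (real (Suc n)))) \<rho>) (conv (logd 0) \<rho>) sequentially"
  "cmod v = 1 \<Longrightarrow> uniform_limit (ball 0 R) (\<lambda>n. conv (logd1 (inverse (real (Suc n))) v) \<rho>) (conv (logd1 0 v) \<rho>) sequentially"
  by (rule conv_uniform_limit logd_L1_limit integrable_ball_logd integrable_ball_logd1 borel_measurable_logd
      borel_measurable_logd1 | simp add: field_simps)+

lemma continuous_on_conv_logd1:
  assumes v: "cmod v = 1"
  shows "continuous_on (ball 0 R) (conv (logd1 0 v) \<rho>)"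
  by (rule uniform_limit_theorem[OF _ conv_logd_approx(2)[OF v]])
    (auto intro!: always_eventually continuous_on_conv_logd1_pos v simp: field_simps)

text \<open>The translates of the gradient kernel, of size 1/|x|, have no common integrable bound,
  so \<open>has_pd_integral\<close> does not apply. Instead the smoothed potentials have uniformly
  convergent derivatives, and the limit of the derivatives is the derivative of the limit.\<close>

lemma has_pd_conv_logd:
  assumes v: "cmod v = 1" and z: "z \<in> ball 0 R"
  shows "has_pd (conv (logd 0) \<rho>) (conv (logd1 0 v) \<rho> z) v z"
proof -
  let ?\<delta> = "\<lambda>n. inverse (real (Suc n))"
  obtain r where r: "r > 0" "ball z r \<subseteq> ball 0 R"
    using openE[OF open_ball z] by blast
  have inb: "z + of_real s * v \<in> ball 0 R" if "s \<in> {-r<..<r}" for s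
    using that v r by (intro subsetD[OF r(2)]) (auto simp: dist_norm norm_mult)
  have "\<exists>g. \<forall>t\<in>{-r<..<r}. (\<lambda>n. conv (logd (?\<delta> n)) \<rho> (z + of_real t * v)) \<longlonglongrightarrow> g t \<and>
     (g has_derivative (\<lambda>h. conv (logd1 0 v) \<rho> (z + of_real t * v) * h)) (at t within {-r<..<r})"
  proof (rule has_derivative_sequence[where ?x0.0 = 0 and f' = "\<lambda>n t h. conv (logd1 (?\<delta> n) v) \<rho> (z + of_real t * v) * h"])
    show "((\<lambda>t. conv (logd (?\<delta> n)) \<rho> (z + of_real t * v)) has_derivative
          (\<lambda>h. conv (logd1 (?\<delta> n) v) \<rho> (z + of_real t * v) * h)) (at t within {-r<..<r})"
      if "t \<in> {-r<..<r}" for n t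
    proof -
      have \<delta>: "0 < ?\<delta> n" "?\<delta> n \<le> 1" by (auto simp: field_simps)
      show ?thesis
        using has_pd_line[OF has_pd_conv_logd_pos[OF v \<delta> inb[OF that]]]
        unfolding has_field_derivative_def by (rule has_derivative_at_withinI)
    qed
    show "(\<lambda>n. conv (logd (?\<delta> n)) \<rho> (z + of_real 0 * v)) \<longlonglongrightarrow> conv (logd 0) \<rho> z"
      using tendsto_uniform_limitI[OF conv_logd_approx(1) z] by simp
    fix e :: real assume e: "e > 0"
    have "\<forall>\<^sub>F n in sequentially. \<forall>y\<in>ball 0 R. dist (conv (logd1 (?\<delta> n) v) \<rho> y) (conv (logd1 0 v) \<rho> y) < e"
      using uniform_limitD[OF conv_logd_approx(2)[OF v] e] .
    then show "\<forall>\<^sub>F n in sequentially. \<forall>t\<in>{-r<..<r}. \<forall>h. norm (conv (logd1 (?\<delta> n) v) \<rho> (z + of_real t * v) * h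
         - conv (logd1 0 v) \<rho> (z + of_real t * v) * h) \<le> e * norm h"
    proof eventually_elim
      case (elim n)
      show ?case
      proof (intro ballI allI)
        fix t h assume "t \<in> {-r<..<r}"
        then have "\<bar>conv (logd1 (?\<delta> n) v) \<rho> (z + of_real t * v) - conv (logd1 0 v) \<rho> (z + of_real t * v)\<bar> \<le> e"
          using elim inb unfolding dist_real_def by (meson less_imp_le)
        then show "norm (conv (logd1 (?\<delta> n) v) \<rho> (z + of_real t * v) * h
         - conv (logd1 0 v) \<rho> (z + of_real t * v) * h) \<le> e * norm h"
          unfolding left_diff_distrib[symmetric] real_norm_def abs_mult by (rule mult_right_mono) simp
      qed
    qed
  qed (use r in auto)
  then obtain g where g: "\<And>t. t \<in> {-r<..<r} \<Longrightarrow> (\<lambda>n. conv (logd (?\<delta> n)) \<rho> (z + of_real t * v)) \<longlonglongrightarrow> g t"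
    "\<And>t. t \<in> {-r<..<r} \<Longrightarrow> (g has_derivative (\<lambda>h. conv (logd1 0 v) \<rho> (z + of_real t * v) * h)) (at t within {-r<..<r})"
    by blast
  have eq: "g t = conv (logd 0) \<rho> (z + of_real t * v)" if "t \<in> {-r<..<r}" for t
    using LIMSEQ_unique[OF g(1)[OF that] tendsto_uniform_limitI[OF conv_logd_approx(1) inb[OF that]]] .
  have "at (0::real) within {-r<..<r} = at 0"
    using r by (intro at_within_open) auto
  then have "(g has_real_derivative conv (logd1 0 v) \<rho> z) (at 0)"
    using g(2)[of 0] r by (simp add: has_field_derivative_def)
  then show ?thesis
    unfolding has_pd_def
    by (rule has_field_derivative_transform_within_open[of _ _ _ "{-r<..<r}"]) (use r eq in auto)
qed

end

section \<open>The fundamental solution\<close>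

text \<open>The Laplacian of \<open>logd \<delta>\<close>, an approximate identity as \<open>\<delta> \<rightarrow> 0\<close>.\<close>

definition poisson :: "real \<Rightarrow> complex \<Rightarrow> real" where
  "poisson \<delta> x = \<delta> / (pi * ((cmod x)\<^sup>2 + \<delta>)\<^sup>2)"

lemma borel_measurable_poisson[measurable]: "poisson \<delta> \<in> borel_measurable borel"
  unfolding poisson_def[abs_def] by measurable

text \<open>Layer cake: \<open>1 / (t\<^sup>2 + 1)\<^sup>2 = \<integral> 4s / (s\<^sup>2 + 1)\<^sup>3\<close> over \<open>s \<ge> t\<close>, so Fubini reduces the integral to the areas of discs
  and polar coordinates are not needed.\<close>

lemma nn_integral_poisson_1: "(\<integral>\<^sup>+x. ennreal (1 / ((cmod x)\<^sup>2 + 1)\<^sup>2) \<partial>lborel) = ennreal pi"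
proof -
  define h where "h s = 4 * s / (s\<^sup>2 + 1) ^ 3" for s :: real
  have pos: "s\<^sup>2 + 1 \<noteq> 0" "s\<^sup>2 + 1 > 0" for s :: real
    using zero_le_power2[of s] by linarith+
  have sq: "((\<lambda>s. (s\<^sup>2 + 1)\<^sup>2) has_real_derivative 2 * (s\<^sup>2 + 1) * (2 * s)) (at s)" for s :: real
    by (auto intro!: derivative_eq_intros)
  have hm[measurable]: "h \<in> borel_measurable borel"
    unfolding h_def[abs_def] by measurable
  have inner: "(\<integral>\<^sup>+s. ennreal (h s) * indicator {cmod x..} s \<partial>lborel) = ennreal (1 / ((cmod x)\<^sup>2 + 1)\<^sup>2)" for x
  proof -
    have "(\<integral>\<^sup>+s. ennreal (h s) * indicator {cmod x..} s \<partial>lborel) = ennreal (0 - (- 1 / ((cmod x)\<^sup>2 + 1)\<^sup>2))"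
    proof (rule nn_integral_FTC_atLeast)
      show "((\<lambda>s::real. - 1 / (s\<^sup>2 + 1)\<^sup>2) \<longlongrightarrow> 0) at_top" by real_asymp
      show "((\<lambda>s. - 1 / (s\<^sup>2 + 1)\<^sup>2) has_real_derivative h s) (at s)" for s
      proof -
        have "((\<lambda>s. - 1 / (s\<^sup>2 + 1)\<^sup>2) has_real_derivative
            (0 * (s\<^sup>2 + 1)\<^sup>2 - (- 1) * (2 * (s\<^sup>2 + 1) * (2 * s))) / ((s\<^sup>2 + 1)\<^sup>2 * (s\<^sup>2 + 1)\<^sup>2)) (at s)"
          by (rule DERIV_divide[OF DERIV_const sq]) (use pos[of s] in simp)
        \<comment> \<open>Numerators and denominators are matched separately, after which the common
          factor s^2 + 1 cancels.\<close>
        moreover have "(0 * (s\<^sup>2 + 1)\<^sup>2 - (- 1) * (2 * (s\<^sup>2 + 1) * (2 * s))) / ((s\<^sup>2 + 1)\<^sup>2 * (s\<^sup>2 + 1)\<^sup>2)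
            = (4 * s * (s\<^sup>2 + 1)) / ((s\<^sup>2 + 1) ^ 3 * (s\<^sup>2 + 1))"
          by (rule arg_cong2[where f = "(/)"]) algebra+
        moreover have "\<dots> = h s"
          using pos(1)[of s] by (simp add: h_def)
        ultimately show ?thesis by simp
      qed
      show "0 \<le> h s" if "cmod x \<le> s" for s
        using that order_trans[OF norm_ge_zero that] pos(2)[of s] by (auto simp: h_def)
    qed simp
    then show ?thesis by simp
  qed
  have outer: "(\<integral>\<^sup>+x. ennreal (h s) * indicator {cmod x..} s \<partial>lborel) = ennreal (pi * s\<^sup>2 * h s) * indicator {0..} s" for s
  proof (cases "s \<ge> 0")
    case True
    have "(\<integral>\<^sup>+x. ennreal (h s) * indicator {cmod x..} s \<partial>lborel) = (\<integral>\<^sup>+x. ennreal (h s) * indicator (cball (0::complex) s) x \<partial>lborel)"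
      by (intro nn_integral_cong) (auto simp: indicator_def)
    also have "\<dots> = ennreal (h s) * emeasure lborel (cball (0::complex) s)"
      by (subst nn_integral_cmult_indicator) auto
    also have "emeasure lborel (cball (0::complex) s) = ennreal (pi * s\<^sup>2)"
      using True by (simp add: emeasure_cball unit_ball_vol_2)
    also have "ennreal (h s) * \<dots> = ennreal (pi * s\<^sup>2 * h s)"
      using True pos(2)[of s] by (subst ennreal_mult[symmetric]) (auto simp: h_def mult_ac)
    finally show ?thesis using True by simp
  next
    case False
    then have "indicator {cmod x..} s = (0::ennreal)" for x
      using norm_ge_zero[of x] by (auto simp: indicator_def simp del: norm_ge_zero)
    then show ?thesis using False by simp
  qed
  have "(\<integral>\<^sup>+x. ennreal (1 / ((cmod x)\<^sup>2 + 1)\<^sup>2) \<partial>lborel)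
      = (\<integral>\<^sup>+x. (\<integral>\<^sup>+s. ennreal (h s) * indicator {cmod x..} s \<partial>lborel) \<partial>lborel)"
    by (simp add: inner)
  also have "\<dots> = (\<integral>\<^sup>+s. (\<integral>\<^sup>+x. ennreal (h s) * indicator {cmod x..} s \<partial>lborel) \<partial>lborel)"
  proof (rule pair_sigma_finite.Fubini')
    show "pair_sigma_finite (lborel :: real measure) (lborel :: complex measure)"
      by (intro pair_sigma_finite.intro lborel.sigma_finite_measure_axioms)
    have "(\<lambda>(s, x). ennreal (h s) * indicator {p. cmod (snd p) \<le> fst p} (s, x)) \<in> borel_measurable (lborel \<Otimes>\<^sub>M lborel)"
      by measurable
    also have "(\<lambda>(s, x). ennreal (h s) * indicator {p. cmod (snd p) \<le> fst p} (s, x)) =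
        (\<lambda>(s, x). ennreal (h s) * indicator {cmod x..} s)"
      by (auto simp: indicator_def fun_eq_iff)
    finally show "(\<lambda>(s, x). ennreal (h s) * indicator {cmod x..} s) \<in> borel_measurable (lborel \<Otimes>\<^sub>M lborel)" .
  qed
  also have "\<dots> = (\<integral>\<^sup>+s. ennreal (pi * s\<^sup>2 * h s) * indicator {0..} s \<partial>lborel)"
    by (simp add: outer)
  also have "\<dots> = ennreal (pi - pi * 0 ^ 4 / (0\<^sup>2 + 1)\<^sup>2)"
  proof (rule nn_integral_FTC_atLeast)
    \<comment> \<open>An antiderivative of 4 pi s^3 / (s^2 + 1)^3 that vanishes at 0; its limit at
      infinity is the total mass pi.\<close>
    show "((\<lambda>s::real. pi * s ^ 4 / (s\<^sup>2 + 1)\<^sup>2) \<longlongrightarrow> pi) at_top" by real_asymp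
    show "((\<lambda>s. pi * s ^ 4 / (s\<^sup>2 + 1)\<^sup>2) has_real_derivative pi * s\<^sup>2 * h s) (at s)" for s
    proof -
      have "((\<lambda>s. pi * s ^ 4 / (s\<^sup>2 + 1)\<^sup>2) has_real_derivative
          ((pi * (4 * s ^ 3)) * (s\<^sup>2 + 1)\<^sup>2 - (pi * s ^ 4) * (2 * (s\<^sup>2 + 1) * (2 * s))) / ((s\<^sup>2 + 1)\<^sup>2 * (s\<^sup>2 + 1)\<^sup>2)) (at s)"
      proof (rule DERIV_divide[OF _ sq])
        show "((\<lambda>s. pi * s ^ 4) has_real_derivative pi * (4 * s ^ 3)) (at s)"
          by (auto intro!: derivative_eq_intros)
      qed (use pos[of s] in simp)
      moreover have "((pi * (4 * s ^ 3)) * (s\<^sup>2 + 1)\<^sup>2 - (pi * s ^ 4) * (2 * (s\<^sup>2 + 1) * (2 * s))) / ((s\<^sup>2 + 1)\<^sup>2 * (s\<^sup>2 + 1)\<^sup>2)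
          = (pi * s\<^sup>2 * (4 * s) * (s\<^sup>2 + 1)) / ((s\<^sup>2 + 1) ^ 3 * (s\<^sup>2 + 1))"
        by (rule arg_cong2[where f = "(/)"]) algebra+
      moreover have "\<dots> = pi * s\<^sup>2 * h s"
        using pos(1)[of s] by (simp add: h_def)
      ultimately show ?thesis by simp
    qed
    show "0 \<le> pi * s\<^sup>2 * h s" if "0 \<le> s" for s
      using that pos(2)[of s] by (simp add: h_def)
  qed simp
  finally show ?thesis by simp
qed

lemma poisson_1_integral: "integrable lborel (poisson 1)" "integral\<^sup>L lborel (poisson 1) = 1"
proof -
  have "(\<integral>\<^sup>+x. ennreal (poisson 1 x) \<partial>lborel) = (\<integral>\<^sup>+x. ennreal (1 / pi) * ennreal (1 / ((cmod x)\<^sup>2 + 1)\<^sup>2) \<partial>lborel)"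
    by (intro nn_integral_cong) (simp add: poisson_def ennreal_mult[symmetric])
  also have "\<dots> = ennreal (1 / pi) * ennreal pi"
    by (subst nn_integral_cmult) (auto simp: nn_integral_poisson_1)
  also have "\<dots> = 1" by (simp add: ennreal_mult[symmetric])
  finally have 1: "(\<integral>\<^sup>+x. ennreal (poisson 1 x) \<partial>lborel) = ennreal 1" by simp
  have "has_bochner_integral lborel (poisson 1) 1"
    by (rule has_bochner_integral_nn_integral) (use 1 in \<open>auto simp: poisson_def\<close>)
  then show "integrable lborel (poisson 1)" "integral\<^sup>L lborel (poisson 1) = 1"
    by (auto simp: has_bochner_integral_iff)
qed

text \<open>Differentiate the constant function \<open>y \<mapsto> \<integral> G(w + y) dw\<close>.\<close>

lemma integral_has_pd_compact_support_eq_0: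
  assumes v: "cmod v = 1" and G: "\<And>w. has_pd G (G' w) v w" and c: "continuous_on UNIV G" "continuous_on UNIV G'"
    and s: "\<And>w. w \<notin> ball 0 R \<Longrightarrow> G w = 0" "\<And>w. w \<notin> ball 0 R \<Longrightarrow> G' w = 0"
  shows "integral\<^sup>L lborel G' = 0"
proof -
  have m[measurable]: "G \<in> borel_measurable borel" "G' \<in> borel_measurable borel"
    using c by (auto intro: borel_measurable_continuous_onI)
  have "compact (G' ` cball 0 R)"
    by (intro compact_continuous_image continuous_on_subset[OF c(2)]) auto
  then obtain b0 where b0: "\<And>w. w \<in> cball 0 R \<Longrightarrow> \<bar>G' w\<bar> \<le> b0"
    by (fastforce dest: compact_imp_bounded simp: bounded_iff)
  define b where "b = max b0 0"
  have b: "\<bar>G' w\<bar> \<le> b * indicator (ball 0 R) w" for w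
    using b0[of w] s(2)[of w] by (cases "w \<in> ball 0 R") (auto simp: b_def le_max_iff_disj)
  have bn: "b \<ge> 0" by (simp add: b_def)
  have "compact (G ` cball 0 R)"
    by (intro compact_continuous_image continuous_on_subset[OF c(1)]) auto
  then obtain a0 where a0: "\<And>w. w \<in> cball 0 R \<Longrightarrow> \<bar>G w\<bar> \<le> a0"
    by (fastforce dest: compact_imp_bounded simp: bounded_iff)
  interpret bounded_density G "max a0 0" R
    by unfold_locales (use s a0 in \<open>force simp: le_max_iff_disj\<close>)+
  have shift: "(\<integral>w. G (w + y) \<partial>lborel) = integral\<^sup>L lborel G" for y
    using lborel_integral_affine[of 1 G y] by (simp add: add.commute)
  have "has_pd (\<lambda>y. \<integral>w. G (y + w) \<partial>lborel) (\<integral>w. G' (0 + w) \<partial>lborel) v 0"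
  proof (rule has_pd_integral[OF v zero_less_one, where B = "\<lambda>w. b * indicator (ball 0 (R + 1)) w"])
    show "integrable lborel (\<lambda>w. G (y + w))" for y
      using lborel_integrable_affine_iff[of 1 G y] integrable_density by simp
    show "has_pd (\<lambda>y. G (y + w)) (G' (y + w)) v y" for y w
      by (rule has_pd_translate) (rule G)
    show "\<bar>G' (y + w)\<bar> \<le> b * indicator (ball 0 (R + 1)) w" if "y \<in> ball 0 1" for y w
    proof -
      have "indicator (ball 0 R) (y + w) \<le> (indicator (ball 0 (R + 1)) w :: real)"
        using that norm_triangle_ineq4[of "y + w" y] by (auto simp: indicator_def)
      then have "b * indicator (ball 0 R) (y + w) \<le> b * indicator (ball 0 (R + 1)) w"
        using bn by (rule mult_left_mono)
      then show ?thesis using b[of "y + w"] by simp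
    qed
    show "integrable lborel (\<lambda>w::complex. b * indicator (ball 0 (R + 1)) w)"
      by (intro integrable_mult_right integrable_real_indicator) (auto simp: emeasure_ball_less_top)
  qed auto
  then have "has_pd (\<lambda>y. integral\<^sup>L lborel G) (integral\<^sup>L lborel G') v 0"
    using shift by (simp add: add.commute)
  from has_pd_imp_pd[OF this] has_pd_imp_pd[OF has_pd_const[of "integral\<^sup>L lborel G" v 0]]
  show ?thesis by simp
qed

section \<open>The smoothed kernel tested against C^1 densities of compact support\<close>

definition logd11 :: "real \<Rightarrow> complex \<Rightarrow> complex \<Rightarrow> real" where
  "logd11 \<delta> v x = (((cmod x)\<^sup>2 + \<delta>) - 2 * (x \<bullet> v)\<^sup>2) / (2 * pi * ((cmod x)\<^sup>2 + \<delta>)\<^sup>2)"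

lemma has_pd_logd1_pos:
  assumes "\<delta> > 0" "cmod v = 1"
  shows "has_pd (logd1 \<delta> v) (logd11 \<delta> v x) v x"
proof -
  have p: "(cmod x)\<^sup>2 + \<delta> > 0" using assms by (simp add: add_nonneg_pos)
  have vv: "v \<bullet> v = 1" using assms by (simp add: dot_square_norm)
  have "has_pd (\<lambda>x. 2 * pi * ((cmod x)\<^sup>2 + \<delta>)) (2 * pi * (2 * (x \<bullet> v) + 0)) v x"
    by (intro has_pd_cmult has_pd_add has_pd_norm_sq has_pd_const)
  from has_pd_divide[OF has_pd_inner[of v v x] this] p vv
  have "has_pd (\<lambda>x. (x \<bullet> v) / (2 * pi * ((cmod x)\<^sup>2 + \<delta>)))
     ((2 * pi * ((cmod x)\<^sup>2 + \<delta>) - (x \<bullet> v) * (2 * pi * (2 * (x \<bullet> v)))) /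
       ((2 * pi * ((cmod x)\<^sup>2 + \<delta>)) * (2 * pi * ((cmod x)\<^sup>2 + \<delta>)))) v x" by simp
  moreover have "(2 * pi * ((cmod x)\<^sup>2 + \<delta>) - (x \<bullet> v) * (2 * pi * (2 * (x \<bullet> v)))) /
       ((2 * pi * ((cmod x)\<^sup>2 + \<delta>)) * (2 * pi * ((cmod x)\<^sup>2 + \<delta>))) = logd11 \<delta> v x"
  proof -
    have "(2 * pi * ((cmod x)\<^sup>2 + \<delta>) - (x \<bullet> v) * (2 * pi * (2 * (x \<bullet> v)))) = (2 * pi) * (((cmod x)\<^sup>2 + \<delta>) - 2 * (x \<bullet> v)\<^sup>2)"
      "(2 * pi * ((cmod x)\<^sup>2 + \<delta>)) * (2 * pi * ((cmod x)\<^sup>2 + \<delta>)) = (2 * pi) * (2 * pi * ((cmod x)\<^sup>2 + \<delta>)\<^sup>2)"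
      by (simp_all add: algebra_simps power2_eq_square)
    then show ?thesis
      unfolding logd11_def by (simp only: mult_divide_mult_cancel_left_if) simp
  qed
  ultimately show ?thesis
    by (simp add: logd1_def[abs_def])
qed

lemma logd11_sum: "\<delta> > 0 \<Longrightarrow> logd11 \<delta> 1 x + logd11 \<delta> \<i> x = poisson \<delta> x"
proof -
  assume "\<delta> > 0"
  have "(cmod x)\<^sup>2 = (x \<bullet> 1)\<^sup>2 + (x \<bullet> \<i>)\<^sup>2" by (simp add: cmod_power2 inner_complex_def)
  then have "(((cmod x)\<^sup>2 + \<delta>) - 2 * (x \<bullet> 1)\<^sup>2) + (((cmod x)\<^sup>2 + \<delta>) - 2 * (x \<bullet> \<i>)\<^sup>2) = 2 * \<delta>"
    by simp
  then have "logd11 \<delta> 1 x + logd11 \<delta> \<i> x = (2 * \<delta>) / (2 * pi * ((cmod x)\<^sup>2 + \<delta>)\<^sup>2)"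
    unfolding logd11_def add_divide_distrib[symmetric] by (simp only:)
  then show ?thesis by (simp add: poisson_def)
qed

lemma continuous_on_logd11: "\<delta> > 0 \<Longrightarrow> continuous_on S (logd11 \<delta> v)"
  unfolding logd11_def by (intro continuous_intros) (auto simp: add_nonneg_eq_0_iff)

locale C1_density =
  fixes \<rho> :: "complex \<Rightarrow> real" and F :: "complex \<Rightarrow> complex \<Rightarrow> real" and R :: real
  assumes c0: "continuous_on UNIV \<rho>" and c1: "\<And>v. v \<in> {1, \<i>} \<Longrightarrow> continuous_on UNIV (F v)"
    and d1: "\<And>v z. v \<in> {1, \<i>} \<Longrightarrow> has_pd \<rho> (F v z) v z"
    and s0: "\<And>z. z \<notin> ball 0 R \<Longrightarrow> \<rho> z = 0" and s1: "\<And>v z. v \<in> {1, \<i>} \<Longrightarrow> z \<notin> ball 0 R \<Longrightarrow> F v z = 0"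
begin

lemma bounded_density_of_continuous:
  assumes "continuous_on UNIV f" "\<And>z. z \<notin> ball 0 R \<Longrightarrow> f z = 0"
  shows "\<exists>B. bounded_density f B R"
proof -
  have "compact (f ` cball 0 R)"
    by (intro compact_continuous_image continuous_on_subset[OF assms(1)]) auto
  then obtain a0 where a0: "\<And>w. w \<in> cball 0 R \<Longrightarrow> \<bar>f w\<bar> \<le> a0"
    by (fastforce dest: compact_imp_bounded simp: bounded_iff)
  have "bounded_density f (max a0 0) R"
    by unfold_locales (use assms a0 in \<open>force simp: le_max_iff_disj intro: borel_measurable_continuous_onI\<close>)+
  then show ?thesis ..
qed

lemma unit: "v \<in> {1, \<i>} \<Longrightarrow> cmod v = 1" by auto

text \<open>The substitution w = z - sqrt(\<delta>) y turns \<open>poisson \<delta>\<close> into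
  \<open>poisson 1\<close>, leaving \<delta> only in the argument of the continuous bounded
  density.\<close>

lemma conv_poisson_limit:
  assumes "\<And>n. \<delta> n > 0" "\<delta> \<longlonglongrightarrow> 0"
  shows "(\<lambda>n. conv (poisson (\<delta> n)) \<rho> z) \<longlonglongrightarrow> \<rho> z"
proof -
  obtain B where "bounded_density \<rho> B R" using bounded_density_of_continuous[OF c0 s0] by blast
  then interpret bounded_density \<rho> B R .
  have eq: "conv (poisson (\<delta> n)) \<rho> z = (\<integral>y. \<rho> (z - sqrt (\<delta> n) *\<^sub>R y) * poisson 1 y \<partial>lborel)" for n
  proof -
    let ?e = "sqrt (\<delta> n)"
    have e: "?e > 0" "?e\<^sup>2 = \<delta> n" using assms(1)[of n] by auto
    have "conv (poisson (\<delta> n)) \<rho> z = (\<integral>x. \<rho> (z - x) * poisson (\<delta> n) x \<partial>lborel)"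
      unfolding conv_def
      by (subst lborel_integral_reflect[where t = z and f = "\<lambda>x. \<rho> (z - x) * poisson (\<delta> n) x", symmetric]) auto
    also have "\<dots> = ?e\<^sup>2 * (\<integral>x. \<rho> (z - (0 + ?e *\<^sub>R x)) * poisson (\<delta> n) (0 + ?e *\<^sub>R x) \<partial>lborel)"
      using e by (subst lborel_integral_affine[where c = ?e and t = 0]) auto
    also have "\<dots> = (\<integral>x. ?e\<^sup>2 * (\<rho> (z - ?e *\<^sub>R x) * poisson (\<delta> n) (?e *\<^sub>R x)) \<partial>lborel)"
      by simp
    also have "\<dots> = (\<integral>y. \<rho> (z - ?e *\<^sub>R y) * poisson 1 y \<partial>lborel)"
    proof (rule Bochner_Integration.integral_cong[OF refl])
      fix x
      have "poisson (\<delta> n) (?e *\<^sub>R x) = \<delta> n / (pi * (\<delta> n * ((cmod x)\<^sup>2 + 1))\<^sup>2)"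
        unfolding poisson_def using e by (simp add: power_mult_distrib algebra_simps)
      then have "?e\<^sup>2 * poisson (\<delta> n) (?e *\<^sub>R x) = poisson 1 x"
        unfolding e(2) using assms(1)[of n] by (simp add: poisson_def power_mult_distrib power2_eq_square)
      then show "?e\<^sup>2 * (\<rho> (z - ?e *\<^sub>R x) * poisson (\<delta> n) (?e *\<^sub>R x)) = \<rho> (z - ?e *\<^sub>R x) * poisson 1 x"
        by (metis mult.left_commute)
    qed
    finally show ?thesis .
  qed
  have "(\<lambda>n. \<integral>y. \<rho> (z - sqrt (\<delta> n) *\<^sub>R y) * poisson 1 y \<partial>lborel) \<longlonglongrightarrow> (\<integral>y. \<rho> z * poisson 1 y \<partial>lborel)"
  proof (rule integral_dominated_convergence[where w = "\<lambda>y. B * poisson 1 y"])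
    show "integrable lborel (\<lambda>y. B * poisson 1 y)" using poisson_1_integral by simp
    have "(\<lambda>n. \<rho> (z - sqrt (\<delta> n) *\<^sub>R y)) \<longlonglongrightarrow> \<rho> z" for y
    proof -
      have "(\<lambda>n. z - sqrt (\<delta> n) *\<^sub>R y) \<longlonglongrightarrow> z - sqrt 0 *\<^sub>R y"
        by (intro tendsto_intros assms)
      then show ?thesis
        using continuous_on_tendsto_compose[OF c0, of _ z] by simp
    qed
    then show "AE y in lborel. (\<lambda>n. \<rho> (z - sqrt (\<delta> n) *\<^sub>R y) * poisson 1 y) \<longlonglongrightarrow> \<rho> z * poisson 1 y"
      by (intro AE_I2 tendsto_intros)
    show "AE y in lborel. norm (\<rho> (z - sqrt (\<delta> n) *\<^sub>R y) * poisson 1 y) \<le> B * poisson 1 y" for n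
    proof (rule AE_I2)
      fix y
      have "poisson 1 y \<ge> 0" by (simp add: poisson_def)
      then show "norm (\<rho> (z - sqrt (\<delta> n) *\<^sub>R y) * poisson 1 y) \<le> B * poisson 1 y"
        using bounded by (simp add: abs_mult mult_right_mono)
    qed
  qed auto
  then show ?thesis using poisson_1_integral by (simp add: eq)
qed

text \<open>The difference of the two integrands is the derivative in w of the compactly supported
  \<open>\<rho> w * logd1 \<delta> v (z - w)\<close>. Reflecting the kernel changes the sign of
  \<open>logd1\<close> but not of \<open>logd11\<close>.\<close>

lemma conv_by_parts:
  assumes v: "v \<in> {1, \<i>}" and \<delta>: "\<delta> > 0"
  shows "conv (logd1 \<delta> v) (F v) z = conv (logd11 \<delta> v) \<rho> z"
proof -
  let ?a = "\<lambda>w. F v w * logd1 \<delta> v (z - w)" and ?b = "\<lambda>w. \<rho> w * logd11 \<delta> v (z - w)"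
  have ca: "continuous_on UNIV ?a" and cb: "continuous_on UNIV ?b" and cG: "continuous_on UNIV (\<lambda>w. \<rho> w * logd1 \<delta> v (z - w))"
    using \<delta> by (intro continuous_intros c1[OF v] c0 continuous_on_compose2[OF continuous_on_logd1[of \<delta> UNIV v]]
        continuous_on_compose2[OF continuous_on_logd11[of \<delta> UNIV v]]; auto)+
  obtain A B where "bounded_density ?a A R" "bounded_density ?b B R"
    using bounded_density_of_continuous[OF ca] bounded_density_of_continuous[OF cb] s0 s1[OF v] by force
  then have i: "integrable lborel ?a" "integrable lborel ?b"
    by (auto intro: bounded_density.integrable_density)
  have "(\<integral>w. ?a w - ?b w \<partial>lborel) = 0"
  proof (rule integral_has_pd_compact_support_eq_0[OF unit[OF v], where G = "\<lambda>w. \<rho> w * logd1 \<delta> v (z - w)" and R = R])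
    show "has_pd (\<lambda>w. \<rho> w * logd1 \<delta> v (z - w)) (?a w - ?b w) v w" for w
    proof -
      have "logd1 \<delta> v (z - w) = - logd1 \<delta> v (w - z)" for w
        by (simp add: logd1_def norm_minus_commute inner_diff_left divide_simps)
      moreover have "logd11 \<delta> v (z - w) = logd11 \<delta> v (w - z)"
        by (simp add: logd11_def norm_minus_commute inner_diff_left power2_commute)
      moreover have "has_pd (\<lambda>w. \<rho> w * - logd1 \<delta> v (w - z)) (F v w * - logd1 \<delta> v (w - z) + \<rho> w * - logd11 \<delta> v (w - z)) v w"
        by (intro has_pd_mult has_pd_minus d1 v has_pd_translate_diff has_pd_logd1_pos \<delta> unit)
      ultimately show ?thesis by simp
    qed
    show "continuous_on UNIV (\<lambda>w. ?a w - ?b w)" by (intro continuous_intros ca cb)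
  qed (use s0 s1[OF v] cG in auto)
  then show ?thesis using i by (simp add: conv_def)
qed

text \<open>For \<delta> > 0, integration by parts summed over the two directions leaves the
  Laplacian of the smoothed kernel against \<rho>. As \<delta> -> 0, one side converges by L^1
  convergence of the gradient kernels, the other by the approximate identity.\<close>

lemma divergence_identity:
  assumes z: "z \<in> ball 0 R"
  shows "conv (logd1 0 1) (F 1) z + conv (logd1 0 \<i>) (F \<i>) z = \<rho> z"
proof -
  define \<delta> where "\<delta> n = inverse (real (Suc n))" for n
  have \<delta>: "\<delta> n > 0" for n by (simp add: \<delta>_def)
  have \<delta>0: "\<delta> \<longlonglongrightarrow> 0" unfolding \<delta>_def[abs_def] by (rule LIMSEQ_inverse_real_of_nat)
  have lim: "(\<lambda>n. conv (logd1 (\<delta> n) v) (F v) z) \<longlonglongrightarrow> conv (logd1 0 v) (F v) z" if v: "v \<in> {1, \<i>}" for v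
  proof -
    obtain B where "bounded_density (F v) B R" using bounded_density_of_continuous[OF c1 s1] v by blast
    then interpret bounded_density "F v" B R .
    show ?thesis
      unfolding \<delta>_def using tendsto_uniform_limitI[OF conv_logd_approx(2)[OF unit[OF v]] z] .
  qed
  have eq: "conv (logd1 (\<delta> n) 1) (F 1) z + conv (logd1 (\<delta> n) \<i>) (F \<i>) z = conv (poisson (\<delta> n)) \<rho> z" for n
  proof -
    have "integrable lborel (\<lambda>w. \<rho> w * logd11 (\<delta> n) v (z - w))" for v
    proof -
      have "continuous_on UNIV (\<lambda>w. \<rho> w * logd11 (\<delta> n) v (z - w))"
        using \<delta>[of n] by (intro continuous_intros c0 continuous_on_compose2[OF continuous_on_logd11[of "\<delta> n" UNIV v]]) auto
      from bounded_density_of_continuous[OF this] s0 show ?thesis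
        by (auto dest: bounded_density.integrable_density)
    qed
    then have "conv (logd11 (\<delta> n) 1) \<rho> z + conv (logd11 (\<delta> n) \<i>) \<rho> z =
       (\<integral>w. \<rho> w * logd11 (\<delta> n) 1 (z - w) + \<rho> w * logd11 (\<delta> n) \<i> (z - w) \<partial>lborel)"
      by (simp add: conv_def)
    also have "\<dots> = conv (poisson (\<delta> n)) \<rho> z"
      unfolding conv_def distrib_left[symmetric] logd11_sum[OF \<delta>] ..
    finally show ?thesis by (simp add: conv_by_parts[OF _ \<delta>])
  qed
  have "(\<lambda>n. conv (poisson (\<delta> n)) \<rho> z) \<longlonglongrightarrow> conv (logd1 0 1) (F 1) z + conv (logd1 0 \<i>) (F \<i>) z"
    unfolding eq[symmetric] by (intro tendsto_intros lim) auto
  then show ?thesis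
    using conv_poisson_limit[OF \<delta> \<delta>0] LIMSEQ_unique by blast
qed

text \<open>After reflecting the integration variable the singular kernel no longer depends on the
  point, and the derivative falls on the density.\<close>

lemma has_pd_conv_density:
  assumes v: "v \<in> {1, \<i>}" and z: "z \<in> ball 0 R"
  shows "has_pd (conv (logd 0) \<rho>) (conv (logd 0) (F v) z) v z"
proof -
  obtain B0 where B0: "bounded_density \<rho> B0 R" using bounded_density_of_continuous[OF c0 s0] by blast
  obtain B where "bounded_density (F v) B R" using bounded_density_of_continuous[OF c1 s1] v by blast
  then interpret bounded_density "F v" B R .
  have m[measurable]: "\<rho> \<in> borel_measurable borel" using c0 by (rule borel_measurable_continuous_onI)
  have eq: "conv (logd 0) f = (\<lambda>z. \<integral>x. f (z - x) * logd 0 x \<partial>lborel)" if [measurable]: "f \<in> borel_measurable borel" for f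
  proof
    show "conv (logd 0) f z = (\<integral>x. f (z - x) * logd 0 x \<partial>lborel)" for z
      unfolding conv_def
      by (subst lborel_integral_reflect[where t = z and f = "\<lambda>x. f (z - x) * logd 0 x", symmetric]) auto
  qed
  obtain r where r: "r > 0" "ball z r \<subseteq> ball 0 R"
    using openE[OF open_ball z] by blast
  show ?thesis
    unfolding eq[OF m] eq[OF meas]
  proof (rule has_pd_integral[OF unit[OF v] r(1), where B = "\<lambda>x. B * \<bar>indicator (ball 0 (2 * R)) x * logd 0 x\<bar>"])
    fix y assume "y \<in> ball z r"
    then have y: "y \<in> ball 0 R" using r by auto
    have "integrable lborel (\<lambda>w. \<rho> w * logd 0 (y - w))"
      by (rule bounded_density.conv_integrable[OF B0 _ _ y]) (auto intro: integrable_ball_logd)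
    then show "integrable lborel (\<lambda>x. \<rho> (y - x) * logd 0 x)"
      by (subst lborel_integrable_reflect_iff[where t = y, symmetric]) auto
    fix x
    show "has_pd (\<lambda>y. \<rho> (y - x) * logd 0 x) (F v (y - x) * logd 0 x) v y"
      using has_pd_mult[OF has_pd_translate_diff[OF d1[OF v]] has_pd_const[of "logd 0 x"]] by simp
    show "\<bar>F v (y - x) * logd 0 x\<bar> \<le> B * \<bar>indicator (ball 0 (2 * R)) x * logd 0 x\<bar>"
      using kernel_dominated[of "logd 0" y "y - x"] y by (simp add: abs_mult integrable_ball_logd)
  next
    show "integrable lborel (\<lambda>x. B * \<bar>indicator (ball 0 (2 * R)) x * logd 0 x\<bar>)"
      by (intro integrable_mult_right integrable_abs integrable_ball_logd) auto
  qed auto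
qed

text \<open>One derivative goes to the density and the other to the kernel: \<rho> is only C^1, and
  the second derivatives of the kernel, of size 1/|x|^2, are not locally integrable.\<close>

lemma conv_density_C2: "Ck_on 2 (ball 0 R) (conv (logd 0) \<rho>)"
  "z \<in> ball 0 R \<Longrightarrow> lap (conv (logd 0) \<rho>) z = \<rho> z"
proof -
  have B: "\<exists>B. bounded_density (F v) B R" if "v \<in> {1, \<i>}" for v
    using bounded_density_of_continuous[OF c1 s1] that by blast
  have B0: "\<exists>B. bounded_density \<rho> B R" using bounded_density_of_continuous[OF c0 s0] by blast
  have cc: "continuous_on (ball 0 R) (conv (logd 0) f)" if "\<exists>B. bounded_density f B R" for f
  proof -
    from that obtain B where "bounded_density f B R" ..
    then interpret bounded_density f B R .
    show ?thesis
      by (rule uniform_limit_theorem[OF _ conv_logd_approx(1)])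
        (auto intro!: always_eventually continuous_on_conv_logd_pos simp: field_simps)
  qed
  have d2: "has_pd (conv (logd 0) (F v)) (conv (logd1 0 w) (F v) z) w z"
    if "v \<in> {1, \<i>}" "w \<in> {1, \<i>}" "z \<in> ball 0 R" for v w z
    using B[OF that(1)] bounded_density.has_pd_conv_logd[OF _ unit[OF that(2)] that(3)] by blast
  have c2: "continuous_on (ball 0 R) (conv (logd1 0 w) (F v))"
    if "v \<in> {1, \<i>}" "w \<in> {1, \<i>}" for v w
    using B[OF that(1)] bounded_density.continuous_on_conv_logd1[OF _ unit[OF that(2)]] by blast
  have c1': "continuous_on (ball 0 R) (conv (logd 0) (F v))" if "v \<in> {1, \<i>}" for v
    by (rule cc[OF B[OF that]])
  show "Ck_on 2 (ball 0 R) (conv (logd 0) \<rho>)"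
    by (rule Ck2_I(1)[OF open_ball cc[OF B0] has_pd_conv_density c1' d2 c2])
  show "lap (conv (logd 0) \<rho>) z = \<rho> z" if "z \<in> ball 0 R"
    using divergence_identity[OF that]
    by (subst Ck2_I(2)[OF open_ball cc[OF B0] has_pd_conv_density c1' d2 c2]) (use that in auto)
qed

end

section \<open>Local regularity of the logarithmic potential\<close>

definition has_lap :: "complex set \<Rightarrow> (complex \<Rightarrow> real) \<Rightarrow> (complex \<Rightarrow> real) \<Rightarrow> bool" where
  "has_lap S f L \<longleftrightarrow> Ck_on 2 S f \<and> (\<forall>z\<in>S. lap f z = L z)"

lemma harmonic_on_iff_has_lap: "harmonic_on S f \<longleftrightarrow> has_lap S f (\<lambda>_. 0)"
  by (simp add: harmonic_on_def has_lap_def)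

lemma has_lap_continuous_on: "has_lap S f L \<Longrightarrow> continuous_on S f"
  using Ck2_continuous(1)[of S f 1 1] by (simp add: has_lap_def)

lemma has_lap_add:
  assumes "open S" "has_lap S f L" "has_lap S f' L'"
  shows "has_lap S (\<lambda>z. f z + f' z) (\<lambda>z. L z + L' z)"
proof -
  have C: "Ck_on 2 S f" "Ck_on 2 S f'" using assms by (auto simp: has_lap_def)
  note * = Ck2_I[OF assms(1), of "\<lambda>z. f z + f' z" "\<lambda>v z. pd v f z + pd v f' z"
      "\<lambda>v w z. pd w (pd v f) z + pd w (pd v f') z"]
  have "Ck_on 2 S (\<lambda>z. f z + f' z)"
    by (rule *) (auto intro!: continuous_on_add has_pd_add Ck2_continuous[OF C(1)] Ck2_continuous[OF C(2)] Ck2_D[OF C(1)] Ck2_D[OF C(2)])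
  moreover have "lap (\<lambda>z. f z + f' z) z = L z + L' z" if "z \<in> S" for z
  proof -
    have "lap (\<lambda>z. f z + f' z) z = (pd 1 (pd 1 f) z + pd 1 (pd 1 f') z) + (pd \<i> (pd \<i> f) z + pd \<i> (pd \<i> f') z)"
      by (rule *(2)) (use that in \<open>auto intro!: continuous_on_add has_pd_add Ck2_continuous[OF C(1)] Ck2_continuous[OF C(2)] Ck2_D[OF C(1)] Ck2_D[OF C(2)]\<close>)
    moreover have "lap f z = L z" "lap f' z = L' z" using assms(2,3) that by (auto simp: has_lap_def)
    ultimately show ?thesis unfolding lap_def by linarith
  qed
  ultimately show ?thesis by (simp add: has_lap_def)
qed

lemma has_lap_cmult:
  assumes "open S" "has_lap S f L"
  shows "has_lap S (\<lambda>z. c * f z) (\<lambda>z. c * L z)"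
proof -
  have C: "Ck_on 2 S f" using assms by (auto simp: has_lap_def)
  note * = Ck2_I[OF assms(1), of "\<lambda>z. c * f z" "\<lambda>v z. c * pd v f z" "\<lambda>v w z. c * pd w (pd v f) z"]
  have "Ck_on 2 S (\<lambda>z. c * f z)"
    by (rule *) (auto intro!: continuous_on_mult_left has_pd_cmult Ck2_continuous[OF C(1)] Ck2_D[OF C(1)])
  moreover have "lap (\<lambda>z. c * f z) z = c * L z" if "z \<in> S" for z
  proof -
    have "lap (\<lambda>z. c * f z) z = c * pd 1 (pd 1 f) z + c * pd \<i> (pd \<i> f) z"
      by (rule *(2)) (use that in \<open>auto intro!: continuous_on_mult_left has_pd_cmult Ck2_continuous[OF C(1)] Ck2_D[OF C(1)]\<close>)
    then show ?thesis using assms(2) that by (auto simp: has_lap_def lap_def distrib_left[symmetric])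
  qed
  ultimately show ?thesis by (simp add: has_lap_def)
qed

lemma has_lap_diff:
  assumes "open S" "has_lap S f L" "has_lap S f' L'"
  shows "has_lap S (\<lambda>z. f z - f' z) (\<lambda>z. L z - L' z)"
  using has_lap_add[OF assms(1,2) has_lap_cmult[OF assms(1,3), of "-1"]] by simp

lemma has_lap_const: "open S \<Longrightarrow> has_lap S (\<lambda>_. c) (\<lambda>_. 0)"
  using Ck2_I[of S "\<lambda>_. c" "\<lambda>_ _. 0" "\<lambda>_ _ _. 0"] by (simp add: has_lap_def has_pd_const)

text \<open>Allows a different decomposition of \<open>f\<close> near each point.\<close>

lemma has_lap_local:
  assumes S: "open S" and loc: "\<And>z. z \<in> S \<Longrightarrow> \<exists>U. open U \<and> z \<in> U \<and> has_lap U f L"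
  shows "has_lap S f L"
proof -
  have U: "\<exists>U. open U \<and> z \<in> U \<and> Ck_on 2 U f \<and> lap f z = L z" if "z \<in> S" for z
    using loc[OF that] by (auto simp: has_lap_def)
  have cont: "continuous_on S h" if "\<And>U. Ck_on 2 U f \<Longrightarrow> continuous_on U h" for h :: "complex \<Rightarrow> real"
    unfolding continuous_on_eq_continuous_at[OF S]
    using U that continuous_on_eq_continuous_at by metis
  have "Ck_on 2 S f"
  proof (rule Ck2_I[OF S, of f "\<lambda>v. pd v f" "\<lambda>v w. pd w (pd v f)"])
    show "has_pd f (pd v f z) v z" if "v \<in> {1, \<i>}" "z \<in> S" for v z
      using U[OF that(2)] Ck2_D(1) that(1) by blast
    show "has_pd (pd v f) (pd w (pd v f) z) w z" if "v \<in> {1, \<i>}" "w \<in> {1, \<i>}" "z \<in> S" for v w z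
      using U[OF that(3)] Ck2_D(2) that(1,2) by blast
    show "continuous_on S f" by (rule cont) (use Ck2_continuous(1) in blast)
    show "continuous_on S (pd v f)" if "v \<in> {1, \<i>}" for v
      by (rule cont) (use Ck2_continuous(2) that in blast)
    show "continuous_on S (pd w (pd v f))" if "v \<in> {1, \<i>}" "w \<in> {1, \<i>}" for v w
      by (rule cont) (use Ck2_continuous(3) that in blast)
  qed
  then show ?thesis using U by (auto simp: has_lap_def)
qed

lemma has_lap_subset: "has_lap U f L \<Longrightarrow> open U \<Longrightarrow> open S \<Longrightarrow> S \<subseteq> U \<Longrightarrow> has_lap S f L"
  by (rule has_lap_local) auto

lemma has_lap_cong:
  assumes S: "open S" and f: "has_lap S f L" and eq: "\<And>z. z \<in> S \<Longrightarrow> f z = f' z" "\<And>z. z \<in> S \<Longrightarrow> L z = L' z"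
  shows "has_lap S f' L'"
proof -
  have C: "Ck_on 2 S f" using f by (simp add: has_lap_def)
  have c: "continuous_on S f'"
    by (rule continuous_on_eq[OF Ck2_continuous(1)[OF C, of 1 1]]) (auto simp: eq)
  have d: "has_pd f' (pd v f z) v z" if "v \<in> {1, \<i>}" "z \<in> S" for v z
    by (rule has_pd_cong[OF S that(2) eq(1) Ck2_D(1)[OF C that(1) that(1) that(2)]])
  have c1: "continuous_on S (pd v f)" if "v \<in> {1, \<i>}" for v
    by (rule Ck2_continuous(2)[OF C that that])
  note * = Ck2_I[OF S c d c1 Ck2_D(2)[OF C] Ck2_continuous(3)[OF C]]
  show ?thesis
    unfolding has_lap_def
  proof (intro conjI ballI)
    show "Ck_on 2 S f'" by (rule *(1))
    fix z assume z: "z \<in> S"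
    have "lap f' z = pd 1 (pd 1 f) z + pd \<i> (pd \<i> f) z" by (rule *(2)[OF _ _ _ _ _ _ _ _ z])
    then show "lap f' z = L' z" using f z eq(2) by (simp add: has_lap_def lap_def)
  qed
qed

context
  fixes M :: "'a measure" and p :: "'a \<Rightarrow> complex" and q :: "'a \<Rightarrow> real" and S :: "complex set" and B C :: real
  assumes M: "finite_measure M" and S: "open S"
    and pm[measurable]: "p \<in> borel_measurable M" and qm[measurable]: "q \<in> borel_measurable M"
    and qb: "\<And>x. x \<in> space M \<Longrightarrow> \<bar>q x\<bar> \<le> B"
    and pb: "\<And>z x. z \<in> S \<Longrightarrow> x \<in> space M \<Longrightarrow> q x \<noteq> 0 \<Longrightarrow> cmod (z - p x) \<le> C"
    and far: "\<And>z. z \<in> S \<Longrightarrow> \<exists>d>0. \<exists>r>0. \<forall>y\<in>S \<inter> ball z r. \<forall>x\<in>space M. q x \<noteq> 0 \<longrightarrow> d \<le> cmod (y - p x)"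
begin

lemma log_potential_separate: "z \<in> S \<Longrightarrow> x \<in> space M \<Longrightarrow> q x \<noteq> 0 \<Longrightarrow> z \<noteq> p x"
proof -
  assume a: "z \<in> S" "x \<in> space M" "q x \<noteq> 0"
  obtain d r where "d > 0" "r > 0" "\<forall>y\<in>S \<inter> ball z r. \<forall>x\<in>space M. q x \<noteq> 0 \<longrightarrow> d \<le> cmod (y - p x)"
    using far[OF a(1)] by blast
  then have "0 < d" "d \<le> cmod (z - p x)" using a by auto
  then show "z \<noteq> p x" by auto
qed

lemma log_potential_derivs:
  "\<And>v z x. z \<in> S \<Longrightarrow> x \<in> space M \<Longrightarrow> has_pd (\<lambda>y. q x * logd 0 (y - p x)) (q x * logd1 0 v (z - p x)) v z"
  "\<And>v w z x. z \<in> S \<Longrightarrow> x \<in> space M \<Longrightarrow> has_pd (\<lambda>y. q x * logd1 0 v (y - p x)) (q x * logd2 v w (z - p x)) w z"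
proof -
  fix v w z x assume z: "z \<in> S" "x \<in> space M"
  show "has_pd (\<lambda>y. q x * logd 0 (y - p x)) (q x * logd1 0 v (z - p x)) v z"
  proof (cases "q x = 0")
    case False
    then show ?thesis
      using log_potential_separate[OF z] by (intro has_pd_cmult has_pd_translate_diff has_pd_logd) auto
  qed (simp add: has_pd_const)
  show "has_pd (\<lambda>y. q x * logd1 0 v (y - p x)) (q x * logd2 v w (z - p x)) w z"
  proof (cases "q x = 0")
    case False
    then show ?thesis
      using log_potential_separate[OF z] by (intro has_pd_cmult has_pd_translate_diff has_pd_logd1) auto
  qed (simp add: has_pd_const)
qed

lemma log_potential_continuous:
  assumes x: "x \<in> space M"
  shows "continuous_on S (\<lambda>z. q x * logd 0 (z - p x))" "continuous_on S (\<lambda>z. q x * logd1 0 v (z - p x))"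
    "continuous_on S (\<lambda>z. q x * logd2 v w (z - p x))"
proof -
  have "continuous_on S (\<lambda>z. q x * h (z - p x))" if "continuous_on (- {0}) h" for h :: "complex \<Rightarrow> real"
  proof (cases "q x = 0")
    case False
    then show ?thesis
      using log_potential_separate x by (intro continuous_intros continuous_on_compose2[OF that]) auto
  qed simp
  then show "continuous_on S (\<lambda>z. q x * logd 0 (z - p x))" "continuous_on S (\<lambda>z. q x * logd1 0 v (z - p x))"
    "continuous_on S (\<lambda>z. q x * logd2 v w (z - p x))"
    by (auto intro!: continuous_on_logd continuous_on_logd1 continuous_on_logd2)
qed

lemma log_potential_local_bounds:
  assumes z: "z \<in> S"
  shows "\<exists>r>0. \<exists>C'. \<forall>y\<in>S \<inter> ball z r. \<forall>x\<in>space M. \<forall>v\<in>{1, \<i>}. \<forall>w\<in>{1, \<i>}.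
     \<bar>q x * logd 0 (y - p x)\<bar> \<le> C' \<and> \<bar>q x * logd1 0 v (y - p x)\<bar> \<le> C' \<and> \<bar>q x * logd2 v w (y - p x)\<bar> \<le> C'"
proof -
  obtain d r where d: "d > 0" and r: "r > 0"
    and dr: "\<And>y x. y \<in> S \<Longrightarrow> y \<in> ball z r \<Longrightarrow> x \<in> space M \<Longrightarrow> q x \<noteq> 0 \<Longrightarrow> d \<le> cmod (y - p x)"
    using far[OF z] by blast
  define C' where "C' = \<bar>B\<bar> * (1 / d + C\<^sup>2 + 1 / d\<^sup>2)"
  show ?thesis
  proof (rule exI[of _ r], intro conjI r, rule exI[of _ C'], intro ballI conjI)
    fix y x v w assume y: "y \<in> S \<inter> ball z r" and x: "x \<in> space M" and v: "v \<in> {1, \<i>}" and w: "w \<in> {1, \<i>}"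
    have main: "\<bar>q x * h\<bar> \<le> C'" if "q x \<noteq> 0 \<Longrightarrow> \<bar>h\<bar> \<le> 1 / d + C\<^sup>2 + 1 / d\<^sup>2" for h
    proof (cases "q x = 0")
      case False
      then show ?thesis
        unfolding abs_mult C'_def using qb[OF x] that by (intro mult_mono) auto
    qed (use d in \<open>simp add: C'_def\<close>)
    let ?x = "y - p x"
    have b: "1 / cmod ?x \<le> 1 / d" "1 / (cmod ?x)\<^sup>2 \<le> 1 / d\<^sup>2" "(cmod ?x)\<^sup>2 \<le> C\<^sup>2" "?x \<noteq> 0" if "q x \<noteq> 0"
      using dr[of y x] y x that d pb[of y x] by (auto intro!: divide_left_mono power_mono mult_pos_pos zero_less_power)
    have n: "0 \<le> 1 / d" "0 \<le> C\<^sup>2" "0 \<le> 1 / d\<^sup>2" using d by auto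
    have u: "cmod v = 1" "cmod w = 1" using v w by auto
    show "\<bar>q x * logd 0 ?x\<bar> \<le> C'"
      by (rule main) (use b n abs_logd_le[of 0 ?x] in linarith)
    show "\<bar>q x * logd1 0 v ?x\<bar> \<le> C'"
      by (rule main) (use b n abs_logd1_le[OF u(1), of 0 ?x] in linarith)
    show "\<bar>q x * logd2 v w ?x\<bar> \<le> C'"
      by (rule main) (use b n abs_logd2_le[OF u, of ?x] in linarith)
  qed
qed

lemma log_potential_meas: "(\<lambda>x. q x * logd 0 (z - p x)) \<in> borel_measurable M"
  by measurable

lemma log_potential_C2:
  defines "K \<equiv> \<lambda>z. \<integral>x. q x * logd 0 (z - p x) \<partial>M" and "K1 \<equiv> \<lambda>v z. \<integral>x. q x * logd1 0 v (z - p x) \<partial>M"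
    and "K2 \<equiv> \<lambda>v w z. \<integral>x. q x * logd2 v w (z - p x) \<partial>M"
  shows "Ck_on 2 S K" "\<And>z. z \<in> S \<Longrightarrow> lap K z = K2 1 1 z + K2 \<i> \<i> z"
    "\<And>v z. v \<in> {1, \<i>} \<Longrightarrow> z \<in> S \<Longrightarrow> has_pd K (K1 v z) v z"
    "\<And>v w z. v \<in> {1, \<i>} \<Longrightarrow> w \<in> {1, \<i>} \<Longrightarrow> z \<in> S \<Longrightarrow> has_pd (K1 v) (K2 v w z) w z"
    "continuous_on S K" "\<And>v. v \<in> {1, \<i>} \<Longrightarrow> continuous_on S (K1 v)"
    "\<And>v w. v \<in> {1, \<i>} \<Longrightarrow> w \<in> {1, \<i>} \<Longrightarrow> continuous_on S (K2 v w)"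
  using Ck2_integral[of M S "\<lambda>z x. q x * logd 0 (z - p x)" "\<lambda>v z x. q x * logd1 0 v (z - p x)"
      "\<lambda>v w z x. q x * logd2 v w (z - p x)", OF M S log_potential_meas log_potential_derivs(1) log_potential_derivs(2)
      log_potential_continuous(1) log_potential_continuous(2) log_potential_continuous(3) log_potential_local_bounds]
  unfolding K_def K1_def K2_def by blast+

lemma log_potential_has_lap: "has_lap S (\<lambda>z. \<integral>x. q x * logd 0 (z - p x) \<partial>M) (\<lambda>_. 0)"
proof -
  have z: "(\<integral>x. q x * logd2 1 1 (z - p x) \<partial>M) + (\<integral>x. q x * logd2 \<i> \<i> (z - p x) \<partial>M) = 0" for z
  proof -
    \<comment> \<open>The integrands are pointwise opposite, so the integrals cancel without any
      appeal to integrability.\<close>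
    have "(\<lambda>x. q x * logd2 \<i> \<i> (z - p x)) = (\<lambda>x. - (q x * logd2 1 1 (z - p x)))"
    proof
      fix x
      have "logd2 \<i> \<i> (z - p x) = - logd2 1 1 (z - p x)" using logd2_trace[of "z - p x"] by simp
      then show "q x * logd2 \<i> \<i> (z - p x) = - (q x * logd2 1 1 (z - p x))" by simp
    qed
    then show ?thesis by simp
  qed
  show ?thesis
    unfolding has_lap_def
  proof (intro conjI ballI)
    show "Ck_on 2 S (\<lambda>z. \<integral>x. q x * logd 0 (z - p x) \<partial>M)" by (rule log_potential_C2(1))
    show "lap (\<lambda>z. \<integral>x. q x * logd 0 (z - p x) \<partial>M) y = 0" if "y \<in> S" for y
      using log_potential_C2(2)[OF that] by (simp add: z)
  qed
qed

end

section \<open>A C^1 cutoff function\<close>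

definition pos2 :: "real \<Rightarrow> real" where "pos2 t = (max 0 t)\<^sup>2"

lemma DERIV_pos2: "(pos2 has_real_derivative 2 * max 0 t) (at t)"
proof -
  consider "t > 0" | "t < 0" | "t = 0" by linarith
  then show ?thesis
  proof cases
    case 1
    have "((\<lambda>t. t\<^sup>2) has_real_derivative 2 * max 0 t) (at t)"
      using 1 by (auto intro!: derivative_eq_intros)
    then show ?thesis
      by (rule has_field_derivative_transform_within_open[of _ _ _ "{0<..}"]) (use 1 in \<open>auto simp: pos2_def\<close>)
  next
    case 2
    have "((\<lambda>t. 0) has_real_derivative 2 * max 0 t) (at t)"
      using 2 by (auto intro!: derivative_eq_intros)
    then show ?thesis
      by (rule has_field_derivative_transform_within_open[of _ _ _ "{..<0}"]) (use 2 in \<open>auto simp: pos2_def\<close>)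
  next
    case 3
    have "((\<lambda>h. (pos2 (0 + h) - pos2 0) / h) \<longlongrightarrow> 0) (at 0)"
    proof (rule Lim_null_comparison)
      show "\<forall>\<^sub>F h in at 0. norm ((pos2 (0 + h) - pos2 0) / h) \<le> \<bar>h\<bar>"
        by (intro always_eventually) (auto simp: pos2_def max_def power2_eq_square)
      show "((\<lambda>h::real. \<bar>h\<bar>) \<longlongrightarrow> 0) (at 0)" by (rule tendsto_rabs_zero) (rule tendsto_ident_at)
    qed
    then show ?thesis using 3 by (simp add: has_field_derivative_iff)
  qed
qed

text \<open>Equals 1 for |w - a|^2 <= 3 r^2 and 0 for |w - a| >= 2 r. Composing the ramps
  \<open>pos2\<close> gives a C^1 function, which is enough because only one derivative of the
  density is used.\<close>

definition cutoff :: "complex \<Rightarrow> real \<Rightarrow> complex \<Rightarrow> real" where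
  "cutoff a r w = 1 - pos2 (1 - pos2 (4 - (cmod (w - a))\<^sup>2 / r\<^sup>2))"

definition cutoff1 :: "complex \<Rightarrow> real \<Rightarrow> complex \<Rightarrow> complex \<Rightarrow> real" where
  "cutoff1 a r v w = - (4 * max 0 (1 - pos2 (4 - (cmod (w - a))\<^sup>2 / r\<^sup>2)) * max 0 (4 - (cmod (w - a))\<^sup>2 / r\<^sup>2)
     * (2 * ((w - a) \<bullet> v) / r\<^sup>2))"

lemma has_pd_cutoff: "has_pd (cutoff a r) (cutoff1 a r v w) v w"
proof -
  have 1: "has_pd (\<lambda>w. 4 - (1 / r\<^sup>2) * (cmod (w - a))\<^sup>2) (0 - (1 / r\<^sup>2) * (2 * ((w - a) \<bullet> v))) v w"
    by (intro has_pd_diff has_pd_const has_pd_cmult has_pd_translate_diff has_pd_norm_sq)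
  have 2: "has_pd (\<lambda>w. 1 - pos2 (1 - pos2 (4 - (1 / r\<^sup>2) * (cmod (w - a))\<^sup>2)))
     (0 - 2 * max 0 (1 - pos2 (4 - (1 / r\<^sup>2) * (cmod (w - a))\<^sup>2)) *
       (0 - 2 * max 0 (4 - (1 / r\<^sup>2) * (cmod (w - a))\<^sup>2) * (0 - (1 / r\<^sup>2) * (2 * ((w - a) \<bullet> v))))) v w"
    by (intro has_pd_diff has_pd_const has_pd_chain[OF _ DERIV_pos2] 1)
  then show ?thesis
    by (simp add: cutoff_def[abs_def] cutoff1_def mult.assoc)
qed

lemma continuous_on_pos2[continuous_intros]: "continuous_on S f \<Longrightarrow> continuous_on S (\<lambda>x. pos2 (f x))"
  unfolding pos2_def by (intro continuous_intros)

lemma continuous_on_cutoff: "r > 0 \<Longrightarrow> continuous_on S (cutoff a r)" "r > 0 \<Longrightarrow> continuous_on S (cutoff1 a r v)"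
  unfolding cutoff_def cutoff1_def by (intro continuous_intros; simp)+

lemma cutoff_outside:
  assumes "r > 0" "w \<notin> cball a (2 * r)"
  shows "cutoff a r w = 0" "cutoff1 a r v w = 0"
proof -
  have "(2 * r)\<^sup>2 \<le> (cmod (w - a))\<^sup>2"
    using assms by (intro power_mono) (auto simp: dist_norm norm_minus_commute)
  then have "4 - (cmod (w - a))\<^sup>2 / r\<^sup>2 \<le> 0" using assms by (simp add: field_simps)
  then show "cutoff a r w = 0" "cutoff1 a r v w = 0" by (auto simp: cutoff_def cutoff1_def pos2_def max_def)
qed

lemma cutoff_inside:
  assumes "r > 0" "w \<in> ball a (3 / 2 * r)"
  shows "cutoff a r w = 1"
proof -
  have "(cmod (w - a))\<^sup>2 \<le> (3 / 2 * r)\<^sup>2"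
    using assms by (intro power_mono) (auto simp: dist_norm norm_minus_commute)
  \<comment> \<open>Since 9/4 <= 3, the argument of the inner ramp is at least 1.\<close>
  also have "\<dots> \<le> 3 * r\<^sup>2" by (simp add: power_mult_distrib power2_eq_square)
  finally have "4 - (cmod (w - a))\<^sup>2 / r\<^sup>2 \<ge> 1" using assms by (simp add: field_simps)
  then have "pos2 (4 - (cmod (w - a))\<^sup>2 / r\<^sup>2) \<ge> 1" by (simp add: pos2_def)
  then show ?thesis by (simp add: cutoff_def pos2_def[of "1 - _"] max_def)
qed

lemma cutoff_bounds: "0 \<le> cutoff a r w" "cutoff a r w \<le> 1"
proof -
  have p: "pos2 t \<ge> 0" for t by (simp add: pos2_def)
  have "pos2 (1 - pos2 t) \<le> 1" for t
    using p[of t] by (auto simp: pos2_def[of "1 - _"] intro!: power_le_one)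
  then show "0 \<le> cutoff a r w" "cutoff a r w \<le> 1" using p by (auto simp: cutoff_def)
qed

text \<open>Near a point split the density with a cutoff: one part is \<open>C\<^sup>1\<close> with compact support, the other vanishes near the point
  and so has a harmonic potential there.\<close>

lemma (in bounded_density) has_lap_conv_logd:
  assumes S: "open S" "S \<subseteq> ball 0 R"
    and c0: "continuous_on S \<rho>" and c1: "\<And>v. v \<in> {1, \<i>} \<Longrightarrow> continuous_on S (F v)"
    and d1: "\<And>v z. v \<in> {1, \<i>} \<Longrightarrow> z \<in> S \<Longrightarrow> has_pd \<rho> (F v z) v z"
  shows "has_lap S (conv (logd 0) \<rho>) \<rho>"
proof (rule has_lap_local[OF S(1)])
  fix a assume a: "a \<in> S"
  obtain r0 where r0: "r0 > 0" "ball a r0 \<subseteq> S" using S a open_contains_ball by blast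
  \<comment> \<open>The cutoff vanishes outside the closed ball of radius 2r, inside the ball of
    radius 3r where \<rho> is C^1. It equals 1 up to radius 3r/2, which leaves a gap of r/2 around
    the ball of radius r.\<close>
  define r where "r = r0 / 3"
  have r: "r > 0" "ball a (3 * r) \<subseteq> S" using r0 by (auto simp: r_def)
  define \<rho>1 where "\<rho>1 w = cutoff a r w * \<rho> w" for w
  define F1 where "F1 v w = cutoff1 a r v w * \<rho> w + cutoff a r w * F v w" for v w
  define \<rho>2 where "\<rho>2 w = (1 - cutoff a r w) * \<rho> w" for w
  have out0: "\<rho>1 w = 0" "F1 v w = 0" if "w \<notin> cball a (2 * r)" for v w
    using cutoff_outside[OF r(1) that] by (auto simp: \<rho>1_def F1_def)
  have cov: "ball a (3 * r) \<union> (- cball a (2 * r)) = UNIV" using r by auto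
  have glue: "continuous_on UNIV h" if "continuous_on (ball a (3 * r)) h" "\<And>w. w \<notin> cball a (2 * r) \<Longrightarrow> h w = 0" for h :: "complex \<Rightarrow> real"
  proof -
    have "continuous_on (- cball a (2 * r)) h"
      by (rule continuous_on_eq[OF continuous_on_const[of _ 0]]) (use that in auto)
    then show ?thesis
      unfolding cov[symmetric] using that(1) by (intro continuous_on_open_Un) auto
  qed
  have outR: "w \<notin> cball a (2 * r)" if "w \<notin> ball 0 R" for w
    using that r S by (auto simp: subset_eq)
  interpret \<rho>1: C1_density \<rho>1 F1 R
  proof
    show "continuous_on UNIV \<rho>1"
      unfolding \<rho>1_def[abs_def] using out0(1) unfolding \<rho>1_def
      by (intro glue continuous_intros continuous_on_subset[OF c0 r(2)] continuous_on_cutoff r)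
    show "continuous_on UNIV (F1 v)" if "v \<in> {1, \<i>}" for v
      unfolding F1_def[abs_def] using out0(2) unfolding F1_def
      by (intro glue continuous_intros continuous_on_subset[OF c0 r(2)] continuous_on_subset[OF c1[OF that] r(2)] continuous_on_cutoff r)
    show "has_pd \<rho>1 (F1 v z) v z" if v: "v \<in> {1, \<i>}" for v z
    proof (cases "z \<in> ball a (3 * r)")
      case True
      then show ?thesis
        unfolding \<rho>1_def[abs_def] F1_def using r v by (intro has_pd_mult has_pd_cutoff d1) auto
    next
      case False
      then have z: "z \<in> - cball a (2 * r)" using cov by auto
      show ?thesis
        unfolding out0(2)[OF z[unfolded Compl_iff]]
        by (rule has_pd_cong[OF _ z _ has_pd_const[of 0]]) (use out0 in auto)
    qed
    show "\<rho>1 z = 0" if "z \<notin> ball 0 R" for z using outR[OF that] out0 by simp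
    show "F1 v z = 0" if "z \<notin> ball 0 R" for v z using outR[OF that] out0 by simp
  qed
  have cm[measurable]: "cutoff a r \<in> borel_measurable borel"
    using continuous_on_cutoff(1)[OF r(1)] by (rule borel_measurable_continuous_onI)
  have bd: "\<bar>c * \<rho> w\<bar> \<le> B" if "\<bar>c\<bar> \<le> 1" for c w
    using mult_mono[OF that bounded[of w]] by (simp add: abs_mult)
  interpret b1: bounded_density \<rho>1 B R
    by unfold_locales (auto simp: \<rho>1_def[abs_def] support cutoff_bounds intro!: bd)
  interpret b2: bounded_density \<rho>2 B R
    by unfold_locales (auto simp: \<rho>2_def[abs_def] support cutoff_bounds intro!: bd)
  let ?U = "ball a r"
  have US: "?U \<subseteq> S" "?U \<subseteq> ball 0 R" using r S by (auto simp: subset_eq)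
  have 1: "has_lap ?U (conv (logd 0) \<rho>1) \<rho>1"
    by (rule has_lap_subset[of "ball 0 R"]) (use \<rho>1.conv_density_C2 US in \<open>auto simp: has_lap_def\<close>)
  let ?M = "restrict_space lborel (ball (0::complex) R)"
  have fm: "finite_measure ?M"
    using emeasure_ball_less_top[of 0 R]
    by (intro finite_measureI) (simp add: emeasure_restrict_space space_restrict_space)
  have 2: "has_lap ?U (\<lambda>z. \<integral>w. \<rho>2 w * logd 0 (z - w) \<partial>?M) (\<lambda>_. 0)"
  proof (rule log_potential_has_lap[OF fm open_ball, where C = "2 * R" and B = B])
    show "(\<lambda>w. w) \<in> borel_measurable ?M" "\<rho>2 \<in> borel_measurable ?M"
      by (auto intro!: measurable_restrict_space1)
    show "\<bar>\<rho>2 x\<bar> \<le> B" for x by (rule b2.bounded)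
    show "cmod (z - x) \<le> 2 * R" if "z \<in> ?U" "x \<in> space ?M" for z x
      using that US norm_triangle_ineq4[of z x] by (fastforce simp: space_restrict_space)
    show "\<exists>d>0. \<exists>s>0. \<forall>y\<in>?U \<inter> ball z s. \<forall>x\<in>space ?M. \<rho>2 x \<noteq> 0 \<longrightarrow> d \<le> cmod (y - x)" for z
    proof (rule exI[of _ "r / 2"], rule conjI[OF _ exI[of _ 1]], safe)
      fix y x assume y: "y \<in> ?U" and "\<rho>2 x \<noteq> 0"
      then have "x \<notin> ball a (3 / 2 * r)" using cutoff_inside[OF r(1), of x a] by (auto simp: \<rho>2_def)
      then show "r / 2 \<le> cmod (y - x)"
        using y dist_triangle[of a x y] by (simp add: dist_norm)
    qed (use r in auto)
  qed
  have eq: "(\<integral>w. \<rho>2 w * logd 0 (z - w) \<partial>?M) = conv (logd 0) \<rho>2 z" for z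
  proof -
    have "(\<integral>w. \<rho>2 w * logd 0 (z - w) \<partial>?M) = (\<integral>w. indicator (ball 0 R) w *\<^sub>R (\<rho>2 w * logd 0 (z - w)) \<partial>lborel)"
      by (rule integral_restrict_space) simp
    also have "\<dots> = conv (logd 0) \<rho>2 z"
      unfolding conv_def by (intro Bochner_Integration.integral_cong) (auto simp: indicator_def b2.support)
    finally show ?thesis .
  qed
  have "has_lap ?U (conv (logd 0) \<rho>) \<rho>"
  proof (rule has_lap_cong[OF open_ball has_lap_add[OF open_ball 1 2]])
    fix z assume z: "z \<in> ?U"
    have "conv (logd 0) \<rho>1 z + conv (logd 0) \<rho>2 z = conv (logd 0) \<rho> z"
      unfolding conv_def using b1.conv_integrable[of "logd 0" z] b2.conv_integrable[of "logd 0" z] z US integrable_ball_logd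
      by (subst Bochner_Integration.integral_add[symmetric]) (auto simp: \<rho>1_def \<rho>2_def algebra_simps)
    then show "conv (logd 0) \<rho>1 z + (\<integral>w. \<rho>2 w * logd 0 (z - w) \<partial>?M) = conv (logd 0) \<rho> z"
      by (simp add: eq)
    show "\<rho>1 z + 0 = \<rho> z" using z cutoff_inside[OF r(1), of z a] r by (simp add: \<rho>1_def)
  qed
  then show "\<exists>U. open U \<and> a \<in> U \<and> has_lap U (conv (logd 0) \<rho>) \<rho>"
    using r by (intro exI[of _ ?U]) auto
qed

section \<open>Symmetry and size of the Green function\<close>

text \<open>\<open>dirichlet_classical\<close> demands values on the closure, while an interior
  solution is known at the frontier only through its limits; its values off \<open>D\<close> are
  therefore replaced by those of \<open>b\<close>.\<close>

lemma has_lap_imp_dirichlet_classical: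
  assumes D: "open D" and f: "has_lap D f (\<lambda>z. V z * f z)"
    and b: "continuous_on (frontier D) b" and lim: "\<And>p. p \<in> frontier D \<Longrightarrow> (f \<longlongrightarrow> b p) (at p within D)"
  shows "dirichlet_classical D V b (\<lambda>w. if w \<in> D then f w else b w)"
proof -
  let ?\<psi> = "\<lambda>w. if w \<in> D then f w else b w"
  have "has_lap D ?\<psi> (\<lambda>z. V z * f z)"
    by (rule has_lap_cong[OF D f]) auto
  moreover have "continuous_on (closure D) ?\<psi>"
    by (rule continuous_on_closure_extend[OF D has_lap_continuous_on[OF f] b lim])
  moreover have "p \<notin> D" if "p \<in> frontier D" for p
    using that D by (auto simp: frontier_def interior_open)
  ultimately show ?thesis
    by (auto simp: dirichlet_classical_def has_lap_def)
qed

lemma has_lap_logd: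
  assumes S: "open S" "a \<notin> S"
  shows "has_lap S (\<lambda>z. logd 0 (z - a)) (\<lambda>_. 0)"
proof -
  have c: "continuous_on S (\<lambda>z. h (z - a))" if "continuous_on (- {0}) h" for h :: "complex \<Rightarrow> real"
    using S(2) by (intro continuous_on_compose2[OF that] continuous_intros) auto
  have d: "has_pd (\<lambda>z. logd 0 (z - a)) (logd1 0 v (z - a)) v z"
    "has_pd (\<lambda>z. logd1 0 v (z - a)) (logd2 v w (z - a)) w z" if "z \<in> S" for v w z
    using S(2) that by (auto intro!: has_pd_translate_diff has_pd_logd has_pd_logd1)
  note * = Ck2_I[OF S(1) c[OF continuous_on_logd] d(1) c[OF continuous_on_logd1] d(2) c[OF continuous_on_logd2]]
  show ?thesis
    using * by (auto simp: has_lap_def logd2_trace)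
qed

text \<open>The measures \<open>m z\<close> are the harmonic measures.\<close>

locale green_domain =
  fixes D :: "complex set" and g :: "complex \<Rightarrow> complex \<Rightarrow> real" and m :: "complex \<Rightarrow> complex measure"
  assumes dom: "bounded_domain D" and gf: "is_green_function D g"
    and m_fin: "\<And>z. z \<in> D \<Longrightarrow> finite_measure (m z)"
    and m_space: "\<And>z. z \<in> D \<Longrightarrow> space (m z) = frontier D"
    and m_sets: "\<And>z. z \<in> D \<Longrightarrow> sets (m z) = sets (restrict_space borel (frontier D))"
    and m_rep: "\<And>z h \<psi>. z \<in> D \<Longrightarrow> continuous_on (frontier D) h \<Longrightarrow> dirichlet_classical D (\<lambda>_. 0) h \<psi> \<Longrightarrow>
       \<psi> z = integral\<^sup>L (m z) h"
begin

lemma open_D: "open D" and bounded_D: "bounded D" and nonempty_D: "D \<noteq> {}"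
  using dom by (auto simp: bounded_domain_def)

lemma frontier_not_in: "p \<in> frontier D \<Longrightarrow> p \<notin> D"
  using open_D by (auto simp: frontier_def interior_open)

definition R where "R = (SOME R. closure D \<subseteq> ball (0::complex) R)"

lemma closure_subset_ball: "closure D \<subseteq> ball 0 R"
proof -
  have "\<exists>R. closure D \<subseteq> ball (0::complex) R"
    using bounded_D bounded_closure bounded_subset_ballD by blast
  from someI_ex[OF this] show ?thesis by (simp add: R_def)
qed

lemma D_subset_ball: "D \<subseteq> ball 0 R"
  using closure_subset closure_subset_ball by blast

lemma frontier_subset_ball: "frontier D \<subseteq> ball 0 R"
  using closure_subset_ball by (auto simp: frontier_def)

text \<open>The regular part \<open>g\<^sub>z(w) - ln \<bar>w - z\<bar> / 2\<pi>\<close>, extended over the pole.\<close>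

definition reg where "reg z = (SOME h. harmonic_on D h \<and> (\<forall>w\<in>D - {z}. g z w = ln (cmod (w - z)) / (2 * pi) + h w))"

lemma reg:
  assumes "z \<in> D"
  shows harmonic_reg: "has_lap D (reg z) (\<lambda>_. 0)"
    and green_eq: "\<And>w. w \<in> D \<Longrightarrow> w \<noteq> z \<Longrightarrow> g z w = logd 0 (w - z) + reg z w"
proof -
  have "\<exists>h. harmonic_on D h \<and> (\<forall>w\<in>D - {z}. g z w = ln (cmod (w - z)) / (2 * pi) + h w)"
    using gf assms by (auto simp: is_green_function_def)
  from someI_ex[OF this, folded reg_def] show "has_lap D (reg z) (\<lambda>_. 0)"
    "\<And>w. w \<in> D \<Longrightarrow> w \<noteq> z \<Longrightarrow> g z w = logd 0 (w - z) + reg z w"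
    unfolding harmonic_on_iff_has_lap logd_0 by blast+
qed

lemma green_boundary: "z \<in> D \<Longrightarrow> p \<in> frontier D \<Longrightarrow> (g z \<longlongrightarrow> 0) (at p within D)"
  using gf by (auto simp: is_green_function_def)

text \<open>The source of all information on the measures \<open>m z\<close>, applied below to
  constants and to regular parts of Green functions.\<close>

lemma harmonic_representation:
  assumes f: "has_lap D f (\<lambda>_. 0)" and b: "continuous_on (frontier D) b"
    and lim: "\<And>p. p \<in> frontier D \<Longrightarrow> (f \<longlongrightarrow> b p) (at p within D)" and z: "z \<in> D"
  shows "f z = integral\<^sup>L (m z) b"
  using m_rep[OF z b has_lap_imp_dirichlet_classical[OF open_D _ b lim, of "\<lambda>_. 0"]] f z by simp

lemma m_measurable: "z \<in> D \<Longrightarrow> borel_measurable (m z) = borel_measurable (restrict_space borel (frontier D))"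
  by (rule measurable_cong_sets) (auto simp: m_sets)

lemma mass_1:
  assumes z: "z \<in> D"
  shows "measure (m z) (space (m z)) = 1"
proof -
  have "(1::real) = integral\<^sup>L (m z) (\<lambda>_. 1)"
    by (rule harmonic_representation[OF has_lap_const[OF open_D] _ _ z]) auto
  then show ?thesis by simp
qed

lemma abs_integral_m_le:
  fixes f :: "complex \<Rightarrow> real"
  assumes z: "z \<in> D" and f: "\<And>x. x \<in> frontier D \<Longrightarrow> \<bar>f x\<bar> \<le> C"
  shows "\<bar>integral\<^sup>L (m z) f\<bar> \<le> C"
proof -
  interpret finite_measure "m z" by (rule m_fin[OF z])
  show ?thesis
  proof (cases "integrable (m z) f")
    case True
    have "\<bar>integral\<^sup>L (m z) f\<bar> \<le> (\<integral>x. \<bar>f x\<bar> \<partial>m z)" by (rule integral_abs_bound)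
    also have "\<dots> \<le> (\<integral>x. C \<partial>m z)"
      using True f m_space[OF z] by (intro integral_mono) auto
    also have "\<dots> = C" using mass_1[OF z] by simp
    finally show ?thesis .
  next
    case False
    \<comment> \<open>Without integrability the integral is 0 and only \<open>0 \<le> C\<close> is
      needed; a frontier point provides it.\<close>
    have "frontier D \<noteq> {}"
      using open_D bounded_D nonempty_D frontier_eq_empty not_bounded_UNIV by metis
    then show ?thesis using False f by (force simp: not_integrable_integral_eq)
  qed
qed

lemma reg_boundary:
  assumes z: "z \<in> D" and p: "p \<in> frontier D"
  shows "(reg z \<longlongrightarrow> - logd 0 (p - z)) (at p within D)"
proof -
  have pz: "p \<noteq> z" using frontier_not_in[OF p] z by auto
  have "((\<lambda>w. logd 0 (w - z)) \<longlongrightarrow> logd 0 (p - z)) (at p within D)"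
    unfolding logd_def using pz by (intro tendsto_intros) auto
  then have "((\<lambda>w. g z w - logd 0 (w - z)) \<longlongrightarrow> 0 - logd 0 (p - z)) (at p within D)"
    by (intro tendsto_diff green_boundary z p)
  moreover have "\<forall>\<^sub>F w in at p within D. g z w - logd 0 (w - z) = reg z w"
  proof -
    have "\<forall>\<^sub>F w in at p within D. w \<noteq> z"
      using pz by (intro eventually_neq_at_within)
    moreover have "\<forall>\<^sub>F w in at p within D. w \<in> D" by (simp add: eventually_at_filter)
    ultimately show ?thesis by eventually_elim (simp add: green_eq[OF z])
  qed
  ultimately show ?thesis using Lim_transform_eventually by fastforce
qed

lemma continuous_on_logd_frontier: "z \<in> D \<Longrightarrow> continuous_on (frontier D) (\<lambda>\<zeta>. logd 0 (\<zeta> - z))"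
  by (intro continuous_on_compose2[OF continuous_on_logd[of 0 "- {0}"]] continuous_intros)
    (auto dest: frontier_not_in)

section \<open>Logarithmic potentials of harmonic measures, sign and symmetry of the Green
  function\<close>

definition pot where "pot w z = (\<integral>\<zeta>. logd 0 (z - \<zeta>) \<partial>m w)"
definition pot1 where "pot1 v w z = (\<integral>\<zeta>. logd1 0 v (z - \<zeta>) \<partial>m w)"
definition pot2 where "pot2 u v w z = (\<integral>\<zeta>. logd2 u v (z - \<zeta>) \<partial>m w)"

text \<open>\<open>reg z\<close> is harmonic with boundary values
  \<open>- logd 0 (\<zeta> - z)\<close>. In the resulting integral the pole z is the argument of a
  kernel smooth off the frontier, so the dependence on z can be differentiated.\<close>

lemma reg_eq_pot:
  assumes "z \<in> D" "w \<in> D"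
  shows "reg z w = - pot w z"
proof -
  have "reg z w = (\<integral>\<zeta>. - logd 0 (\<zeta> - z) \<partial>m w)"
    using assms by (intro harmonic_representation harmonic_reg reg_boundary continuous_on_minus continuous_on_logd_frontier)
  then show ?thesis by (simp add: pot_def logd_minus_commute[of 0 z])
qed

lemma frontier_far:
  assumes z: "z \<in> D"
  shows "\<exists>d>0. \<exists>r>0. \<forall>y\<in>D \<inter> ball z r. \<forall>\<zeta>\<in>frontier D. d \<le> cmod (y - \<zeta>)"
proof -
  obtain e where e: "e > 0" "ball z e \<subseteq> D" using open_D z open_contains_ball by blast
  have "e / 2 \<le> cmod (y - \<zeta>)" if "y \<in> ball z (e / 2)" "\<zeta> \<in> frontier D" for y \<zeta>
  proof -
    have "\<zeta> \<notin> ball z e" using frontier_not_in[OF that(2)] e by auto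
    then show ?thesis using that(1) dist_triangle[of z \<zeta> y] by (simp add: dist_norm)
  qed
  then show ?thesis using e by (intro exI[of _ "e / 2"] conjI) auto
qed

lemma norm_diff_le_diameter:
  assumes "z \<in> ball 0 R" "\<zeta> \<in> ball 0 R"
  shows "cmod (z - \<zeta>) \<le> 2 * R"
  using assms norm_triangle_ineq4[of z \<zeta>] by simp

lemma pot_facts:
  assumes w: "w \<in> D"
  shows "has_lap D (pot w) (\<lambda>_. 0)"
    "\<And>v z. v \<in> {1, \<i>} \<Longrightarrow> z \<in> D \<Longrightarrow> has_pd (pot w) (pot1 v w z) v z"
    "\<And>u v z. u \<in> {1, \<i>} \<Longrightarrow> v \<in> {1, \<i>} \<Longrightarrow> z \<in> D \<Longrightarrow> has_pd (pot1 u w) (pot2 u v w z) v z"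
    "continuous_on D (pot w)" "\<And>v. v \<in> {1, \<i>} \<Longrightarrow> continuous_on D (pot1 v w)"
    "\<And>u v. u \<in> {1, \<i>} \<Longrightarrow> v \<in> {1, \<i>} \<Longrightarrow> continuous_on D (pot2 u v w)"
    "\<And>z. z \<in> D \<Longrightarrow> pot2 1 1 w z + pot2 \<i> \<i> w z = 0"
    "\<And>z. z \<in> D \<Longrightarrow> \<exists>r>0. \<exists>C. \<forall>y\<in>D \<inter> ball z r. \<forall>\<zeta>\<in>frontier D. \<forall>u\<in>{1, \<i>}. \<forall>v\<in>{1, \<i>}.
       \<bar>logd 0 (y - \<zeta>)\<bar> \<le> C \<and> \<bar>logd1 0 u (y - \<zeta>)\<bar> \<le> C \<and> \<bar>logd2 u v (y - \<zeta>)\<bar> \<le> C"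
proof -
  have hyp: "finite_measure (m w)" "(\<lambda>\<zeta>. \<zeta>) \<in> borel_measurable (m w)" "(\<lambda>_. 1::real) \<in> borel_measurable (m w)"
    "\<bar>1::real\<bar> \<le> 1"
    "\<And>z x. z \<in> D \<Longrightarrow> x \<in> space (m w) \<Longrightarrow> (1::real) \<noteq> 0 \<Longrightarrow> cmod (z - x) \<le> 2 * R"
    "\<And>z. z \<in> D \<Longrightarrow> \<exists>d>0. \<exists>r>0. \<forall>y\<in>D \<inter> ball z r. \<forall>x\<in>space (m w). (1::real) \<noteq> 0 \<longrightarrow> d \<le> cmod (y - x)"
    using m_fin[OF w] frontier_far norm_diff_le_diameter D_subset_ball frontier_subset_ball
    by (auto simp: m_space[OF w] m_measurable[OF w] subset_eq intro: measurable_restrict_space1)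
  note F = log_potential_C2[where M = "m w" and S = D and p = "\<lambda>\<zeta>. \<zeta>" and q = "\<lambda>_. 1" and B = 1 and C = "2 * R", OF hyp(1) open_D hyp(2-6), simplified] and H = log_potential_has_lap[where M = "m w" and S = D and p = "\<lambda>\<zeta>. \<zeta>" and q = "\<lambda>_. 1" and B = 1 and C = "2 * R", OF hyp(1) open_D hyp(2-6), simplified]
    and B = log_potential_local_bounds[where M = "m w" and S = D and p = "\<lambda>\<zeta>. \<zeta>" and q = "\<lambda>_. 1" and B = 1 and C = "2 * R", OF hyp(1) open_D hyp(2-6), simplified]
  have eqs: "pot w = (\<lambda>z. \<integral>\<zeta>. logd 0 (z - \<zeta>) \<partial>m w)" "\<And>v. pot1 v w = (\<lambda>z. \<integral>\<zeta>. logd1 0 v (z - \<zeta>) \<partial>m w)"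
    "\<And>u v. pot2 u v w = (\<lambda>z. \<integral>\<zeta>. logd2 u v (z - \<zeta>) \<partial>m w)"
    by (simp_all add: pot_def pot1_def pot2_def fun_eq_iff)
  show h: "has_lap D (pot w) (\<lambda>_. 0)" unfolding eqs using H .
  show "has_pd (pot w) (pot1 v w z) v z" if "v \<in> {1, \<i>}" "z \<in> D" for v z
    unfolding eqs using F(3) that by auto
  show "has_pd (pot1 u w) (pot2 u v w z) v z" if "u \<in> {1, \<i>}" "v \<in> {1, \<i>}" "z \<in> D" for u v z
    unfolding eqs using F(4) that by auto
  show "continuous_on D (pot w)" unfolding eqs using F(5) .
  show "continuous_on D (pot1 v w)" if "v \<in> {1, \<i>}" for v unfolding eqs using F(6) that by auto
  show "continuous_on D (pot2 u v w)" if "u \<in> {1, \<i>}" "v \<in> {1, \<i>}" for u v unfolding eqs using F(7) that by auto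
  show "pot2 1 1 w z + pot2 \<i> \<i> w z = 0" if "z \<in> D" for z
    unfolding eqs using F(2)[OF that] H that by (simp add: has_lap_def)
  show "\<exists>r>0. \<exists>C. \<forall>y\<in>D \<inter> ball z r. \<forall>\<zeta>\<in>frontier D. \<forall>u\<in>{1, \<i>}. \<forall>v\<in>{1, \<i>}.
       \<bar>logd 0 (y - \<zeta>)\<bar> \<le> C \<and> \<bar>logd1 0 u (y - \<zeta>)\<bar> \<le> C \<and> \<bar>logd2 u v (y - \<zeta>)\<bar> \<le> C" if "z \<in> D" for z
    using B[OF that] by (simp add: m_space[OF w])
qed

text \<open>The maximum principle on the punctured domain: the limits are 0 on the frontier of
  \<open>D\<close> and minus infinity at the pole.\<close>

lemma green_nonpos:
  assumes z: "z \<in> D" and w: "w \<in> D" "w \<noteq> z"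
  shows "logd 0 (w - z) + reg z w \<le> 0"
proof (rule harmonic_maximum_principle[of "D - {z}"])
  show "open (D - {z})" "bounded (D - {z})" using open_D bounded_D by (auto intro: bounded_subset)
  have "has_lap (D - {z}) (\<lambda>w. logd 0 (w - z)) (\<lambda>_. 0)"
    using open_D by (intro has_lap_logd) auto
  from has_lap_add[OF _ this has_lap_subset[OF harmonic_reg[OF z] open_D]] open_D
  show "harmonic_on (D - {z}) (\<lambda>w. logd 0 (w - z) + reg z w)"
    by (auto simp: harmonic_on_iff_has_lap)
  show "w \<in> D - {z}" using w by simp
  fix p e :: "real" and q :: complex
  show "\<forall>\<^sub>F w in at q within D - {z}. logd 0 (w - z) + reg z w < e" if q: "q \<in> frontier (D - {z})" and e: "e > 0"
  proof (cases "q = z")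
    case False
    have "q \<in> frontier D"
      using q False open_D by (auto simp: frontier_def interior_open closure_def interior_open open_delete islimpt_def)
    have "(g z \<longlongrightarrow> 0) (at q within (D - {z}))"
      using green_boundary[OF z \<open>q \<in> frontier D\<close>] tendsto_within_subset by blast
    then have "\<forall>\<^sub>F w in at q within D - {z}. g z w < e" using e order_tendstoD(2) by blast
    moreover have "\<forall>\<^sub>F w in at q within D - {z}. w \<in> D - {z}" by (simp add: eventually_at_filter)
    ultimately show ?thesis by eventually_elim (simp add: green_eq[OF z])
  next
    case True
    have "isCont (reg z) z"
      using has_lap_continuous_on[OF harmonic_reg[OF z]] continuous_on_eq_continuous_at[OF open_D] z by blast
    then have "\<forall>\<^sub>F w in at z. reg z w < reg z z + 1"
      by (intro order_tendstoD(2)[of _ "reg z z"]) (auto simp: isCont_def)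
    then have 1: "\<forall>\<^sub>F w in at z within D - {z}. reg z w < reg z z + 1"
      using at_le[of "D - {z}" UNIV z] filter_leD by blast
    \<comment> \<open>Solves ln d / (2 pi) = - (reg z z + 1): within this radius the logarithm
      outweighs the local upper bound of \<open>reg z\<close>.\<close>
    define d where "d = exp (2 * pi * (- (reg z z + 1)))"
    have "d > 0" by (simp add: d_def)
    have 2: "\<forall>\<^sub>F w in at z within D - {z}. logd 0 (w - z) < - (reg z z + 1)"
      unfolding eventually_at
    proof (intro exI[of _ d] conjI ballI impI \<open>d > 0\<close>)
      fix w assume w: "w \<in> D - {z}" "w \<noteq> z \<and> dist w z < d"
      then have "ln (cmod (w - z)) < ln d" using \<open>d > 0\<close> by (subst ln_less_cancel_iff) (auto simp: dist_norm)
      then have "ln (cmod (w - z)) < 2 * pi * (- (reg z z + 1))" by (simp add: d_def)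
      then show "logd 0 (w - z) < - (reg z z + 1)"
        unfolding logd_0 by (simp add: divide_less_eq mult.commute)
    qed
    show ?thesis unfolding True using 1 2 by eventually_elim (use e in linarith)
  qed
qed

text \<open>By harmonic representation, \<open>reg z w\<close> is also harmonic in \<open>z\<close>. Since \<open>g \<le> 0\<close>, at a boundary point its upper limit in \<open>z\<close>
  is at most the boundary value of \<open>reg w z\<close>; the maximum principle gives \<open>reg z w \<le> reg w z\<close>, and the roles can be exchanged.\<close>

lemma reg_sym:
  assumes z: "z \<in> D" and w: "w \<in> D"
  shows "reg z w = reg w z"
proof -
  have le: "reg z w \<le> reg w z" if z: "z \<in> D" and w: "w \<in> D" for z w
  proof -
    have "- 1 * pot w z - reg w z \<le> 0"
    proof (rule harmonic_maximum_principle[OF open_D bounded_D _ _ z])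
      show "harmonic_on D (\<lambda>z. - 1 * pot w z - reg w z)"
        using has_lap_diff[OF open_D has_lap_cmult[OF open_D pot_facts(1)[OF w]] harmonic_reg[OF w], of "-1"]
        by (simp add: harmonic_on_iff_has_lap)
      fix p and e :: real assume p: "p \<in> frontier D" and e: "e > 0"
      have pw: "p \<noteq> w" using frontier_not_in[OF p] w by auto
      have "((\<lambda>y. - logd 0 (y - w)) \<longlongrightarrow> - logd 0 (p - w)) (at p within D)"
        unfolding logd_def using pw by (intro tendsto_intros) auto
      then have "((\<lambda>y. - logd 0 (y - w) - reg w y) \<longlongrightarrow> - logd 0 (p - w) - - logd 0 (p - w)) (at p within D)"
        by (intro tendsto_diff reg_boundary w p)
      then have "\<forall>\<^sub>F y in at p within D. - logd 0 (y - w) - reg w y < e"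
        using e by (intro order_tendstoD(2)[of _ 0]) auto
      moreover have "\<forall>\<^sub>F y in at p within D. y \<in> D" by (simp add: eventually_at_filter)
      moreover have "\<forall>\<^sub>F y in at p within D. y \<noteq> w" using pw by (intro eventually_neq_at_within)
      ultimately show "\<forall>\<^sub>F y in at p within D. - 1 * pot w y - reg w y < e"
      proof eventually_elim
        case (elim y)
        then show ?case
          using green_nonpos[of y w] reg_eq_pot[of y w] w by (simp add: logd_minus_commute[of 0 w])
      qed
    qed
    then show ?thesis using reg_eq_pot[OF z w] by simp
  qed
  show ?thesis using le[OF z w] le[OF w z] by simp
qed

lemma green_sym: "z \<in> D \<Longrightarrow> w \<in> D \<Longrightarrow> z \<noteq> w \<Longrightarrow> g z w = g w z"
  using reg_sym[of z w] by (simp add: green_eq logd_minus_commute)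

text \<open>For 0 < |x| <= 2R this is ln (2R / |x|) / (2 pi), minus the Green function of a disc of
  radius 2R centred at the pole; the absolute value keeps it nonnegative elsewhere.\<close>

definition gbound where "gbound x = \<bar>ln (2 * R) / (2 * pi) - logd 0 x\<bar>"

text \<open>The Green function is nonpositive, and \<open>reg z w\<close> is the average of - ln |z
  - \<zeta>| / (2 pi) over a probability measure, with |z - \<zeta>| <= 2R. The bound depends on z -
  w only, so integrals of the Green function are bounded uniformly in z.\<close>

lemma abs_green_le:
  assumes z: "z \<in> D" and w: "w \<in> D" "w \<noteq> z"
  shows "\<bar>g z w\<bar> \<le> gbound (z - w)"
proof -
  have "- (ln (2 * R) / (2 * pi)) \<le> reg z w"
  proof -
    have "continuous_on (frontier D) (\<lambda>\<zeta>. logd 0 (\<zeta> - z))" by (rule continuous_on_logd_frontier[OF z])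
    moreover have "compact (frontier D)" using bounded_D by (simp add: compact_frontier_bounded)
    ultimately have "bounded ((\<lambda>\<zeta>. logd 0 (\<zeta> - z)) ` frontier D)"
      by (intro compact_imp_bounded compact_continuous_image)
    then obtain C where C: "\<And>\<zeta>. \<zeta> \<in> frontier D \<Longrightarrow> \<bar>logd 0 (\<zeta> - z)\<bar> \<le> C"
      by (auto simp: bounded_iff)
    interpret finite_measure "m w" by (rule m_fin[OF w(1)])
    have meas: "(\<lambda>\<zeta>. logd 0 (z - \<zeta>)) \<in> borel_measurable (m w)"
      unfolding m_measurable[OF w(1)] by (intro measurable_restrict_space1) measurable
    have int: "integrable (m w) (\<lambda>\<zeta>. logd 0 (z - \<zeta>))"
      using meas C by (intro integrable_const_bound[of _ C]) (auto simp: m_space[OF w(1)] logd_minus_commute[of 0 z])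
    have "pot w z \<le> (\<integral>\<zeta>. ln (2 * R) / (2 * pi) \<partial>m w)"
      unfolding pot_def
    proof (intro integral_mono int)
      fix \<zeta> assume "\<zeta> \<in> space (m w)"
      then have f: "\<zeta> \<in> frontier D" by (simp add: m_space[OF w(1)])
      then have "z \<noteq> \<zeta>" using frontier_not_in z by auto
      moreover have "cmod (z - \<zeta>) \<le> 2 * R"
        using f z D_subset_ball frontier_subset_ball by (intro norm_diff_le_diameter) auto
      ultimately show "logd 0 (z - \<zeta>) \<le> ln (2 * R) / (2 * pi)"
        unfolding logd_0 by (intro divide_right_mono ln_mono) auto
    qed simp
    also have "\<dots> = ln (2 * R) / (2 * pi)" using mass_1[OF w(1)] by simp
    finally show ?thesis using reg_eq_pot[OF z w(1)] by simp
  qed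
  then show ?thesis
    using green_nonpos[OF assms] unfolding green_eq[OF assms] gbound_def logd_minus_commute[of 0 z] by linarith
qed

end

section \<open>The Green operator\<close>

context green_domain
begin

abbreviation "LD \<equiv> restrict_space lborel D"

lemma D_sets: "D \<inter> space lborel \<in> sets lborel" "D \<in> sets borel"
  using open_D by auto

lemma space_LD: "space LD = D"
  by (simp add: space_restrict_space)

lemma finite_LD: "finite_measure LD"
  using emeasure_bounded_finite[OF bounded_D] D_sets
  by (intro finite_measureI) (simp add: emeasure_restrict_space space_LD)

lemma integral_LD: "integral\<^sup>L LD f = (\<integral>w. f w * indicator D w \<partial>lborel)" for f :: "complex \<Rightarrow> real"
  using integral_restrict_space[OF D_sets(1), of f] by (simp add: mult.commute)

lemma integrable_LD: "integrable LD f \<longleftrightarrow> integrable lborel (\<lambda>w. f w * indicator D w)" for f :: "complex \<Rightarrow> real"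
  using integrable_restrict_space[OF D_sets(1), of f] by (simp add: mult.commute)

lemma AE_LD_neq: "AE w in LD. w \<noteq> z"
  unfolding AE_restrict_space_iff[OF D_sets(1)] using AE_lborel_neq[of z] by eventually_elim simp

lemma measurable_LD_iff: "f \<in> borel_measurable LD \<longleftrightarrow> (\<lambda>w. f w * indicator D w) \<in> borel_measurable borel"
  for f :: "complex \<Rightarrow> real"
  using borel_measurable_restrict_space_iff[OF D_sets(1), of f] by (simp add: mult.commute)

lemma continuous_imp_measurable_LD: "continuous_on D f \<Longrightarrow> f \<in> borel_measurable LD" for f :: "complex \<Rightarrow> real"
  using borel_measurable_continuous_on_restrict[of D f]
  by (subst measurable_cong_sets[OF sets_restrict_space_cong[OF sets_lborel] refl])

text \<open>Bounded by \<open>B\<close> and measurable on \<open>D\<close>.\<close>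

definition bdm :: "(complex \<Rightarrow> real) \<Rightarrow> real \<Rightarrow> bool" where
  "bdm \<phi> B \<longleftrightarrow> \<phi> \<in> borel_measurable LD \<and> (\<forall>w\<in>D. \<bar>\<phi> w\<bar> \<le> B)"

lemma bdm_nonneg: "bdm \<phi> B \<Longrightarrow> 0 \<le> B"
  using nonempty_D by (force simp: bdm_def)

lemma bdm_density:
  assumes "bdm \<phi> B"
  shows "bounded_density (\<lambda>w. \<phi> w * indicator D w) B R"
  using assms bdm_nonneg[OF assms] D_subset_ball
  by unfold_locales (auto simp: bdm_def measurable_LD_iff indicator_def)

lemma bdm_add: "bdm f A \<Longrightarrow> bdm f' B \<Longrightarrow> bdm (\<lambda>w. f w + f' w) (A + B)"
  by (auto simp: bdm_def intro: abs_triangle_ineq[THEN order_trans] add_mono)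

lemma bdm_mult: "bdm f A \<Longrightarrow> bdm f' B \<Longrightarrow> bdm (\<lambda>w. f w * f' w) (A * B)"
  using bdm_nonneg[of f A] by (auto simp: bdm_def abs_mult intro!: mult_mono)

lemma bdm_const: "bdm (\<lambda>_. c) \<bar>c\<bar>"
  by (simp add: bdm_def)

lemma gbound_kernel:
  shows "gbound \<in> borel_measurable borel" and "integrable lborel (\<lambda>x. indicator (ball 0 r) x * gbound x)"
proof -
  show m: "gbound \<in> borel_measurable borel" unfolding gbound_def[abs_def] by measurable
  have "integrable lborel (\<lambda>x::complex. ln (2 * R) / (2 * pi) * indicator (ball 0 r) x)"
    by (intro integrable_mult_right integrable_real_indicator) (auto simp: emeasure_ball_less_top)
  from integrable_abs[OF Bochner_Integration.integrable_diff[OF this integrable_ball_logd[of 0 r]]]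
  have "integrable lborel (\<lambda>x. \<bar>ln (2 * R) / (2 * pi) * indicator (ball 0 r) x - indicator (ball 0 r) x * logd 0 x\<bar>)"
    by simp
  also have "(\<lambda>x. \<bar>ln (2 * R) / (2 * pi) * indicator (ball 0 r) x - indicator (ball 0 r) x * logd 0 x\<bar>)
     = (\<lambda>x. indicator (ball 0 r) x * gbound x)"
    by (auto simp: indicator_def gbound_def)
  finally show "integrable lborel (\<lambda>x. indicator (ball 0 r) x * gbound x)" .
qed

lemma green_measurable:
  assumes z: "z \<in> D"
  shows "g z \<in> borel_measurable LD"
proof -
  \<comment> \<open>\<open>is_green_function\<close> does not fix the value at the pole, hence the
    case distinction at one point.\<close>
  have "(\<lambda>w. if w = z then g z z else logd 0 (w - z) + reg z w) \<in> borel_measurable LD"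
  proof (rule measurable_If)
    have "(\<lambda>w. logd 0 (w - z)) \<in> borel_measurable LD"
      by (rule measurable_restrict_space1) simp
    then show "(\<lambda>w. logd 0 (w - z) + reg z w) \<in> borel_measurable LD"
      by (rule borel_measurable_add) (rule continuous_imp_measurable_LD[OF has_lap_continuous_on[OF harmonic_reg[OF z]]])
    show "{x \<in> space LD. x = z} \<in> sets LD"
      using z by (auto simp: space_LD sets_restrict_space intro!: image_eqI[of _ _ "{z}"])
  qed simp
  then show ?thesis
    by (rule measurable_cong[THEN iffD1, rotated]) (auto simp: space_LD green_eq[OF z])
qed

section \<open>The Green operator on bounded measurable functions\<close>

definition Gop :: "(complex \<Rightarrow> real) \<Rightarrow> complex \<Rightarrow> real" where
  "Gop \<phi> z = (\<integral>w. \<phi> w * g z w \<partial>LD)"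

text \<open>A bound for the integral of |g_z| over \<open>D\<close>, the same for all z, because z -
  w stays in the ball of radius 2R.\<close>

definition Gconst :: real where
  "Gconst = (\<integral>x. indicator (ball 0 (2 * R)) x * gbound x \<partial>lborel)"

lemma Gconst_nonneg: "0 \<le> Gconst"
  unfolding Gconst_def by (intro Bochner_Integration.integral_nonneg) (simp add: gbound_def)

text \<open>Kept general in the kernel because it serves both for \<open>gbound\<close> and for its
  truncated tail in the boundary estimate.\<close>

lemma gbound_LD:
  fixes \<kappa> :: "complex \<Rightarrow> real"
  assumes z: "z \<in> D" and \<kappa>: "\<kappa> \<in> borel_measurable borel" "\<And>r. integrable lborel (\<lambda>x. indicator (ball 0 r) x * \<kappa> x)"
    and nn: "\<And>x. 0 \<le> \<kappa> x"
  shows "integrable LD (\<lambda>w. \<kappa> (z - w))"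
    and "(\<integral>w. \<kappa> (z - w) \<partial>LD) \<le> (\<integral>x. indicator (ball 0 (2 * R)) x * \<kappa> x \<partial>lborel)"
proof -
  have "bdm (\<lambda>_. 1) 1" using bdm_const[of 1] by simp
  then interpret bounded_density "\<lambda>w. 1 * indicator D w" 1 R by (rule bdm_density)
  have zR: "z \<in> ball 0 R" using z D_subset_ball by auto
  show "integrable LD (\<lambda>w. \<kappa> (z - w))"
    using conv_integrable[OF \<kappa> zR] by (simp add: integrable_LD mult.commute)
  have "(\<integral>w. \<kappa> (z - w) \<partial>LD) = conv \<kappa> (\<lambda>w. 1 * indicator D w) z"
    by (simp add: integral_LD conv_def mult.commute)
  also have "\<dots> \<le> (\<integral>x. indicator (ball 0 (2 * R)) x * \<kappa> x \<partial>lborel)"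
    using abs_conv_le[OF \<kappa> zR] nn by simp
  finally show "(\<integral>w. \<kappa> (z - w) \<partial>LD) \<le> (\<integral>x. indicator (ball 0 (2 * R)) x * \<kappa> x \<partial>lborel)" .
qed

lemma gbound_nonneg: "0 \<le> gbound x" by (simp add: gbound_def)

lemma AE_green_le: "z \<in> D \<Longrightarrow> AE w in LD. \<bar>g z w\<bar> \<le> gbound (z - w)"
  using AE_LD_neq[of z] AE_space[of LD]
  by eventually_elim (simp add: space_LD abs_green_le)

lemma green_integrable: "z \<in> D \<Longrightarrow> integrable LD (g z)"
  by (rule Bochner_Integration.integrable_bound[OF gbound_LD(1)[OF _ gbound_kernel gbound_nonneg] green_measurable])
    (use AE_green_le gbound_nonneg in auto)

lemma Gop_integrable:
  assumes \<phi>: "bdm \<phi> B" and z: "z \<in> D"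
  shows "integrable LD (\<lambda>w. \<phi> w * g z w)"
proof (rule Bochner_Integration.integrable_bound)
  show "integrable LD (\<lambda>w. B * \<bar>g z w\<bar>)"
    by (intro integrable_mult_right integrable_abs green_integrable z)
  show "(\<lambda>w. \<phi> w * g z w) \<in> borel_measurable LD"
    using \<phi> green_measurable[OF z] by (auto simp: bdm_def)
  show "AE w in LD. norm (\<phi> w * g z w) \<le> norm (B * \<bar>g z w\<bar>)"
    using \<phi> bdm_nonneg[OF \<phi>] by (intro AE_I2) (auto simp: bdm_def space_LD abs_mult intro!: mult_right_mono)
qed

lemma abs_Gop_le:
  assumes \<phi>: "bdm \<phi> B" and z: "z \<in> D"
  shows "\<bar>Gop \<phi> z\<bar> \<le> B * Gconst"
proof -
  have "\<bar>Gop \<phi> z\<bar> \<le> (\<integral>w. \<bar>\<phi> w * g z w\<bar> \<partial>LD)" unfolding Gop_def by (rule integral_abs_bound)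
  also have "\<dots> \<le> (\<integral>w. B * gbound (z - w) \<partial>LD)"
  proof (rule integral_mono_AE)
    show "AE w in LD. \<bar>\<phi> w * g z w\<bar> \<le> B * gbound (z - w)"
      using AE_green_le[OF z] AE_space[of LD]
    proof eventually_elim
      case (elim w)
      then show ?case
        unfolding abs_mult using \<phi> bdm_nonneg[OF \<phi>] by (intro mult_mono) (auto simp: bdm_def space_LD)
    qed
  qed (auto intro!: integrable_abs Gop_integrable[OF \<phi> z] integrable_mult_right gbound_LD(1)[OF z gbound_kernel gbound_nonneg])
  also have "\<dots> \<le> B * Gconst"
    using gbound_LD(2)[OF z gbound_kernel gbound_nonneg] bdm_nonneg[OF \<phi>]
    by (simp add: Gconst_def mult_left_mono)
  finally show ?thesis .
qed

lemma Gop_cong: "(\<And>w. w \<in> D \<Longrightarrow> \<phi> w = \<psi> w) \<Longrightarrow> Gop \<phi> z = Gop \<psi> z"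
  unfolding Gop_def by (intro Bochner_Integration.integral_cong) (auto simp: space_LD)

lemma Gop_add: "bdm \<phi> A \<Longrightarrow> bdm \<psi> B \<Longrightarrow> z \<in> D \<Longrightarrow> Gop (\<lambda>w. \<phi> w + \<psi> w) z = Gop \<phi> z + Gop \<psi> z"
  unfolding Gop_def distrib_right by (intro Bochner_Integration.integral_add Gop_integrable)

lemma Gop_cmult: "Gop (\<lambda>w. c * \<phi> w) z = c * Gop \<phi> z"
  unfolding Gop_def by (simp add: mult.assoc)

section \<open>Splitting the Green operator into a logarithmic potential and a harmonic
  remainder\<close>

definition Kpot where "Kpot \<phi> z = (\<integral>w. \<phi> w * pot w z \<partial>LD)"
definition Kpot1 where "Kpot1 \<phi> v z = (\<integral>w. \<phi> w * pot1 v w z \<partial>LD)"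

text \<open>The bounds hold for all w at once: they are bounds of the kernels on the frontier, and
  every \<open>m w\<close> has mass 1.\<close>

lemma pot_local_bounds:
  assumes z: "z \<in> D"
  shows "\<exists>r>0. \<exists>C. \<forall>y\<in>D \<inter> ball z r. \<forall>w\<in>D. \<forall>u\<in>{1, \<i>}. \<forall>v\<in>{1, \<i>}.
       \<bar>pot w y\<bar> \<le> C \<and> \<bar>pot1 u w y\<bar> \<le> C \<and> \<bar>pot2 u v w y\<bar> \<le> C"
proof -
  obtain r C where r: "r > 0" and C: "\<forall>y\<in>D \<inter> ball z r. \<forall>\<zeta>\<in>frontier D. \<forall>u\<in>{1, \<i>}. \<forall>v\<in>{1, \<i>}.
       \<bar>logd 0 (y - \<zeta>)\<bar> \<le> C \<and> \<bar>logd1 0 u (y - \<zeta>)\<bar> \<le> C \<and> \<bar>logd2 u v (y - \<zeta>)\<bar> \<le> C"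
    using pot_facts(8)[OF z z] by blast
  show ?thesis
    unfolding pot_def pot1_def pot2_def
    by (rule exI[of _ r], intro conjI r, rule exI[of _ C], intro ballI conjI abs_integral_m_le) (use C in auto)
qed

text \<open>Measurability in w, the index of the measures: \<open>- pot w z = reg z w\<close> is
  harmonic, hence continuous, in w.\<close>

lemma pot_measurable: "z \<in> D \<Longrightarrow> (\<lambda>w. pot w z) \<in> borel_measurable LD"
proof -
  assume z: "z \<in> D"
  have "continuous_on D (\<lambda>w. pot w z)"
    by (rule continuous_on_eq[OF continuous_on_minus[OF has_lap_continuous_on[OF harmonic_reg[OF z]]]])
      (simp add: reg_eq_pot[OF z])
  then show ?thesis by (rule continuous_imp_measurable_LD)
qed

lemma Kpot_facts:
  assumes \<phi>: "bdm \<phi> B"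
  shows "has_lap D (Kpot \<phi>) (\<lambda>_. 0)"
    "\<And>v z. v \<in> {1, \<i>} \<Longrightarrow> z \<in> D \<Longrightarrow> has_pd (Kpot \<phi>) (Kpot1 \<phi> v z) v z"
    "continuous_on D (Kpot \<phi>)" "\<And>v. v \<in> {1, \<i>} \<Longrightarrow> continuous_on D (Kpot1 \<phi> v)"
proof -
  have m: "(\<lambda>w. \<phi> w * pot w z) \<in> borel_measurable LD" if "z \<in> D" for z
    using \<phi> pot_measurable[OF that] by (auto simp: bdm_def)
  have d1: "has_pd (\<lambda>y. \<phi> x * pot x y) (\<phi> x * pot1 v x z) v z"
    if "v \<in> {1, \<i>}" "z \<in> D" "x \<in> space LD" for v z x
    using that by (intro has_pd_cmult pot_facts) (auto simp: space_LD)
  have d2: "has_pd (\<lambda>y. \<phi> x * pot1 v x y) (\<phi> x * pot2 v w x z) w z"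
    if "v \<in> {1, \<i>}" "w \<in> {1, \<i>}" "z \<in> D" "x \<in> space LD" for v w z x
    using that by (intro has_pd_cmult pot_facts) (auto simp: space_LD)
  have c0: "continuous_on D (\<lambda>z. \<phi> x * pot x z)" if "x \<in> space LD" for x
    using that by (intro continuous_on_mult_left pot_facts) (auto simp: space_LD)
  have c1: "continuous_on D (\<lambda>z. \<phi> x * pot1 v x z)" if "v \<in> {1, \<i>}" "x \<in> space LD" for v x
    using that by (intro continuous_on_mult_left pot_facts) (auto simp: space_LD)
  have c2: "continuous_on D (\<lambda>z. \<phi> x * pot2 v w x z)" if "v \<in> {1, \<i>}" "w \<in> {1, \<i>}" "x \<in> space LD" for v w x
    using that by (intro continuous_on_mult_left pot_facts) (auto simp: space_LD)
  have bd: "\<exists>r>0. \<exists>C. \<forall>y\<in>D \<inter> ball z r. \<forall>x\<in>space LD. \<forall>v\<in>{1, \<i>}. \<forall>w\<in>{1, \<i>}.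
     \<bar>\<phi> x * pot x y\<bar> \<le> C \<and> \<bar>\<phi> x * pot1 v x y\<bar> \<le> C \<and> \<bar>\<phi> x * pot2 v w x y\<bar> \<le> C" if z: "z \<in> D" for z
  proof -
    obtain r C where r: "r > 0" and C: "\<forall>y\<in>D \<inter> ball z r. \<forall>w\<in>D. \<forall>u\<in>{1, \<i>}. \<forall>v\<in>{1, \<i>}.
       \<bar>pot w y\<bar> \<le> C \<and> \<bar>pot1 u w y\<bar> \<le> C \<and> \<bar>pot2 u v w y\<bar> \<le> C"
      using pot_local_bounds[OF z] by blast
    show ?thesis
      unfolding abs_mult
      by (rule exI[of _ r], intro conjI r, rule exI[of _ "B * C"], intro ballI conjI mult_mono)
        (use C \<phi> bdm_nonneg[OF \<phi>] in \<open>auto simp: bdm_def space_LD\<close>)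
  qed
  note F = Ck2_integral[of LD D "\<lambda>z w. \<phi> w * pot w z" "\<lambda>v z w. \<phi> w * pot1 v w z" "\<lambda>u v z w. \<phi> w * pot2 u v w z",
      OF finite_LD open_D m d1 d2 c0 c1 c2 bd]
  have eqs: "Kpot \<phi> = (\<lambda>z. \<integral>w. \<phi> w * pot w z \<partial>LD)" "\<And>v. Kpot1 \<phi> v = (\<lambda>z. \<integral>w. \<phi> w * pot1 v w z \<partial>LD)"
    by (simp_all add: Kpot_def Kpot1_def fun_eq_iff)
  have C: "Ck_on 2 D (Kpot \<phi>)" unfolding eqs using F(1) by blast
  have "lap (Kpot \<phi>) z = 0" if z: "z \<in> D" for z
  proof -
    have "lap (Kpot \<phi>) z = (\<integral>w. \<phi> w * pot2 1 1 w z \<partial>LD) + (\<integral>w. \<phi> w * pot2 \<i> \<i> w z \<partial>LD)"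
      unfolding eqs using F(2) z by blast
    also have "(\<integral>w. \<phi> w * pot2 \<i> \<i> w z \<partial>LD) = (\<integral>w. - (\<phi> w * pot2 1 1 w z) \<partial>LD)"
    proof (rule Bochner_Integration.integral_cong[OF refl])
      fix w assume "w \<in> space LD"
      then have "pot2 \<i> \<i> w z = - pot2 1 1 w z" using pot_facts(7)[of w z] z by (simp add: space_LD)
      then show "\<phi> w * pot2 \<i> \<i> w z = - (\<phi> w * pot2 1 1 w z)" by simp
    qed
    finally show ?thesis by simp
  qed
  with C show "has_lap D (Kpot \<phi>) (\<lambda>_. 0)" by (simp add: has_lap_def)
  show "has_pd (Kpot \<phi>) (Kpot1 \<phi> v z) v z" if "v \<in> {1, \<i>}" "z \<in> D" for v z
    unfolding eqs using F(3) that by blast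
  show "continuous_on D (Kpot \<phi>)" unfolding eqs using F(5) by blast
  show "continuous_on D (Kpot1 \<phi> v)" if "v \<in> {1, \<i>}" for v unfolding eqs using F(6) that by blast
qed

lemma Gop_eq:
  assumes \<phi>: "bdm \<phi> B" and z: "z \<in> D"
  shows "Gop \<phi> z = conv (logd 0) (\<lambda>w. \<phi> w * indicator D w) z - Kpot \<phi> z"
proof -
  interpret finite_measure LD by (rule finite_LD)
  interpret bounded_density "\<lambda>w. \<phi> w * indicator D w" B R by (rule bdm_density[OF \<phi>])
  have zR: "z \<in> ball 0 R" using z D_subset_ball by auto
  have "integrable lborel (\<lambda>w. \<phi> w * indicator D w * logd 0 (z - w))"
    by (rule conv_integrable[OF _ integrable_ball_logd zR]) auto
  then have 1: "integrable LD (\<lambda>w. \<phi> w * logd 0 (z - w))"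
    by (simp add: integrable_LD mult_ac)
  obtain C where C: "\<And>w. w \<in> D \<Longrightarrow> \<bar>pot w z\<bar> \<le> C"
    using pot_local_bounds[OF z] z by fastforce
  have 2: "integrable LD (\<lambda>w. \<phi> w * pot w z)"
  proof (rule integrable_const_bound[of _ "B * C"])
    show "AE w in LD. norm (\<phi> w * pot w z) \<le> B * C"
      using \<phi> C bdm_nonneg[OF \<phi>] by (intro AE_I2) (auto simp: bdm_def space_LD abs_mult intro!: mult_mono)
    show "(\<lambda>w. \<phi> w * pot w z) \<in> borel_measurable LD"
      using \<phi> pot_measurable[OF z] by (auto simp: bdm_def)
  qed
  have "Gop \<phi> z = (\<integral>w. \<phi> w * logd 0 (z - w) - \<phi> w * pot w z \<partial>LD)"
    unfolding Gop_def
  proof (rule integral_cong_AE)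
    show "AE w in LD. \<phi> w * g z w = \<phi> w * logd 0 (z - w) - \<phi> w * pot w z"
      using AE_LD_neq[of z] AE_space[of LD]
    proof eventually_elim
      case (elim w)
      then have "g z w = logd 0 (z - w) - pot w z"
        by (simp add: green_eq[OF z] space_LD reg_eq_pot[OF z] logd_minus_commute)
      then show ?case by (simp add: right_diff_distrib)
    qed
  qed (use Gop_integrable[OF \<phi> z] 1 2 in auto)
  also have "\<dots> = (\<integral>w. \<phi> w * logd 0 (z - w) \<partial>LD) - Kpot \<phi> z"
    using 1 2 by (simp add: Kpot_def)
  also have "(\<integral>w. \<phi> w * logd 0 (z - w) \<partial>LD) = conv (logd 0) (\<lambda>w. \<phi> w * indicator D w) z"
    by (simp add: integral_LD conv_def mult_ac)
  finally show ?thesis .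
qed

definition Gop1 where "Gop1 \<phi> v z = conv (logd1 0 v) (\<lambda>w. \<phi> w * indicator D w) z - Kpot1 \<phi> v z"

text \<open>Here \<phi> is merely bounded and measurable. This gain of one derivative starts the
  bootstrap for the fixed point in \<open>dirichlet_polynomial\<close>.\<close>

lemma Gop_C1:
  assumes \<phi>: "bdm \<phi> B"
  shows "\<And>v z. v \<in> {1, \<i>} \<Longrightarrow> z \<in> D \<Longrightarrow> has_pd (Gop \<phi>) (Gop1 \<phi> v z) v z"
    "continuous_on D (Gop \<phi>)" "\<And>v. v \<in> {1, \<i>} \<Longrightarrow> continuous_on D (Gop1 \<phi> v)"
proof -
  interpret bounded_density "\<lambda>w. \<phi> w * indicator D w" B R by (rule bdm_density[OF \<phi>])
  have u: "cmod v = 1" if "v \<in> {1, \<i>}" for v using that by auto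
  show "has_pd (Gop \<phi>) (Gop1 \<phi> v z) v z" if v: "v \<in> {1, \<i>}" and z: "z \<in> D" for v z
    unfolding Gop1_def
    by (rule has_pd_cong[OF open_D z _ has_pd_diff[OF has_pd_conv_logd[OF u[OF v]] Kpot_facts(2)[OF \<phi> v z]]])
      (use Gop_eq[OF \<phi>] z D_subset_ball in auto)
  have c: "continuous_on (ball 0 R) (conv (logd 0) (\<lambda>w. \<phi> w * indicator D w))"
    by (rule uniform_limit_theorem[OF _ conv_logd_approx(1)])
      (auto intro!: always_eventually continuous_on_conv_logd_pos simp: field_simps)
  have "continuous_on D (\<lambda>z. conv (logd 0) (\<lambda>w. \<phi> w * indicator D w) z - Kpot \<phi> z)"
    by (intro continuous_on_diff Kpot_facts(3)[OF \<phi>] continuous_on_subset[OF c D_subset_ball])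
  then show "continuous_on D (Gop \<phi>)"
    by (rule continuous_on_eq) (simp add: Gop_eq[OF \<phi>])
  show "continuous_on D (Gop1 \<phi> v)" if v: "v \<in> {1, \<i>}" for v
    unfolding Gop1_def[abs_def]
    by (intro continuous_on_diff Kpot_facts(4)[OF \<phi> v] continuous_on_subset[OF continuous_on_conv_logd1[OF u[OF v]] D_subset_ball])
qed

text \<open>The logarithmic part contributes \<phi> to the Laplacian, and the remainder
  \<open>Kpot \<phi>\<close> is harmonic.\<close>

lemma Gop_has_lap:
  assumes \<phi>: "bdm \<phi> B" and c0: "continuous_on D \<phi>" and c1: "\<And>v. v \<in> {1, \<i>} \<Longrightarrow> continuous_on D (F v)"
    and d1: "\<And>v z. v \<in> {1, \<i>} \<Longrightarrow> z \<in> D \<Longrightarrow> has_pd \<phi> (F v z) v z"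
  shows "has_lap D (Gop \<phi>) \<phi>"
proof -
  interpret bounded_density "\<lambda>w. \<phi> w * indicator D w" B R by (rule bdm_density[OF \<phi>])
  have "has_lap D (conv (logd 0) (\<lambda>w. \<phi> w * indicator D w)) (\<lambda>w. \<phi> w * indicator D w)"
  proof (rule has_lap_conv_logd[OF open_D D_subset_ball _ c1])
    show "continuous_on D (\<lambda>w. \<phi> w * indicator D w)"
      by (rule continuous_on_eq[OF c0]) simp
    show "has_pd (\<lambda>w. \<phi> w * indicator D w) (F v z) v z" if "v \<in> {1, \<i>}" "z \<in> D" for v z
      by (rule has_pd_cong[OF open_D that(2) _ d1[OF that]]) simp
  qed
  from has_lap_diff[OF open_D this Kpot_facts(1)[OF \<phi>]] show ?thesis
    by (rule has_lap_cong[OF open_D]) (auto simp: Gop_eq[OF \<phi>])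
qed

text \<open>Truncating the kernel at height \<open>n\<close> costs at most \<open>J n\<close> uniformly in \<open>z\<close>; the truncated integral tends to 0 by symmetry
  of the Green function and dominated convergence.\<close>

lemma Gop_boundary:
  assumes \<phi>: "bdm \<phi> B" and p: "p \<in> frontier D"
  shows "(Gop \<phi> \<longlongrightarrow> 0) (at p within D)"
  unfolding tendsto_at_iff_sequentially
proof (intro allI impI)
  fix X assume X: "\<forall>i. X i \<in> D - {p}" and lim: "X \<longlonglongrightarrow> p"
  then have XD: "X i \<in> D" for i by auto
  interpret finite_measure LD by (rule finite_LD)
  have B: "0 \<le> B" by (rule bdm_nonneg[OF \<phi>])
  define tail where "tail M x = gbound x - min (gbound x) M" for M x
  have tm: "tail M \<in> borel_measurable borel" for M
    unfolding tail_def[abs_def] using gbound_kernel(1) by measurable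
  have ti: "integrable lborel (\<lambda>x. indicator (ball 0 r) x * tail M x)" if "M \<ge> 0" for M r
  proof (rule Bochner_Integration.integrable_bound[OF gbound_kernel(2)[of r]])
    show "AE x in lborel. norm (indicator (ball 0 r) x * tail M x) \<le> norm (indicator (ball 0 r) x * gbound x)"
      using that gbound_nonneg by (intro AE_I2) (auto simp: tail_def indicator_def min_def)
  qed (use tm in measurable)
  have tn: "0 \<le> tail M x" for M x by (simp add: tail_def)
  define J where "J M = (\<integral>x. indicator (ball 0 (2 * R)) x * tail M x \<partial>lborel)" for M
  have Jlim: "(\<lambda>n. J (real n)) \<longlonglongrightarrow> 0"
  proof -
    have "(\<lambda>n. J (real n)) \<longlonglongrightarrow> integral\<^sup>L lborel (\<lambda>x::complex. 0::real)"
      unfolding J_def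
    proof (rule integral_dominated_convergence[OF _ _ gbound_kernel(2)[of "2 * R"]])
      show "AE x in lborel. (\<lambda>n. indicator (ball 0 (2 * R)) x * tail (real n) x) \<longlonglongrightarrow> 0"
      proof (rule AE_I2, rule tendsto_mult_right_zero, rule tendsto_eventually)
        fix x
        obtain N where "gbound x \<le> real N" using real_arch_simple by blast
        then show "\<forall>\<^sub>F n in sequentially. tail (real n) x = 0"
          unfolding eventually_sequentially by (intro exI[of _ N]) (auto simp: tail_def min_def)
      qed
      show "AE x in lborel. norm (indicator (ball 0 (2 * R)) x * tail (real n) x) \<le> indicator (ball 0 (2 * R)) x * gbound x" for n
        using gbound_nonneg by (intro AE_I2) (auto simp: tail_def indicator_def min_def)
    qed (use tm in measurable)
    then show ?thesis by simp
  qed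
  have split: "\<bar>Gop \<phi> z\<bar> \<le> B * (\<integral>w. min \<bar>g z w\<bar> (real n) \<partial>LD) + B * J (real n)" if z: "z \<in> D" for z n
  proof -
    have gi: "integrable LD (\<lambda>w. min \<bar>g z w\<bar> (real n))"
      using green_measurable[OF z] by (intro integrable_const_bound[of _ "real n"]) auto
    note tl = gbound_LD[OF z tm ti tn, of "real n"]
    have "\<bar>Gop \<phi> z\<bar> \<le> (\<integral>w. \<bar>\<phi> w * g z w\<bar> \<partial>LD)" unfolding Gop_def by (rule integral_abs_bound)
    also have "\<dots> \<le> (\<integral>w. B * min \<bar>g z w\<bar> (real n) + B * tail (real n) (z - w) \<partial>LD)"
    proof (rule integral_mono_AE)
      show "AE w in LD. \<bar>\<phi> w * g z w\<bar> \<le> B * min \<bar>g z w\<bar> (real n) + B * tail (real n) (z - w)"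
        using AE_green_le[OF z] AE_space[of LD]
      proof eventually_elim
        case (elim w)
        have "\<bar>\<phi> w * g z w\<bar> \<le> B * \<bar>g z w\<bar>"
          using elim(2) \<phi> by (auto simp: abs_mult bdm_def space_LD intro: mult_right_mono)
        also have "\<dots> \<le> B * (min \<bar>g z w\<bar> (real n) + tail (real n) (z - w))"
          using elim(1) B by (intro mult_left_mono) (auto simp: tail_def min_def)
        finally show ?case by (simp add: distrib_left)
      qed
    qed (auto intro!: integrable_abs Gop_integrable[OF \<phi> z] Bochner_Integration.integrable_add integrable_mult_right gi tl(1))
    also have "\<dots> = B * (\<integral>w. min \<bar>g z w\<bar> (real n) \<partial>LD) + B * (\<integral>w. tail (real n) (z - w) \<partial>LD)"
      using gi tl(1) by simp
    also have "\<dots> \<le> B * (\<integral>w. min \<bar>g z w\<bar> (real n) \<partial>LD) + B * J (real n)"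
      using tl(2) B by (auto simp: J_def intro!: mult_left_mono)
    finally show ?thesis .
  qed
  have mlim: "(\<lambda>i. \<integral>w. min \<bar>g (X i) w\<bar> (real n) \<partial>LD) \<longlonglongrightarrow> 0" for n
  proof -
    have "(\<lambda>i. \<integral>w. min \<bar>g (X i) w\<bar> (real n) \<partial>LD) \<longlonglongrightarrow> integral\<^sup>L LD (\<lambda>_. 0::real)"
    proof (rule integral_dominated_convergence[where w = "\<lambda>_. real n"])
      show "(\<lambda>w. min \<bar>g (X i) w\<bar> (real n)) \<in> borel_measurable LD" for i
        using green_measurable[OF XD[of i]] by measurable
      show "AE w in LD. (\<lambda>i. min \<bar>g (X i) w\<bar> (real n)) \<longlonglongrightarrow> 0"
      proof (rule AE_I2)
        fix w assume "w \<in> space LD"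
        then have w: "w \<in> D" by (simp add: space_LD)
        have "filterlim X (at p within D) sequentially"
          using lim X by (auto simp: filterlim_at)
        then have "(\<lambda>i. g w (X i)) \<longlonglongrightarrow> 0"
          by (rule filterlim_compose[OF green_boundary[OF w p]])
        moreover have "\<forall>\<^sub>F i in sequentially. X i \<noteq> w"
          using lim frontier_not_in[OF p] w by (intro tendsto_imp_eventually_ne) auto
        then have "\<forall>\<^sub>F i in sequentially. g w (X i) = g (X i) w"
          by eventually_elim (simp add: green_sym[OF w XD])
        ultimately have "(\<lambda>i. g (X i) w) \<longlonglongrightarrow> 0"
          by (rule Lim_transform_eventually)
        then have "(\<lambda>i. min \<bar>g (X i) w\<bar> (real n)) \<longlonglongrightarrow> min \<bar>0\<bar> (real n)"
          by (intro tendsto_min tendsto_rabs tendsto_const)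
        then show "(\<lambda>i. min \<bar>g (X i) w\<bar> (real n)) \<longlonglongrightarrow> 0" by simp
      qed
    qed (auto simp: min_def)
    then show ?thesis by simp
  qed
  show "(Gop \<phi> \<circ> X) \<longlonglongrightarrow> 0"
  proof (rule LIMSEQ_I)
    fix e :: real assume e: "e > 0"
    have "(\<lambda>n. B * J (real n)) \<longlonglongrightarrow> B * 0" by (intro tendsto_intros Jlim)
    then obtain n where n: "B * J (real n) < e / 2"
      using e order_tendstoD(2)[of _ 0 sequentially "e/2"] eventually_happens'[OF sequentially_bot] by fastforce
    have "(\<lambda>i. B * (\<integral>w. min \<bar>g (X i) w\<bar> (real n) \<partial>LD)) \<longlonglongrightarrow> B * 0" by (intro tendsto_intros mlim)
    then have "\<forall>\<^sub>F i in sequentially. B * (\<integral>w. min \<bar>g (X i) w\<bar> (real n) \<partial>LD) < e / 2"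
      using e order_tendstoD(2)[of _ 0 sequentially "e/2"] by fastforce
    then obtain N where N: "\<And>i. i \<ge> N \<Longrightarrow> B * (\<integral>w. min \<bar>g (X i) w\<bar> (real n) \<partial>LD) < e / 2"
      by (auto simp: eventually_sequentially)
    have "norm ((Gop \<phi> \<circ> X) i - 0) < e" if "i \<ge> N" for i
      using split[OF XD[of i], of n] N[OF that] n by simp
    then show "\<exists>N. \<forall>i\<ge>N. norm ((Gop \<phi> \<circ> X) i - 0) < e" by blast
  qed
qed

end

section \<open>Neumann series and extension to Borel data\<close>

lemma real_polynomial_has_pd:
  fixes p :: "complex \<Rightarrow> real"
  assumes "real_polynomial_function p"
  shows "\<exists>q. real_polynomial_function q \<and> (\<forall>z. has_pd p (q z) v z)"
  using assms
proof induction
  case (linear f)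
  have "has_pd f (f v) v z" for z
  proof -
    have "f (z + of_real t * v) = f z + t * f v" for t
      using linear by (simp add: linear_simps scaleR_conv_of_real[symmetric])
    then show ?thesis
      unfolding has_pd_def by (auto intro!: derivative_eq_intros)
  qed
  then show ?case by (intro exI[of _ "\<lambda>_. f v"]) auto
next
  case (const c)
  then show ?case by (intro exI[of _ "\<lambda>_. 0"]) (auto simp: has_pd_const)
next
  case (add f g)
  then obtain f' g' where "real_polynomial_function f'" "\<forall>z. has_pd f (f' z) v z"
    "real_polynomial_function g'" "\<forall>z. has_pd g (g' z) v z" by blast
  then show ?case by (intro exI[of _ "\<lambda>z. f' z + g' z"]) (auto intro: has_pd_add)
next
  case (mult f g)
  then obtain f' g' where "real_polynomial_function f'" "\<forall>z. has_pd f (f' z) v z"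
    "real_polynomial_function g'" "\<forall>z. has_pd g (g' z) v z" by blast
  with mult show ?case by (intro exI[of _ "\<lambda>z. f' z * g z + f z * g' z"]) (auto intro: has_pd_mult)
qed

lemma real_polynomial_continuous: "real_polynomial_function p \<Longrightarrow> continuous_on S p"
  using continuous_real_polymonial_function continuous_at_imp_continuous_on by blast

lemma real_polynomial_has_lap:
  fixes p :: "complex \<Rightarrow> real"
  assumes p: "real_polynomial_function p" and S: "open S"
  shows "\<exists>L. real_polynomial_function L \<and> has_lap S p L"
proof -
  obtain F where F: "\<And>v. real_polynomial_function (F v)" "\<And>v z. has_pd p (F v z) v z"
    using real_polynomial_has_pd[OF p] by metis
  obtain G where G: "\<And>v w. real_polynomial_function (G v w)" "\<And>v w z. has_pd (F v) (G v w z) w z"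
    using real_polynomial_has_pd[OF F(1)] by metis
  note * = Ck2_I[OF S real_polynomial_continuous[OF p] F(2) real_polynomial_continuous[OF F(1)] G(2) real_polynomial_continuous[OF G(1)]]
  show ?thesis
    using * G(1) by (intro exI[of _ "\<lambda>z. G 1 1 z + G \<i> \<i> z"]) (auto simp: has_lap_def)
qed

section \<open>Neumann series for the operator weighted by u\<close>

locale weighted_green_domain = green_domain +
  fixes u :: "complex \<Rightarrow> real" and u1 :: "complex \<Rightarrow> complex \<Rightarrow> real" and U :: real
  assumes u_cont: "continuous_on D u" and u_pd: "\<And>v z. v \<in> {1, \<i>} \<Longrightarrow> z \<in> D \<Longrightarrow> has_pd u (u1 v z) v z"
    and u1_cont: "\<And>v. v \<in> {1, \<i>} \<Longrightarrow> continuous_on D (u1 v)" and u_bound: "\<And>w. w \<in> D \<Longrightarrow> \<bar>u w\<bar> \<le> U"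
begin

definition T where "T \<phi> = Gop (\<lambda>w. \<phi> w * u w)"
definition q where "q = U * Gconst"

lemma u_bdm: "bdm u U"
  using continuous_imp_measurable_LD[OF u_cont] u_bound by (simp add: bdm_def)

lemma q_nonneg: "0 \<le> q"
  using bdm_nonneg[OF u_bdm] Gconst_nonneg by (simp add: q_def)

lemma abs_T_le: "bdm \<phi> B \<Longrightarrow> z \<in> D \<Longrightarrow> \<bar>T \<phi> z\<bar> \<le> B * q"
  using abs_Gop_le[OF bdm_mult[OF _ u_bdm]] by (simp add: T_def q_def mult.assoc)

lemma T_continuous: "bdm \<phi> B \<Longrightarrow> continuous_on D (T \<phi>)"
  unfolding T_def by (rule Gop_C1(2)[OF bdm_mult[OF _ u_bdm]])

lemma T_bdm: "bdm \<phi> B \<Longrightarrow> bdm (T \<phi>) (B * q)"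
  using abs_T_le continuous_imp_measurable_LD[OF T_continuous] by (auto simp: bdm_def[of "T \<phi>"])

lemma T_cong: "(\<And>w. w \<in> D \<Longrightarrow> \<phi> w = \<psi> w) \<Longrightarrow> T \<phi> z = T \<psi> z"
  unfolding T_def by (rule Gop_cong) simp

lemma T_add: "bdm \<phi> A \<Longrightarrow> bdm \<psi> B \<Longrightarrow> z \<in> D \<Longrightarrow> T (\<lambda>w. \<phi> w + \<psi> w) z = T \<phi> z + T \<psi> z"
  unfolding T_def distrib_right by (rule Gop_add[OF bdm_mult[OF _ u_bdm] bdm_mult[OF _ u_bdm]])

lemma T_cmult: "T (\<lambda>w. c * \<phi> w) z = c * T \<phi> z"
  unfolding T_def mult.assoc by (rule Gop_cmult)

lemma bdm_cmult: "bdm \<phi> B \<Longrightarrow> bdm (\<lambda>w. c * \<phi> w) (\<bar>c\<bar> * B)"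
  using bdm_mult[OF bdm_const[of c]] by simp

lemma T_pow_bdm: "bdm \<phi> B \<Longrightarrow> bdm ((T ^^ n) \<phi>) (B * q ^ n)"
  by (induction n) (auto simp: mult_ac dest: T_bdm)

lemma fixed_point_pow:
  assumes \<phi>: "bdm \<phi> B" and \<phi>0: "bdm \<phi>0 B0" and eq: "\<And>z. z \<in> D \<Longrightarrow> \<phi> z = \<phi>0 z + \<epsilon> * T \<phi> z"
  shows "z \<in> D \<Longrightarrow> (T ^^ n) \<phi> z = (T ^^ n) \<phi>0 z + \<epsilon> * (T ^^ Suc n) \<phi> z"
proof (induction n arbitrary: z)
  case 0
  then show ?case using eq by simp
next
  case (Suc n)
  have "(T ^^ Suc n) \<phi> z = T (\<lambda>w. (T ^^ n) \<phi>0 w + \<epsilon> * (T ^^ Suc n) \<phi> w) z"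
    unfolding funpow.simps(2) o_apply by (rule T_cong) (use Suc.IH in simp)
  also have "\<dots> = T ((T ^^ n) \<phi>0) z + T (\<lambda>w. \<epsilon> * (T ^^ Suc n) \<phi> w) z"
    by (rule T_add[OF T_pow_bdm[OF \<phi>0] bdm_cmult[OF T_pow_bdm[OF \<phi>]] Suc.prems])
  finally show ?case by (simp add: T_cmult)
qed

text \<open>Any bounded fixed point is the sum of the series: the partial sums telescope, with a
  remainder \<epsilon>^N T^N \<phi> of size at most B (\<epsilon> q)^N. No continuity is involved,
  so this applies to solutions with Borel data.\<close>

lemma neumann_series:
  assumes \<phi>: "bdm \<phi> B" and \<phi>0: "bdm \<phi>0 B0" and eq: "\<And>z. z \<in> D \<Longrightarrow> \<phi> z = \<phi>0 z + \<epsilon> * T \<phi> z"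
    and \<epsilon>: "0 \<le> \<epsilon>" "\<epsilon> * q < 1" and z: "z \<in> D"
  shows "(\<lambda>n. \<epsilon> ^ n * (T ^^ n) \<phi>0 z) sums \<phi> z"
proof -
  have part: "(\<Sum>n<N. \<epsilon> ^ n * (T ^^ n) \<phi>0 z) = \<phi> z - \<epsilon> ^ N * (T ^^ N) \<phi> z" for N
  proof (induction N)
    case (Suc N)
    have "(T ^^ N) \<phi>0 z = (T ^^ N) \<phi> z - \<epsilon> * (T ^^ Suc N) \<phi> z"
      using fixed_point_pow[OF \<phi> \<phi>0 eq z, of N] by simp
    then have "\<epsilon> ^ N * (T ^^ N) \<phi>0 z = \<epsilon> ^ N * (T ^^ N) \<phi> z - \<epsilon> ^ Suc N * (T ^^ Suc N) \<phi> z"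
      by (simp only:) (simp add: algebra_simps)
    then show ?case using Suc by (simp only: sum.lessThan_Suc)
  qed simp
  have "(\<lambda>N. \<epsilon> ^ N * (T ^^ N) \<phi> z) \<longlonglongrightarrow> 0"
  proof (rule Lim_null_comparison)
    show "\<forall>\<^sub>F N in sequentially. norm (\<epsilon> ^ N * (T ^^ N) \<phi> z) \<le> B * (\<epsilon> * q) ^ N"
    proof (intro always_eventually allI)
      fix N
      have "\<bar>(T ^^ N) \<phi> z\<bar> \<le> B * q ^ N" using T_pow_bdm[OF \<phi>, of N] z by (simp add: bdm_def)
      then have "\<epsilon> ^ N * \<bar>(T ^^ N) \<phi> z\<bar> \<le> \<epsilon> ^ N * (B * q ^ N)" using \<epsilon> by (intro mult_left_mono) auto
      then show "norm (\<epsilon> ^ N * (T ^^ N) \<phi> z) \<le> B * (\<epsilon> * q) ^ N"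
        using \<epsilon> by (simp add: abs_mult power_mult_distrib mult_ac)
    qed
    have "(\<lambda>N. (\<epsilon> * q) ^ N) \<longlonglongrightarrow> 0" using \<epsilon> q_nonneg by (intro LIMSEQ_power_zero) auto
    then show "(\<lambda>N. B * (\<epsilon> * q) ^ N) \<longlonglongrightarrow> 0" by (rule tendsto_mult_right_zero)
  qed
  then have "(\<lambda>N. \<phi> z - \<epsilon> ^ N * (T ^^ N) \<phi> z) \<longlonglongrightarrow> \<phi> z - 0" by (intro tendsto_intros)
  then show ?thesis by (simp add: sums_def part)
qed

text \<open>The second conjunct keeps the partial sums bounded and measurable, as additivity of
  \<open>T\<close> requires at each step of the induction.\<close>

lemma T_sum:
  assumes "\<And>i. i < (N::nat) \<Longrightarrow> \<exists>A. bdm (a i) A" and z: "z \<in> D"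
  shows "T (\<lambda>w. \<Sum>i<N. a i w) z = (\<Sum>i<N. T (a i) z) \<and> (\<exists>A. bdm (\<lambda>w. \<Sum>i<N. a i w) A)"
  using assms(1)
proof (induction N)
  case 0
  then show ?case using T_cmult[of 0 "\<lambda>_. 0" z] bdm_const[of 0] by auto
next
  case (Suc N)
  obtain A A' where A: "bdm (a N) A" "bdm (\<lambda>w. \<Sum>i<N. a i w) A'" using Suc by force
  then show ?case using Suc T_add[OF A(2,1) z] bdm_add[OF A(2,1)] by auto
qed

text \<open>The Neumann series converges uniformly, and \<open>T\<close> passes through the limit
  because it is bounded in the sup norm.\<close>

lemma fixed_point_exists:
  assumes \<psi>0: "bdm \<psi>0 A" and c: "continuous_on D \<psi>0" and \<epsilon>: "0 \<le> \<epsilon>" "\<epsilon> * q < 1"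
  shows "\<exists>\<psi> B. bdm \<psi> B \<and> continuous_on D \<psi> \<and> (\<forall>z\<in>D. \<psi> z = \<psi>0 z + \<epsilon> * T \<psi> z)"
proof -
  define a where "a n z = \<epsilon> ^ n * (T ^^ n) \<psi>0 z" for n z
  have a_bdm: "bdm (a n) (A * (\<epsilon> * q) ^ n)" for n
    using bdm_cmult[OF T_pow_bdm[OF \<psi>0], of "\<epsilon> ^ n" n] \<epsilon> by (simp add: a_def[abs_def] power_mult_distrib mult_ac)
  have a_cont: "continuous_on D (a n)" for n
    unfolding a_def[abs_def] using c T_continuous[OF T_pow_bdm[OF \<psi>0]]
    by (intro continuous_on_mult_left) (cases n, auto)
  have a_le: "norm (a n z) \<le> A * (\<epsilon> * q) ^ n" if "z \<in> D" for n z
    using a_bdm[of n] that by (simp add: bdm_def)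
  have a_Suc: "a (Suc n) z = \<epsilon> * T (a n) z" for n z
    by (simp add: a_def[abs_def] T_cmult mult_ac)
  define \<psi> where "\<psi> z = (\<Sum>n. a n z)" for z
  have r: "0 \<le> \<epsilon> * q" using \<epsilon> q_nonneg by simp
  have summ: "summable (\<lambda>n. A * (\<epsilon> * q) ^ n)"
    using \<epsilon> r by (intro summable_mult summable_geometric) simp
  have ul: "uniform_limit D (\<lambda>N z. \<Sum>n<N. a n z) \<psi> sequentially"
    unfolding \<psi>_def[abs_def] by (rule Weierstrass_m_test[OF a_le summ])
  have \<psi>_cont: "continuous_on D \<psi>"
    by (rule uniform_limit_theorem[OF _ ul]) (auto intro!: always_eventually continuous_on_sum a_cont)
  have \<psi>_bdm: "bdm \<psi> (\<Sum>n. A * (\<epsilon> * q) ^ n)"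
  proof -
    have "\<bar>\<psi> z\<bar> \<le> (\<Sum>n. A * (\<epsilon> * q) ^ n)" if "z \<in> D" for z
    proof -
      have "summable (\<lambda>n. norm (a n z))"
        by (rule summable_comparison_test'[OF summ, of 0]) (use a_le[OF that] in auto)
      then have "norm (\<psi> z) \<le> (\<Sum>n. norm (a n z))" unfolding \<psi>_def by (rule summable_norm)
      also have "\<dots> \<le> (\<Sum>n. A * (\<epsilon> * q) ^ n)"
        by (rule suminf_le[OF a_le[OF that] \<open>summable (\<lambda>n. norm (a n z))\<close> summ])
      finally show ?thesis by simp
    qed
    then show ?thesis using continuous_imp_measurable_LD[OF \<psi>_cont] by (simp add: bdm_def)
  qed
  have "\<psi> z = \<psi>0 z + \<epsilon> * T \<psi> z" if z: "z \<in> D" for z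
  proof -
    let ?S = "\<lambda>N w. \<Sum>n<N. a n w"
    have Sb: "\<exists>B. bdm (?S N) B" and TS: "T (?S N) z = (\<Sum>n<N. T (a n) z)" for N
      using T_sum[of N a z] a_bdm z by blast+
    have "(\<lambda>N. T (?S N) z) \<longlonglongrightarrow> T \<psi> z"
    proof (rule LIMSEQ_I)
      fix e :: real assume e: "e > 0"
      \<comment> \<open>Adding 1 allows q = 0 and makes \<open>e' * q < e\<close> strict.\<close>
      define e' where "e' = e / (q + 1)"
      have e': "e' > 0" "e' * q < e"
        using e q_nonneg by (auto simp: e'_def field_simps)
      obtain N0 where N0: "\<And>N w. N \<ge> N0 \<Longrightarrow> w \<in> D \<Longrightarrow> \<bar>?S N w - \<psi> w\<bar> < e'"
        using uniform_limitD[OF ul e'(1)] by (auto simp: eventually_sequentially dist_real_def)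
      have "norm (T (?S N) z - T \<psi> z) < e" if N: "N \<ge> N0" for N
      proof -
        obtain B where B: "bdm (?S N) B" using Sb by blast
        have \<psi>': "bdm (\<lambda>w. - 1 * \<psi> w) (\<bar>- 1\<bar> * (\<Sum>n. A * (\<epsilon> * q) ^ n))" by (rule bdm_cmult[OF \<psi>_bdm])
        have "bdm (\<lambda>w. ?S N w + - 1 * \<psi> w) e'"
          using bdm_add[OF B \<psi>'] N0[OF N] by (auto simp: bdm_def intro: less_imp_le)
        then have "\<bar>T (\<lambda>w. ?S N w + - 1 * \<psi> w) z\<bar> \<le> e' * q" by (rule abs_T_le[OF _ z])
        also have "T (\<lambda>w. ?S N w + - 1 * \<psi> w) z = T (?S N) z - T \<psi> z"
          unfolding T_add[OF B \<psi>' z] T_cmult by simp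
        finally show ?thesis using e'(2) by simp
      qed
      then show "\<exists>N0. \<forall>N\<ge>N0. norm (T (?S N) z - T \<psi> z) < e" by blast
    qed
    then have "(\<lambda>N. \<psi>0 z + \<epsilon> * T (?S N) z) \<longlonglongrightarrow> \<psi>0 z + \<epsilon> * T \<psi> z" by (intro tendsto_intros)
    \<comment> \<open>An index shift: the zeroth term is \<psi>0, and \<open>\<epsilon> * T\<close>
      sends each term to the next.\<close>
    moreover have "\<psi>0 z + \<epsilon> * T (?S N) z = ?S (Suc N) z" for N
      unfolding TS sum_distrib_left a_Suc[symmetric] sum.lessThan_Suc_shift by (simp add: a_def)
    ultimately have "(\<lambda>N. ?S (Suc N) z) \<longlonglongrightarrow> \<psi>0 z + \<epsilon> * T \<psi> z" by simp
    moreover have "(\<lambda>N. ?S (Suc N) z) \<longlonglongrightarrow> \<psi> z"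
      using tendsto_uniform_limitI[OF ul z] by (rule LIMSEQ_Suc)
    ultimately show ?thesis using LIMSEQ_unique by blast
  qed
  then show ?thesis using \<psi>_bdm \<psi>_cont by blast
qed

lemma continuous_bounded_bdm:
  assumes "continuous_on (closure D) f"
  shows "\<exists>B. bdm f B"
proof -
  have "compact (closure D)" using bounded_D by (simp add: compact_closure)
  then have "bounded (f ` closure D)" using assms by (intro compact_imp_bounded compact_continuous_image)
  then obtain B where "\<And>z. z \<in> closure D \<Longrightarrow> \<bar>f z\<bar> \<le> B" by (auto simp: bounded_iff)
  then have "bdm f B"
    using continuous_imp_measurable_LD[of f] continuous_on_subset[OF assms closure_subset] closure_subset
    by (auto simp: bdm_def subset_eq)
  then show ?thesis ..
qed

text \<open>The fixed point \<psi> is at first only continuous. Its equation gives it one derivative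
  by \<open>Gop_C1\<close>, and with the C^1 density \<open>\<psi> * u\<close> a second one by
  \<open>Gop_has_lap\<close>. The boundary values come from \<psi>0 alone, since
  \<open>T \<psi>\<close> tends to 0 there.\<close>

lemma dirichlet_polynomial:
  assumes H: "real_polynomial_function H" and \<epsilon>: "0 \<le> \<epsilon>" "\<epsilon> * q < 1"
  shows "\<exists>\<psi>0 \<psi> B. has_lap D \<psi>0 (\<lambda>_. 0) \<and> (\<forall>p\<in>frontier D. (\<psi>0 \<longlongrightarrow> H p) (at p within D)) \<and>
     has_lap D \<psi> (\<lambda>w. \<epsilon> * u w * \<psi> w) \<and> (\<forall>p\<in>frontier D. (\<psi> \<longlongrightarrow> H p) (at p within D)) \<and>
     bdm \<psi> B \<and> continuous_on D \<psi> \<and> (\<forall>z\<in>D. \<psi> z = \<psi>0 z + \<epsilon> * T \<psi> z)"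
proof -
  obtain L where L: "real_polynomial_function L" "has_lap D H L"
    using real_polynomial_has_lap[OF H open_D] by blast
  obtain BL where BL: "bdm L BL"
    using continuous_bounded_bdm[OF real_polynomial_continuous[OF L(1)]] by blast
  obtain BH where BH: "bdm H BH"
    using continuous_bounded_bdm[OF real_polynomial_continuous[OF H]] by blast
  obtain FL where FL: "\<And>v. real_polynomial_function (FL v)" "\<And>v z. has_pd L (FL v z) v z"
    using real_polynomial_has_pd[OF L(1)] by metis
  obtain FH where FH: "\<And>v. real_polynomial_function (FH v)" "\<And>v z. has_pd H (FH v z) v z"
    using real_polynomial_has_pd[OF H] by metis
  have GL: "has_lap D (Gop L) L"
    by (rule Gop_has_lap[OF BL real_polynomial_continuous[OF L(1)] real_polynomial_continuous[OF FL(1)] FL(2)])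
  define \<psi>0 where "\<psi>0 z = H z - Gop L z" for z
  have lap0: "has_lap D \<psi>0 (\<lambda>_. 0)"
    unfolding \<psi>0_def[abs_def] using has_lap_diff[OF open_D L(2) GL] by simp
  have lim0: "(\<psi>0 \<longlongrightarrow> H p) (at p within D)" if "p \<in> frontier D" for p
  proof -
    have "(H \<longlongrightarrow> H p) (at p within D)"
      using real_polynomial_continuous[OF H, of UNIV] by (simp add: continuous_on_def Lim_at_imp_Lim_at_within)
    from tendsto_diff[OF this Gop_boundary[OF BL that]] show ?thesis by (simp add: \<psi>0_def[abs_def])
  qed
  have c0: "continuous_on D \<psi>0" by (rule has_lap_continuous_on[OF lap0])
  have b0: "bdm \<psi>0 (BH + BL * Gconst)"
    using BH abs_Gop_le[OF BL] continuous_imp_measurable_LD[OF c0]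
    by (fastforce simp: bdm_def \<psi>0_def[abs_def] intro: abs_triangle_ineq4[THEN order_trans] add_mono)
  obtain \<psi> B where \<psi>: "bdm \<psi> B" "continuous_on D \<psi>" and eq: "\<And>z. z \<in> D \<Longrightarrow> \<psi> z = \<psi>0 z + \<epsilon> * T \<psi> z"
    using fixed_point_exists[OF b0 c0 \<epsilon>] by blast
  have bu: "bdm (\<lambda>w. \<psi> w * u w) (B * U)" by (rule bdm_mult[OF \<psi>(1) u_bdm])
  define F where "F v z = (FH v z - Gop1 L v z) + \<epsilon> * Gop1 (\<lambda>w. \<psi> w * u w) v z" for v z
  have dF: "has_pd \<psi> (F v z) v z" if "v \<in> {1, \<i>}" "z \<in> D" for v z
  proof (rule has_pd_cong[OF open_D that(2)])
    show "has_pd (\<lambda>z. (H z - Gop L z) + \<epsilon> * T \<psi> z) (F v z) v z"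
      unfolding F_def T_def by (intro has_pd_add has_pd_diff has_pd_cmult FH Gop_C1(1)[OF BL that] Gop_C1(1)[OF bu that])
  qed (simp add: eq \<psi>0_def)
  have cF: "continuous_on D (F v)" if "v \<in> {1, \<i>}" for v
    unfolding F_def[abs_def]
    by (intro continuous_intros real_polynomial_continuous[OF FH(1)] Gop_C1(3)[OF BL that] Gop_C1(3)[OF bu that])
  have GT: "has_lap D (T \<psi>) (\<lambda>w. \<psi> w * u w)"
    unfolding T_def
    by (rule Gop_has_lap[OF bu, where F = "\<lambda>v z. F v z * u z + \<psi> z * u1 v z"])
      (auto intro!: continuous_intros has_pd_mult \<psi>(2) u_cont cF u1_cont dF u_pd)
  have lap: "has_lap D \<psi> (\<lambda>w. \<epsilon> * u w * \<psi> w)"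
    by (rule has_lap_cong[OF open_D has_lap_add[OF open_D lap0 has_lap_cmult[OF open_D GT, of \<epsilon>]]])
      (auto simp: eq mult_ac)
  have lim: "(\<psi> \<longlongrightarrow> H p) (at p within D)" if "p \<in> frontier D" for p
  proof -
    have "((\<lambda>z. \<psi>0 z + \<epsilon> * T \<psi> z) \<longlongrightarrow> H p + \<epsilon> * 0) (at p within D)"
      unfolding T_def by (intro tendsto_intros lim0 that Gop_boundary[OF bu])
    moreover have "\<forall>\<^sub>F z in at p within D. \<psi>0 z + \<epsilon> * T \<psi> z = \<psi> z"
      by (simp add: eventually_at_filter eq)
    ultimately show ?thesis using Lim_transform_eventually by fastforce
  qed
  show ?thesis using lap0 lim0 lap lim \<psi> eq by blast
qed

end

section \<open>From polynomial to bounded Borel boundary data\<close>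

locale perturbed_domain = weighted_green_domain +
  fixes \<epsilon> :: real and n :: "complex \<Rightarrow> complex measure"
  assumes eps: "0 \<le> \<epsilon>" "\<epsilon> * q < 1"
    and n_fin: "\<And>z. z \<in> D \<Longrightarrow> finite_measure (n z)"
    and n_space: "\<And>z. z \<in> D \<Longrightarrow> space (n z) = frontier D"
    and n_sets: "\<And>z. z \<in> D \<Longrightarrow> sets (n z) = sets (restrict_space borel (frontier D))"
    and n_rep: "\<And>z h \<psi>. z \<in> D \<Longrightarrow> continuous_on (frontier D) h \<Longrightarrow> dirichlet_classical D (\<lambda>w. \<epsilon> * u w) h \<psi> \<Longrightarrow>
       \<psi> z = integral\<^sup>L (n z) h"
begin

definition I :: "(complex \<Rightarrow> real) \<Rightarrow> complex \<Rightarrow> real" where "I f w = integral\<^sup>L (n w) f"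

text \<open>The identity to be extended from polynomial to Borel boundary data.\<close>

definition resolvent_id :: "(complex \<Rightarrow> real) \<Rightarrow> bool" where
  "resolvent_id f \<longleftrightarrow> f \<in> borel_measurable borel \<and> (\<exists>C. \<forall>x\<in>frontier D. \<bar>f x\<bar> \<le> C) \<and> (\<exists>B. bdm (I f) B) \<and>
     (\<forall>z\<in>D. I f z = integral\<^sup>L (m z) f + \<epsilon> * T (I f) z)"

lemma measurable_n: "z \<in> D \<Longrightarrow> f \<in> borel_measurable borel \<Longrightarrow> f \<in> borel_measurable (n z)"
  by (subst measurable_cong_sets[OF n_sets refl]) (auto intro: measurable_restrict_space1)

lemma measurable_m: "z \<in> D \<Longrightarrow> f \<in> borel_measurable borel \<Longrightarrow> f \<in> borel_measurable (m z)"
  by (subst measurable_cong_sets[OF m_sets refl]) (auto intro: measurable_restrict_space1)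

lemma integrable_n:
  fixes f :: "complex \<Rightarrow> real"
  assumes "z \<in> D" "f \<in> borel_measurable borel" "\<And>x. x \<in> frontier D \<Longrightarrow> \<bar>f x\<bar> \<le> C"
  shows "integrable (n z) f"
proof -
  interpret finite_measure "n z" by (rule n_fin[OF assms(1)])
  show ?thesis
    using assms measurable_n by (intro integrable_const_bound[of _ C]) (auto simp: n_space)
qed

lemma integrable_m:
  fixes f :: "complex \<Rightarrow> real"
  assumes "z \<in> D" "f \<in> borel_measurable borel" "\<And>x. x \<in> frontier D \<Longrightarrow> \<bar>f x\<bar> \<le> C"
  shows "integrable (m z) f"
proof -
  interpret finite_measure "m z" by (rule m_fin[OF assms(1)])
  show ?thesis
    using assms measurable_m by (intro integrable_const_bound[of _ C]) (auto simp: m_space)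
qed

lemma resolvent_id_polynomial:
  assumes H: "real_polynomial_function H"
  shows "resolvent_id H"
proof -
  obtain \<psi>0 \<psi> B where \<psi>: "has_lap D \<psi>0 (\<lambda>_. 0)" "\<forall>p\<in>frontier D. (\<psi>0 \<longlongrightarrow> H p) (at p within D)"
     "has_lap D \<psi> (\<lambda>w. \<epsilon> * u w * \<psi> w)" "\<forall>p\<in>frontier D. (\<psi> \<longlongrightarrow> H p) (at p within D)"
     "bdm \<psi> B" "continuous_on D \<psi>" "\<forall>z\<in>D. \<psi> z = \<psi>0 z + \<epsilon> * T \<psi> z"
    using dirichlet_polynomial[OF H eps] by blast
  have c: "continuous_on S H" for S by (rule real_polynomial_continuous[OF H])
  have I: "\<psi> z = I H z" if "z \<in> D" for z
    using n_rep[OF that c has_lap_imp_dirichlet_classical[OF open_D \<psi>(3) c]] \<psi>(4) that by (simp add: I_def)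
  have m: "\<psi>0 z = integral\<^sup>L (m z) H" if "z \<in> D" for z
    using harmonic_representation[OF \<psi>(1) c _ that] \<psi>(2) by blast
  have "bdm (I H) B"
    using \<psi>(5) I measurable_cong[of LD \<psi> "I H" borel] by (auto simp: bdm_def space_LD)
  moreover have "I H z = integral\<^sup>L (m z) H + \<epsilon> * T (I H) z" if "z \<in> D" for z
    using \<psi>(7) that I m T_cong[of \<psi> "I H" z] by auto
  moreover have "\<exists>C. \<forall>x\<in>frontier D. \<bar>H x\<bar> \<le> C"
  proof -
    have "compact (frontier D)" using bounded_D by (simp add: compact_frontier_bounded)
    then have "bounded (H ` frontier D)" using c by (intro compact_imp_bounded compact_continuous_image)
    then show ?thesis by (auto simp: bounded_iff)
  qed
  ultimately show ?thesis
    using c by (auto simp: resolvent_id_def intro: borel_measurable_continuous_onI)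
qed

text \<open>The total mass at w is \<open>I (\<lambda>_. 1) w\<close>, and
  \<open>resolvent_id\<close> includes its boundedness in w.\<close>

lemma mass_bound: "\<exists>B1\<ge>0. \<forall>w\<in>D. measure (n w) (space (n w)) \<le> B1"
proof -
  have "resolvent_id (\<lambda>_. 1)" by (rule resolvent_id_polynomial) (rule real_polynomial_function.intros(2))
  then obtain B where B: "bdm (I (\<lambda>_. 1)) B" by (auto simp: resolvent_id_def)
  then have "measure (n w) (space (n w)) \<le> B" if "w \<in> D" for w
    using that by (auto simp: bdm_def I_def)
  then show ?thesis using bdm_nonneg[OF B] by blast
qed

lemma abs_I_le: "\<exists>B1\<ge>0. \<forall>f C. f \<in> borel_measurable borel \<longrightarrow> (\<forall>x\<in>frontier D. \<bar>f x\<bar> \<le> C) \<longrightarrow> 0 \<le> C \<longrightarrow> (\<forall>w\<in>D. \<bar>I f w\<bar> \<le> C * B1)"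
proof -
  obtain B1 where B1: "B1 \<ge> 0" "\<And>w. w \<in> D \<Longrightarrow> measure (n w) (space (n w)) \<le> B1" using mass_bound by blast
  have "\<bar>I f w\<bar> \<le> C * B1" if f: "f \<in> borel_measurable borel" "\<And>x. x \<in> frontier D \<Longrightarrow> \<bar>f x\<bar> \<le> C" "0 \<le> C" and w: "w \<in> D" for f C w
  proof -
    interpret finite_measure "n w" by (rule n_fin[OF w])
    have "\<bar>I f w\<bar> \<le> (\<integral>x. \<bar>f x\<bar> \<partial>n w)" unfolding I_def by (rule integral_abs_bound)
    also have "\<dots> \<le> (\<integral>x. C \<partial>n w)"
      using integrable_n[OF w f(1,2)] f(2) n_space[OF w] by (intro integral_mono) auto
    also have "\<dots> \<le> C * B1" using mult_left_mono[OF B1(2)[OF w] f(3)] by (simp add: mult.commute)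
    finally show ?thesis .
  qed
  then show ?thesis using B1(1) by blast
qed

lemma resolvent_id_linear:
  assumes f: "resolvent_id f" and h: "resolvent_id h"
  shows "resolvent_id (\<lambda>x. a * f x + b * h x)"
proof -
  obtain Cf Ch Bf Bh where f': "f \<in> borel_measurable borel" "\<And>x. x \<in> frontier D \<Longrightarrow> \<bar>f x\<bar> \<le> Cf" "bdm (I f) Bf"
      "\<And>z. z \<in> D \<Longrightarrow> I f z = integral\<^sup>L (m z) f + \<epsilon> * T (I f) z"
    and h': "h \<in> borel_measurable borel" "\<And>x. x \<in> frontier D \<Longrightarrow> \<bar>h x\<bar> \<le> Ch" "bdm (I h) Bh"
      "\<And>z. z \<in> D \<Longrightarrow> I h z = integral\<^sup>L (m z) h + \<epsilon> * T (I h) z"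
    using f h unfolding resolvent_id_def by blast
  let ?k = "\<lambda>x. a * f x + b * h x"
  have Ik: "I ?k w = a * I f w + b * I h w" if "w \<in> D" for w
    using integrable_n[OF that f'(1,2)] integrable_n[OF that h'(1,2)] by (simp add: I_def)
  have mk: "integral\<^sup>L (m w) ?k = a * integral\<^sup>L (m w) f + b * integral\<^sup>L (m w) h" if "w \<in> D" for w
    using integrable_m[OF that f'(1,2)] integrable_m[OF that h'(1,2)] by simp
  have B: "bdm (\<lambda>w. a * I f w + b * I h w) (\<bar>a\<bar> * Bf + \<bar>b\<bar> * Bh)"
    by (intro bdm_add bdm_cmult f' h')
  have "bdm (I ?k) (\<bar>a\<bar> * Bf + \<bar>b\<bar> * Bh)"
    using B measurable_cong[of LD "I ?k" "\<lambda>w. a * I f w + b * I h w" borel] Ik by (auto simp: bdm_def space_LD)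
  moreover have "I ?k z = integral\<^sup>L (m z) ?k + \<epsilon> * T (I ?k) z" if z: "z \<in> D" for z
  proof -
    have "T (I ?k) z = T (\<lambda>w. a * I f w + b * I h w) z" by (rule T_cong) (rule Ik)
    also have "\<dots> = a * T (I f) z + b * T (I h) z"
      by (subst T_add[OF bdm_cmult[OF f'(3)] bdm_cmult[OF h'(3)] z]) (simp add: T_cmult)
    finally show ?thesis unfolding Ik[OF z] mk[OF z] f'(4)[OF z] h'(4)[OF z] by (simp add: algebra_simps)
  qed
  moreover have "\<exists>C. \<forall>x\<in>frontier D. \<bar>?k x\<bar> \<le> C"
  proof (intro exI ballI)
    fix x assume x: "x \<in> frontier D"
    have "\<bar>?k x\<bar> \<le> \<bar>a\<bar> * \<bar>f x\<bar> + \<bar>b\<bar> * \<bar>h x\<bar>" using abs_triangle_ineq[of "a * f x" "b * h x"] by (simp add: abs_mult)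
    also have "\<dots> \<le> \<bar>a\<bar> * Cf + \<bar>b\<bar> * Ch" using f'(2)[OF x] h'(2)[OF x] by (intro add_mono mult_left_mono) auto
    finally show "\<bar>?k x\<bar> \<le> \<bar>a\<bar> * Cf + \<bar>b\<bar> * Ch" .
  qed
  ultimately show ?thesis using f'(1) h'(1) by (auto simp: resolvent_id_def)
qed

text \<open>Dominated convergence three times: against \<open>n w\<close>, against
  \<open>m w\<close>, and inside \<open>T\<close>. Measurability of \<open>I f\<close> passes to the
  limit too; it cannot be read off from the measures, which are given for each w separately.\<close>

lemma resolvent_id_limit:
  assumes k: "\<And>i. resolvent_id (fk i)" and b: "\<And>i x. x \<in> frontier D \<Longrightarrow> \<bar>fk i x\<bar> \<le> C"
    and f: "f \<in> borel_measurable borel" and lim: "\<And>x. x \<in> frontier D \<Longrightarrow> (\<lambda>i. fk i x) \<longlonglongrightarrow> f x"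
  shows "resolvent_id f"
proof -
  define C' where "C' = max C 0"
  have b': "\<bar>fk i x\<bar> \<le> C'" if "x \<in> frontier D" for i x using b[OF that, of i] by (simp add: C'_def)
  have fb: "\<bar>f x\<bar> \<le> C'" if "x \<in> frontier D" for x
    using tendsto_rabs[OF lim[OF that]] b'[OF that] by (intro LIMSEQ_le_const2[of "\<lambda>i. \<bar>fk i x\<bar>"]) auto
  have km: "fk i \<in> borel_measurable borel" "\<exists>B. bdm (I (fk i)) B"
    "\<And>z. z \<in> D \<Longrightarrow> I (fk i) z = integral\<^sup>L (m z) (fk i) + \<epsilon> * T (I (fk i)) z" for i
    using k[of i] by (auto simp: resolvent_id_def)
  obtain B1 where B1: "B1 \<ge> 0" "\<And>f C w. f \<in> borel_measurable borel \<Longrightarrow> (\<And>x. x \<in> frontier D \<Longrightarrow> \<bar>f x\<bar> \<le> C) \<Longrightarrow> 0 \<le> C \<Longrightarrow> w \<in> D \<Longrightarrow> \<bar>I f w\<bar> \<le> C * B1"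
    using abs_I_le by blast
  have C'0: "0 \<le> C'" by (simp add: C'_def)
  have Ilim: "(\<lambda>i. I (fk i) w) \<longlonglongrightarrow> I f w" if w: "w \<in> D" for w
    unfolding I_def
  proof (rule integral_dominated_convergence[where w = "\<lambda>_. C'"])
    interpret finite_measure "n w" by (rule n_fin[OF w])
    show "integrable (n w) (\<lambda>_. C')" by simp
  qed (use lim b' n_space[OF w] f km(1) in \<open>auto intro: measurable_n[OF w]\<close>)
  have mlim: "(\<lambda>i. integral\<^sup>L (m w) (fk i)) \<longlonglongrightarrow> integral\<^sup>L (m w) f" if w: "w \<in> D" for w
  proof (rule integral_dominated_convergence[where w = "\<lambda>_. C'"])
    interpret finite_measure "m w" by (rule m_fin[OF w])
    show "integrable (m w) (\<lambda>_. C')" by simp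
  qed (use lim b' m_space[OF w] f km(1) in \<open>auto intro: measurable_m[OF w]\<close>)
  have Ikm: "I (fk i) \<in> borel_measurable LD" for i using km(2)[of i] by (auto simp: bdm_def)
  have Im: "I f \<in> borel_measurable LD"
    by (rule borel_measurable_LIMSEQ_real[OF _ Ikm]) (use Ilim in \<open>auto simp: space_LD\<close>)
  have Ib: "\<bar>I f w\<bar> \<le> C' * B1" "\<bar>I (fk i) w\<bar> \<le> C' * B1" if "w \<in> D" for w i
    using B1(2)[OF f fb C'0 that] B1(2)[OF km(1) b' C'0 that] by auto
  have Tlim: "(\<lambda>i. T (I (fk i)) z) \<longlonglongrightarrow> T (I f) z" if z: "z \<in> D" for z
    unfolding T_def Gop_def
  proof (rule integral_dominated_convergence[where w = "\<lambda>w. C' * B1 * U * \<bar>g z w\<bar>"])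
    show "integrable LD (\<lambda>w. C' * B1 * U * \<bar>g z w\<bar>)"
      by (intro integrable_mult_right integrable_abs green_integrable z)
    show "(\<lambda>w. I f w * u w * g z w) \<in> borel_measurable LD" "(\<lambda>w. I (fk i) w * u w * g z w) \<in> borel_measurable LD" for i
      using Im Ikm[of i] u_bdm green_measurable[OF z] by (auto simp: bdm_def)
    show "AE w in LD. (\<lambda>i. I (fk i) w * u w * g z w) \<longlonglongrightarrow> I f w * u w * g z w"
      by (intro AE_I2 tendsto_intros Ilim) (simp add: space_LD)
    show "AE w in LD. norm (I (fk i) w * u w * g z w) \<le> C' * B1 * U * \<bar>g z w\<bar>" for i
      using Ib(2) u_bound C'0 B1(1) by (intro AE_I2) (auto simp: space_LD abs_mult intro!: mult_right_mono mult_mono)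
  qed
  have "I f z = integral\<^sup>L (m z) f + \<epsilon> * T (I f) z" if z: "z \<in> D" for z
  proof -
    have "(\<lambda>i. integral\<^sup>L (m z) (fk i) + \<epsilon> * T (I (fk i)) z) \<longlonglongrightarrow> integral\<^sup>L (m z) f + \<epsilon> * T (I f) z"
      by (intro tendsto_intros mlim Tlim z)
    then have "(\<lambda>i. I (fk i) z) \<longlonglongrightarrow> integral\<^sup>L (m z) f + \<epsilon> * T (I f) z" using km(3)[OF z] by simp
    then show ?thesis using Ilim[OF z] LIMSEQ_unique by blast
  qed
  then show ?thesis using f fb Im Ib(1) by (auto simp: resolvent_id_def bdm_def)
qed

lemma resolvent_id_continuous:
  assumes h: "continuous_on UNIV h"
  shows "resolvent_id h"
proof -
  have cf: "compact (frontier D)" using bounded_D by (simp add: compact_frontier_bounded)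
  have "\<exists>p. real_polynomial_function p \<and> (\<forall>x\<in>frontier D. \<bar>h x - p x\<bar> < inverse (real (Suc k)))" for k
    by (rule Stone_Weierstrass_real_polynomial_function[OF cf continuous_on_subset[OF h], of "inverse (real (Suc k))"]) auto
  then obtain p where p: "\<And>k. real_polynomial_function (p k)" "\<And>k x. x \<in> frontier D \<Longrightarrow> \<bar>h x - p k x\<bar> < inverse (real (Suc k))"
    by metis
  have "bounded (h ` frontier D)"
    using cf continuous_on_subset[OF h] by (intro compact_imp_bounded compact_continuous_image) auto
  then obtain C where C: "\<And>x. x \<in> frontier D \<Longrightarrow> \<bar>h x\<bar> \<le> C" by (auto simp: bounded_iff)
  show ?thesis
  proof (rule resolvent_id_limit[OF resolvent_id_polynomial[OF p(1)]])
    show "h \<in> borel_measurable borel" using h by (rule borel_measurable_continuous_onI)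
    show "\<bar>p k x\<bar> \<le> C + 1" if "x \<in> frontier D" for k x
    proof -
      have "inverse (real (Suc k)) \<le> 1" by (simp add: field_simps)
      then show ?thesis using p(2)[OF that, of k] C[OF that] by linarith
    qed
    show "(\<lambda>k. p k x) \<longlonglongrightarrow> h x" if "x \<in> frontier D" for x
    proof (rule LIM_zero_cancel, rule Lim_null_comparison)
      show "\<forall>\<^sub>F k in sequentially. norm (p k x - h x) \<le> inverse (real (Suc k))"
        using p(2)[OF that] by (intro always_eventually) (simp add: abs_minus_commute less_imp_le)
    qed (rule LIMSEQ_inverse_real_of_nat)
  qed
qed

text \<open>Dynkin's argument starting from closed sets, whose indicators are limits of the
  continuous functions max 0 (1 - k dist(x, A)).\<close>

lemma resolvent_id_indicator:
  assumes "A \<in> sets borel"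
  shows "resolvent_id (indicator A)"
proof -
  have "Int_stable {S :: complex set. closed S}" by (auto simp: Int_stable_def)
  moreover have "{S :: complex set. closed S} \<subseteq> Pow UNIV" by simp
  moreover have "A \<in> sigma_sets UNIV {S. closed S}"
    using assms by (simp add: borel_eq_closed)
  ultimately show ?thesis
  proof (induction rule: sigma_sets_induct_disjoint)
    case (basic A)
    then have A: "closed A" by simp
    show ?case
    \<comment> \<open>\<open>infdist x {}\<close> is 0, so for the empty set the approximating
      functions would be constantly 1.\<close>
    proof (cases "A = {}")
      case True
      then show ?thesis using resolvent_id_continuous[of "\<lambda>_. 0"] by (simp add: indicator_def[abs_def])
    next
      case False
      show ?thesis
      proof (rule resolvent_id_limit[where C = 1])
        show "resolvent_id (\<lambda>x. max 0 (1 - real k * infdist x A))" for k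
          by (intro resolvent_id_continuous continuous_intros)
        show "\<bar>max 0 (1 - real k * infdist x A)\<bar> \<le> 1" for k x
          using infdist_nonneg[of x A] by (auto simp: max_def)
        show "indicator A \<in> borel_measurable borel" using A by simp
        show "(\<lambda>k. max 0 (1 - real k * infdist x A)) \<longlonglongrightarrow> indicator A x" for x
        proof (cases "x \<in> A")
          case True
          then show ?thesis by simp
        next
          case x: False
          then have pos: "infdist x A > 0" using infdist_pos_not_in_closed[OF A False] by blast
          obtain N where N: "1 / infdist x A \<le> real N" using real_arch_simple by blast
          have "max 0 (1 - real k * infdist x A) = 0" if "k \<ge> N" for k
          proof -
            have "1 / infdist x A \<le> real k" using N that by linarith
            then show ?thesis using pos by (simp add: field_simps)
          qed
          then have "\<forall>\<^sub>F k in sequentially. max 0 (1 - real k * infdist x A) = 0"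
            unfolding eventually_sequentially by blast
          then show ?thesis using x by (simp add: tendsto_eventually)
        qed
      qed
    qed
  next
    case empty
    then show ?case using resolvent_id_continuous[of "\<lambda>_. 0"] by (simp add: indicator_def[abs_def])
  next
    case (compl A)
    have "resolvent_id (\<lambda>x. 1 * 1 + (- 1) * indicator A x)"
      by (rule resolvent_id_linear[OF resolvent_id_continuous compl(2)]) simp
    also have "(\<lambda>x. 1 * 1 + (- 1) * indicator A x) = (indicator (UNIV - A) :: complex \<Rightarrow> real)"
      by (auto simp: indicator_def)
    finally show ?case .
  next
    case (union A)
    have fin: "resolvent_id (\<lambda>x. \<Sum>i<k. indicator (A i) x)" for k :: nat
    proof (induction k)
      case 0
      then show ?case using resolvent_id_continuous[of "\<lambda>_. 0"] by simp
    next
      case (Suc k)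
      then show ?case using resolvent_id_linear[OF Suc union(3)[of k], of 1 1] by simp
    qed
    have eq: "(\<Sum>i<k. indicator (A i) x) = (indicator (\<Union>i<k. A i) x :: real)" for k x
      using union(1) by (subst indicator_UN_disjoint[symmetric]) (auto simp: disjoint_family_on_def)
    show ?case
    proof (rule resolvent_id_limit[OF fin, where C = 1])
      show "\<bar>\<Sum>i<k. indicator (A i) x\<bar> \<le> (1::real)" for k x
        unfolding eq by (simp add: indicator_def)
      show "indicator (\<Union>i. A i) \<in> borel_measurable borel"
        using union(2) by (intro borel_measurable_indicator sets.countable_UN) (auto simp: borel_eq_closed)
      show "(\<lambda>k. \<Sum>i<k. indicator (A i) x) \<longlonglongrightarrow> (indicator (\<Union>i. A i) x :: real)" for x
        unfolding eq by (rule LIMSEQ_indicator_UN)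
    qed
  qed
qed

lemma resolvent_id_bounded_borel:
  assumes f: "f \<in> borel_measurable borel" and b: "\<And>x. \<bar>f x\<bar> \<le> C"
  shows "resolvent_id f"
proof -
  \<comment> \<open>Boundedness stands inside the induction formula because the induction runs over
    all nonnegative Borel functions; in each case the parts inherit the bound from the
    whole.\<close>
  have nonneg: "(\<exists>C. \<forall>x. \<bar>h x\<bar> \<le> C) \<longrightarrow> resolvent_id h" if "h \<in> borel_measurable borel" "\<And>x. 0 \<le> h x" for h
    using that
  proof (induction rule: borel_measurable_induct_real)
    case (set A)
    then show ?case using resolvent_id_indicator by simp
  next
    case (mult h c)
    show ?case
    proof
      assume "\<exists>C. \<forall>x. \<bar>c * h x\<bar> \<le> C"
      then obtain C where C: "\<And>x. \<bar>c * h x\<bar> \<le> C" by blast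
      show "resolvent_id (\<lambda>x. c * h x)"
      \<comment> \<open>For c = 0 a bound on the product says nothing about
        \<open>h\<close>.\<close>
      proof (cases "c = 0")
        case True
        then show ?thesis using resolvent_id_continuous[of "\<lambda>_. 0"] by simp
      next
        case False
        have "\<bar>h x\<bar> \<le> C / \<bar>c\<bar>" for x
          using C[of x] False by (simp add: abs_mult field_simps)
        then have "resolvent_id h" using mult by blast
        then show ?thesis using resolvent_id_linear[of h h c 0] by simp
      qed
    qed
  next
    case (add h k)
    show ?case
    proof
      assume "\<exists>C. \<forall>x. \<bar>k x + h x\<bar> \<le> C"
      then obtain C where C: "\<And>x. \<bar>k x + h x\<bar> \<le> C" by blast
      have "\<bar>h x\<bar> \<le> C" "\<bar>k x\<bar> \<le> C" for x using C[of x] add.hyps(2)[of x] add.hyps(4)[of x] by auto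
      then have "resolvent_id h" "resolvent_id k" using add.IH by blast+
      then show "resolvent_id (\<lambda>x. k x + h x)" using resolvent_id_linear[of k h 1 1] by simp
    qed
  next
    case (seq V)
    show ?case
    proof
      assume "\<exists>C. \<forall>x. \<bar>h x\<bar> \<le> C"
      then obtain C where C: "\<And>x. \<bar>h x\<bar> \<le> C" by blast
      have Vh: "V i x \<le> h x" for i x
        using seq(3,4) by (intro incseq_le[of "\<lambda>i. V i x"]) (auto simp: incseq_def le_fun_def)
      have Vb: "\<bar>V i x\<bar> \<le> C" for i x using Vh[of i x] seq(2)[of i x] C[of x] by auto
      then have gV: "resolvent_id (V i)" for i using seq(5) by blast
      have hm: "h \<in> borel_measurable borel"
        by (rule borel_measurable_LIMSEQ_real[OF _ seq(1)]) (use seq(4) in auto)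
      show "resolvent_id h" by (rule resolvent_id_limit[OF gV Vb hm]) (use seq(4) in auto)
    qed
  qed
  have "0 \<le> f x + C" "\<bar>f x + C\<bar> \<le> 2 * C" for x using b[of x] by auto
  then have "resolvent_id (\<lambda>x. f x + C)"
    using f by (intro nonneg[rule_format] exI[of _ "2 * C"] allI) auto
  from resolvent_id_linear[OF this resolvent_id_continuous[of "\<lambda>_. 1"], of 1 "- C"] show ?thesis by simp
qed

end

section \<open>The expansion of the perturbed solution\<close>

theorem theorem3:
  fixes D :: "complex set" and u f :: "complex \<Rightarrow> real"
    and g :: "complex \<Rightarrow> complex \<Rightarrow> real"
    and \<phi> :: "real \<Rightarrow> complex \<Rightarrow> real"
  assumes "bounded_domain D" and "C1_boundary D"
    and "smooth_on_closure D u" and "\<forall>w\<in>closure D. u w > 0"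
    and "is_green_function D g"
    and "f \<in> borel_measurable (restrict_space borel (frontier D))"
    and "bounded (f ` frontier D)"
    and "\<forall>\<epsilon>\<ge>0. dirichlet_solution D (\<lambda>w. \<epsilon> * u w) f (\<phi> \<epsilon>)"
  shows "(\<forall>e>0. \<exists>\<delta>>0. \<forall>\<epsilon>. 0 < \<epsilon> \<and> \<epsilon> < \<delta> \<longrightarrow>
            (\<forall>z\<in>D. \<bar>\<phi> \<epsilon> z - \<phi> 0 z - \<epsilon> * (LINT w:D|lborel. u w * \<phi> 0 w * g z w)\<bar> \<le> e * \<epsilon>))
       \<and> (\<exists>\<epsilon>0>0. \<forall>\<epsilon>. 0 \<le> \<epsilon> \<and> \<epsilon> < \<epsilon>0 \<longrightarrow>
            (\<forall>z\<in>D. (\<lambda>n. \<epsilon> ^ n * (Top D u g ^^ n) (\<phi> 0) z) sums \<phi> \<epsilon> z))"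
proof -
  have D: "open D" "bounded D" using assms(1) by (auto simp: bounded_domain_def)
  obtain V v where V: "open V" "closure D \<subseteq> V" "smooth_on V v" and vu: "\<And>w. w \<in> closure D \<Longrightarrow> v w = u w"
    using assms(3) by (auto simp: smooth_on_closure_def)
  have C2: "Ck_on 2 V v" using V(3) by (simp add: smooth_on_def)
  have DV: "D \<subseteq> V" using V(2) closure_subset by blast
  have vD: "v w = u w" if "w \<in> D" for w using vu closure_subset that by blast
  have vc: "continuous_on V v" using Ck2_continuous(1)[OF C2, of 1 1] by simp
  have "compact (closure D)" using D by (simp add: compact_closure)
  then have "bounded (v ` closure D)"
    using continuous_on_subset[OF vc V(2)] by (intro compact_imp_bounded compact_continuous_image)
  then obtain U where U: "\<And>w. w \<in> closure D \<Longrightarrow> \<bar>v w\<bar> \<le> U" by (auto simp: bounded_iff)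
  \<comment> \<open>The guards stand under the quantifiers so that choice yields one total family
    \<open>N\<close> of measures.\<close>
  have "\<forall>\<epsilon> z. \<exists>\<mu>. 0 \<le> \<epsilon> \<longrightarrow> z \<in> D \<longrightarrow> finite_measure \<mu> \<and> space \<mu> = frontier D \<and>
        sets \<mu> = sets (restrict_space borel (frontier D)) \<and>
        (\<forall>h \<psi>. continuous_on (frontier D) h \<longrightarrow> dirichlet_classical D (\<lambda>w. \<epsilon> * u w) h \<psi> \<longrightarrow>
                 \<psi> z = integral\<^sup>L \<mu> h) \<and> \<phi> \<epsilon> z = integral\<^sup>L \<mu> f"
    using assms(8) unfolding dirichlet_solution_def by blast
  then obtain N where N: "\<forall>\<epsilon> z. 0 \<le> \<epsilon> \<longrightarrow> z \<in> D \<longrightarrow> finite_measure (N \<epsilon> z) \<and> space (N \<epsilon> z) = frontier D \<and>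
        sets (N \<epsilon> z) = sets (restrict_space borel (frontier D)) \<and>
        (\<forall>h \<psi>. continuous_on (frontier D) h \<longrightarrow> dirichlet_classical D (\<lambda>w. \<epsilon> * u w) h \<psi> \<longrightarrow>
                 \<psi> z = integral\<^sup>L (N \<epsilon> z) h) \<and> \<phi> \<epsilon> z = integral\<^sup>L (N \<epsilon> z) f"
    by metis
  have N_fin: "finite_measure (N \<epsilon> z)" and N_space: "space (N \<epsilon> z) = frontier D"
    and N_sets: "sets (N \<epsilon> z) = sets (restrict_space borel (frontier D))"
    and N_rep: "\<And>h \<psi>. continuous_on (frontier D) h \<Longrightarrow> dirichlet_classical D (\<lambda>w. \<epsilon> * u w) h \<psi> \<Longrightarrow> \<psi> z = integral\<^sup>L (N \<epsilon> z) h"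
    and N_\<phi>: "\<phi> \<epsilon> z = integral\<^sup>L (N \<epsilon> z) f"
    if "0 \<le> \<epsilon>" "z \<in> D" for \<epsilon> z
    using N that by blast+
  \<comment> \<open>The measures at \<epsilon> = 0 serve as harmonic measures.\<close>
  interpret weighted_green_domain D g "N 0" u "\<lambda>w. pd w v" U
  proof (intro weighted_green_domain.intro green_domain.intro weighted_green_domain_axioms.intro)
    show "\<psi> z = integral\<^sup>L (N 0 z) h" if "z \<in> D" "continuous_on (frontier D) h" "dirichlet_classical D (\<lambda>_. 0) h \<psi>" for z h \<psi>
      using N_rep[OF order_refl that(1,2)] that(3) by simp
    show "continuous_on D u"
      by (rule continuous_on_eq[OF continuous_on_subset[OF vc DV]]) (rule vD)
    show "has_pd u (pd w v z) w z" if "w \<in> {1, \<i>}" "z \<in> D" for w z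
      by (rule has_pd_cong[OF D(1) that(2) vD Ck2_D(1)[OF C2 that(1,1)]]) (use that(2) DV in auto)
    show "continuous_on D (pd w v)" if "w \<in> {1, \<i>}" for w
      by (rule continuous_on_subset[OF Ck2_continuous(2)[OF C2 that that] DV])
    show "\<bar>u w\<bar> \<le> U" if "w \<in> D" for w
      using U[of w] vD[OF that] closure_subset that by auto
    show "bounded_domain D" "is_green_function D g" by (rule assms)+
    show "finite_measure (N 0 z)" if "z \<in> D" for z by (rule N_fin[OF order_refl that])
    show "space (N 0 z) = frontier D" if "z \<in> D" for z by (rule N_space[OF order_refl that])
    show "sets (N 0 z) = sets (restrict_space borel (frontier D))" if "z \<in> D" for z
      by (rule N_sets[OF order_refl that])
  qed
  have Top_T: "Top D u g = T"
    unfolding Top_def[abs_def] T_def[abs_def] Gop_def[abs_def] integral_LD set_lebesgue_integral_def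
    by (intro ext Bochner_Integration.integral_cong refl) simp
  have first: "(LINT w:D|lborel. u w * \<phi> 0 w * g z w) = T (\<phi> 0) z" for z
    unfolding Top_T[symmetric] Top_def by (simp add: mult.commute[of "u _"])
  obtain C where C: "\<And>x. x \<in> frontier D \<Longrightarrow> \<bar>f x\<bar> \<le> C" using assms(7) by (auto simp: bounded_iff)
  \<comment> \<open>\<open>f\<close> is Borel on the frontier only. Its extension by 0 is Borel on
    the plane and has the same integrals, since the measures live on the frontier.\<close>
  define f0 where "f0 x = f x * indicator (frontier D) x" for x
  have f0m: "f0 \<in> borel_measurable borel"
    using assms(6) borel_measurable_restrict_space_iff[of "frontier D" borel f]
    by (simp add: f0_def[abs_def] mult.commute frontier_closed borel_closed)
  have f0b: "\<bar>f0 x\<bar> \<le> max C 0" for x using C[of x] by (auto simp: f0_def indicator_def)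
  have int_f0: "integral\<^sup>L (N \<epsilon> z) f0 = \<phi> \<epsilon> z" if "0 \<le> \<epsilon>" "z \<in> D" for \<epsilon> z
    unfolding N_\<phi>[OF that] by (intro Bochner_Integration.integral_cong) (auto simp: f0_def N_space[OF that])
  have main: "(\<exists>B. bdm (\<phi> \<epsilon>) B) \<and> (\<forall>z\<in>D. \<phi> \<epsilon> z = \<phi> 0 z + \<epsilon> * T (\<phi> \<epsilon>) z)"
    if \<epsilon>: "0 \<le> \<epsilon>" "\<epsilon> * q < 1" for \<epsilon>
  proof -
    interpret perturbed_domain D g "N 0" u "\<lambda>w. pd w v" U \<epsilon> "N \<epsilon>"
    proof (intro perturbed_domain.intro perturbed_domain_axioms.intro weighted_green_domain_axioms)
      show "0 \<le> \<epsilon>" "\<epsilon> * q < 1" by (rule \<epsilon>)+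
      show "finite_measure (N \<epsilon> z)" if "z \<in> D" for z by (rule N_fin[OF \<epsilon>(1) that])
      show "space (N \<epsilon> z) = frontier D" if "z \<in> D" for z by (rule N_space[OF \<epsilon>(1) that])
      show "sets (N \<epsilon> z) = sets (restrict_space borel (frontier D))" if "z \<in> D" for z
        by (rule N_sets[OF \<epsilon>(1) that])
      show "\<psi> z = integral\<^sup>L (N \<epsilon> z) h"
        if "z \<in> D" "continuous_on (frontier D) h" "dirichlet_classical D (\<lambda>w. \<epsilon> * u w) h \<psi>" for z h \<psi>
        by (rule N_rep[OF \<epsilon>(1) that])
    qed
    have "resolvent_id f0" by (rule resolvent_id_bounded_borel[OF f0m f0b])
    then obtain B where B: "bdm (I f0) B" "\<And>z. z \<in> D \<Longrightarrow> I f0 z = integral\<^sup>L (N 0 z) f0 + \<epsilon> * T (I f0) z"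
      by (auto simp: resolvent_id_def)
    have I: "I f0 z = \<phi> \<epsilon> z" if "z \<in> D" for z unfolding I_def by (rule int_f0[OF \<epsilon>(1) that])
    have "bdm (\<phi> \<epsilon>) B"
      using B(1) I measurable_cong[of LD "I f0" "\<phi> \<epsilon>" borel] by (auto simp: bdm_def space_LD)
    moreover have "\<phi> \<epsilon> z = \<phi> 0 z + \<epsilon> * T (\<phi> \<epsilon>) z" if z: "z \<in> D" for z
      using B(2)[OF z] T_cong[of "I f0" "\<phi> \<epsilon>" z] I int_f0[OF order_refl z] z by simp
    ultimately show ?thesis by blast
  qed
  obtain B0 where B0: "bdm (\<phi> 0) B0" using main[of 0] by auto
  \<comment> \<open>Keeps \<epsilon> q at most 1/2, so that the geometric bounds are uniform in
    \<epsilon>; the added 1 covers q = 0.\<close>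
  define \<epsilon>0 where "\<epsilon>0 = 1 / (2 * (q + 1))"
  have \<epsilon>0: "\<epsilon>0 > 0" using q_nonneg by (simp add: \<epsilon>0_def)
  have small: "\<epsilon> * q \<le> 1 / 2" if "0 \<le> \<epsilon>" "\<epsilon> < \<epsilon>0" for \<epsilon>
  proof -
    have "\<epsilon> * (q + 1) \<le> \<epsilon>0 * (q + 1)" using that q_nonneg by (intro mult_right_mono) auto
    also have "\<dots> = 1 / 2" using q_nonneg by (simp add: \<epsilon>0_def)
    finally show ?thesis using that by (simp add: distrib_left)
  qed
  have series: "(\<lambda>n. \<epsilon> ^ n * (T ^^ n) (\<phi> 0) z) sums \<phi> \<epsilon> z" if e: "0 \<le> \<epsilon>" "\<epsilon> < \<epsilon>0" "z \<in> D" for \<epsilon> z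
  proof -
    have s: "\<epsilon> * q < 1" using small[OF e(1,2)] by simp
    obtain B where "bdm (\<phi> \<epsilon>) B" using main[OF e(1) s] by blast
    then show ?thesis
      using neumann_series[OF _ B0 _ e(1) s e(3)] main[OF e(1) s] by blast
  qed
  \<comment> \<open>The bound supplied by \<open>main\<close> may depend on \<epsilon>; the series
    gives one that does not.\<close>
  have bound: "\<bar>\<phi> \<epsilon> z\<bar> \<le> 2 * B0" if "0 \<le> \<epsilon>" "\<epsilon> < \<epsilon>0" "z \<in> D" for \<epsilon> z
  proof -
    have "norm (\<phi> \<epsilon> z) \<le> B0 * (1 / (1 - 1 / 2))"
    proof (rule norm_sums_le[OF series[OF that]])
      show "(\<lambda>n. B0 * (1 / 2) ^ n) sums (B0 * (1 / (1 - 1 / 2)))"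
        by (intro sums_mult geometric_sums) simp
      fix n
      have "\<bar>(T ^^ n) (\<phi> 0) z\<bar> \<le> B0 * q ^ n" using T_pow_bdm[OF B0, of n] that(3) by (simp add: bdm_def)
      then have "norm (\<epsilon> ^ n * (T ^^ n) (\<phi> 0) z) \<le> \<epsilon> ^ n * (B0 * q ^ n)"
        using that(1) by (simp add: abs_mult mult_left_mono)
      also have "\<dots> = B0 * (\<epsilon> * q) ^ n" by (simp add: power_mult_distrib)
      also have "\<dots> \<le> B0 * (1 / 2) ^ n"
        using small[OF that(1,2)] bdm_nonneg[OF B0] that(1) q_nonneg by (intro mult_left_mono power_mono) auto
      finally show "norm (\<epsilon> ^ n * (T ^^ n) (\<phi> 0) z) \<le> B0 * (1 / 2) ^ n" .
    qed
    then show ?thesis by simp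
  qed
  \<comment> \<open>Inserting the fixed point equation into itself leaves \<epsilon>^2 times T
    applied twice to \<open>\<phi> \<epsilon>\<close>, so the error is of order \<epsilon>^2
    uniformly in z.\<close>
  have error: "\<bar>\<phi> \<epsilon> z - \<phi> 0 z - \<epsilon> * T (\<phi> 0) z\<bar> \<le> (2 * B0 * q\<^sup>2 * \<epsilon>) * \<epsilon>" if \<epsilon>: "0 \<le> \<epsilon>" "\<epsilon> < \<epsilon>0" and z: "z \<in> D" for \<epsilon> z
  proof -
    have s: "\<epsilon> * q < 1" using small[OF \<epsilon>] by simp
    obtain B where B: "bdm (\<phi> \<epsilon>) B" and eq: "\<And>w. w \<in> D \<Longrightarrow> \<phi> \<epsilon> w = \<phi> 0 w + \<epsilon> * T (\<phi> \<epsilon>) w"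
      using main[OF \<epsilon>(1) s] by blast
    have b2: "bdm (\<phi> \<epsilon>) (2 * B0)" using B bound[OF \<epsilon>] by (simp add: bdm_def)
    have Tb: "bdm (\<lambda>w. \<epsilon> * T (\<phi> \<epsilon>) w) (\<bar>\<epsilon>\<bar> * (2 * B0 * q))" by (rule bdm_cmult[OF T_bdm[OF b2]])
    have "T (\<phi> \<epsilon>) z = T (\<lambda>w. \<phi> 0 w + \<epsilon> * T (\<phi> \<epsilon>) w) z" by (rule T_cong) (rule eq)
    also have "\<dots> = T (\<phi> 0) z + T (\<lambda>w. \<epsilon> * T (\<phi> \<epsilon>) w) z" by (rule T_add[OF B0 Tb z])
    finally have "\<phi> \<epsilon> z - \<phi> 0 z - \<epsilon> * T (\<phi> 0) z = \<epsilon> * T (\<lambda>w. \<epsilon> * T (\<phi> \<epsilon>) w) z"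
      using eq[OF z] by (simp add: algebra_simps)
    moreover have "\<epsilon> * \<bar>T (\<lambda>w. \<epsilon> * T (\<phi> \<epsilon>) w) z\<bar> \<le> \<epsilon> * (\<bar>\<epsilon>\<bar> * (2 * B0 * q) * q)"
      using abs_T_le[OF Tb z] \<epsilon>(1) by (intro mult_left_mono)
    ultimately show ?thesis
      using \<epsilon>(1) by (simp add: abs_mult power2_eq_square mult_ac)
  qed
  show ?thesis
    unfolding first Top_T
  proof (intro conjI allI impI)
    fix e :: real assume e: "e > 0"
    \<comment> \<open>The added 1 makes K positive even if \<open>B0\<close> or \<open>q\<close> is
      0.\<close>
    define K where "K = 2 * B0 * q\<^sup>2 + 1"
    have K: "K > 0" using bdm_nonneg[OF B0] by (simp add: K_def add_nonneg_pos)
    show "\<exists>\<delta>>0. \<forall>\<epsilon>. 0 < \<epsilon> \<and> \<epsilon> < \<delta> \<longrightarrow> (\<forall>z\<in>D. \<bar>\<phi> \<epsilon> z - \<phi> 0 z - \<epsilon> * T (\<phi> 0) z\<bar> \<le> e * \<epsilon>)"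
    proof (rule exI[of _ "min \<epsilon>0 (e / K)"], intro conjI allI impI ballI)
      show "min \<epsilon>0 (e / K) > 0" using \<epsilon>0 e K by simp
      fix \<epsilon> z assume \<epsilon>: "0 < \<epsilon> \<and> \<epsilon> < min \<epsilon>0 (e / K)" and z: "z \<in> D"
      have "2 * B0 * q\<^sup>2 * \<epsilon> \<le> K * \<epsilon>" using \<epsilon> by (intro mult_right_mono) (auto simp: K_def)
      also have "\<dots> \<le> e" using \<epsilon> K by (simp add: field_simps)
      finally have "(2 * B0 * q\<^sup>2 * \<epsilon>) * \<epsilon> \<le> e * \<epsilon>" using \<epsilon> by (intro mult_right_mono) auto
      then show "\<bar>\<phi> \<epsilon> z - \<phi> 0 z - \<epsilon> * T (\<phi> 0) z\<bar> \<le> e * \<epsilon>"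
        by (rule order_trans[rotated]) (rule error, use \<epsilon> z in auto)
    qed
  next
    show "\<exists>\<epsilon>0>0. \<forall>\<epsilon>. 0 \<le> \<epsilon> \<and> \<epsilon> < \<epsilon>0 \<longrightarrow> (\<forall>z\<in>D. (\<lambda>n. \<epsilon> ^ n * (T ^^ n) (\<phi> 0) z) sums \<phi> \<epsilon> z)"
      using \<epsilon>0 series by blast
  qed
qed

end
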